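(* Let $p\geq 2$ be an integer and let $v=(v_k)_{k\geq1}$ be a real sequence, not identically zero, satisfying $\sum_{k=1}^\infty v_k^2d_{p,k}<\infty$. Put $k_v:=\min\{k:v_k\neq 0\}$. Let $f$ be an angular function that is infinitely many times differentiable at zero. Let $(\kappa_n)$ be a positive real sequence with $\kappa_n=o(1)$. Fix $\tau>0$ and put, for each positive integer $k$, $$ \xi_{p,k}(\tau):=\frac{m_{k,k}^2\,(f^{(k)}(0))^2\,\tau^{2k}}{(k!)^2\,t_{p,k}^2}=\frac{d_{p,k}\,(f^{(k)}(0))^2\,\tau^{2k}}{\prod_{\ell=0}^{k-1}(p+2\ell)^2}. $$ Then, as $n\to\infty$: (i) under $\mathrm{P}^{(n)}_{\kappa_n,f}$ with $\kappa_n=o(n^{-1/(2k_v)})$, $S_v^{(n)}$ converges in distribution to $\sum_{k=1}^{\infty}v_k^2\chi^2_{d_{p,k}}$; (ii) under $\mathrm{P}^{(n)}_{\kappa_n,f}$ with $\kappa_n=n^{-1/(2k_v)}\tau$, $S_v^{(n)}$ converges in distribution to $\sum_{k=1}^{\infty}v_k^2\chi^2_{d_{p,k}}(\delta_{k,k_v}\xi_{p,k_v}(\tau))$; (iii) if $n^{1/(2k_v)}\kappa_n\to\infty$ and $f^{(k_v)}(0)\neq 0$, then $\mathrm{P}^{(n)}_{\kappa_n,f}[S_v^{(n)}>c]\to 1$ for any $c>0$ (so that the test rejecting for $S_v^{(n)}$ larger than the upper $\alpha$-quantile of $\sum_{k=1}^{\infty}v_k^2\chi^2_{d_{p,k}}$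 is consistent under this sequence of alternatives).
   Context: $\mathcal{S}^{p-1}$ is the unit sphere of $\mathbb{R}^p$ and $\theta_0:=(0,\ldots,0,1)'\in\mathbb{R}^p$. An angular function is a (Borel measurable) function $f:\mathbb{R}\to[0,\infty)$ with $f(0)=1$; $f^{(k)}$ denotes its $k$th derivative. For $\kappa_n>0$, $\mathrm{P}^{(n)}_{\kappa_n,f}$ is the hypothesis under which $U_1,\ldots,U_n$ are i.i.d. on $\mathcal{S}^{p-1}$ with density, with respect to the surface area measure, proportional to $u\mapsto f(\kappa_n u'\theta_0)$. (This is well defined as soon as the integral of this function is finite and positive, hence for all large $n$ when $\kappa_n\to0$ and $f$ is continuous at zero.) Polynomials: $C_q^{0}$ is the Chebyshev polynomial of the first kind, $C_q^0(\cos\theta)=\cos(q\theta)$; for $\lambda>0$, $C_q^\lambda(t)=\sum_{j=0}^{\lfloor q/2\rfloor}(-1)^j\frac{2^{q-2j}\Gamma(q-j+\lambda)}{\Gamma(\lambda)j!(q-2j)!}t^{q-2j}$ is the Gegenbauer polynomial. The real numbers $m_{k,i}$, $0\le k\le i$, are defined, for each positive integer $i$, by $t^i=\sum_{k=0}^i m_{k,i}C_k^{(p-2)/2}(t)$. Constants: $d_{p,k}=\binom{p+k-3}{p-2}+\binom{p+k-2}{p-2}$ for $k\ge1$ (so $d_{2,k}=2$); $t_{p,k}:=\sqrt2$ if $p=2$ and $t_{p,k}:=(1+2k/(p-2))/\sqrt{d_{p,k}}$ if $p\ge3$; $\delta_{k,\ell}$ is the Kronecker delta. Sobolev statistic: $S_v^{(n)}:=\frac1n\sum_{i,j=1}^n\sum_{k=1}^\infty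 v_k^2h_{p,k}(U_i'U_j)$, where $h_{p,k}(s):=2C_k^0(s)$ if $p=2$ and $h_{p,k}(s):=(1+\frac{2k}{p-2})C_k^{(p-2)/2}(s)$ if $p\geq3$. $\chi^2_d(\xi)$ is the non-central chi-square distribution with $d$ degrees of freedom and non-centrality parameter $\xi$ (law of $\|Z\|^2$ with $Z\sim N(\mu,I_d)$, $\|\mu\|^2=\xi$), $\chi^2_d:=\chi^2_d(0)$; $\sum_k w_k\chi^2_{d_k}(\xi_k)$ denotes the law of the weighted sum of mutually independent random variables with these distributions. *)

theory Defs
  imports
    "HOL-Probability.Probability"
    "HOL-Library.Landau_Symbols"
    "HOL-Computational_Algebra.Polynomial"
begin

subsection \<open>Rotationally symmetric distributions on the unit sphere\<close>

definition theta0 :: "real ^ 'p::{finite,linorder}" where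
  "theta0 = axis (Max UNIV) 1"

text \<open>
  The surface area measure of the unit sphere, in polar-coordinate form: the area of a Borel
  subset A of the sphere is p times the Lebesgue measure of the cone over A inside the unit
  ball; see \<open>emeasure_surface_measure\<close>. For p = 2 this is arc length, of total mass 2 pi.
\<close>

definition surface_measure :: "(real ^ 'p::finite) measure" where
  "surface_measure = scale_measure (of_nat CARD('p))
     (distr (restrict_space lborel (ball 0 1 - {0})) (restrict_space borel (sphere 0 1))
        (\<lambda>x. x /\<^sub>R norm x))"

lemma space_surface_measure: "space (surface_measure :: (real ^ 'p::finite) measure) = sphere 0 1"
  by (simp add: surface_measure_def space_scale_measure space_restrict_space)

lemma emeasure_surface_measure:
  fixes A :: "(real ^ 'p::finite) set"
  assumes "A \<in> sets borel" "A \<subseteq> sphere 0 1"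
  shows "emeasure surface_measure A =
    of_nat CARD('p) * emeasure lborel {r *\<^sub>R u | r u. 0 < r \<and> r < 1 \<and> u \<in> A}"
proof -
  let ?g = "\<lambda>x :: real ^ 'p. x /\<^sub>R norm x"
  let ?R = "restrict_space lborel (ball 0 1 - {0}) :: (real ^ 'p) measure"
  have "?g \<in> measurable lborel borel"
    by simp
  then have "?g \<in> measurable ?R borel"
    by (rule measurable_restrict_space1)
  then have m: "?g \<in> measurable ?R (restrict_space borel (sphere 0 1))"
  proof (rule measurable_restrict_space2[rotated])
    show "?g \<in> space ?R \<rightarrow> sphere 0 1"
      by (auto simp: space_restrict_space)
  qed
  have A: "A \<in> sets (restrict_space borel (sphere 0 1))"
    using assms by (simp add: sets_restrict_space_iff)
  have eq: "?g -` A \<inter> space ?R = {r *\<^sub>R u | r u. 0 < r \<and> r < 1 \<and> u \<in> A}"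
  proof (intro set_eqI iffI)
    fix x assume x: "x \<in> ?g -` A \<inter> space ?R"
    then have "x = norm x *\<^sub>R ?g x" "0 < norm x" "norm x < 1" "?g x \<in> A"
      by (auto simp: space_restrict_space)
    then show "x \<in> {r *\<^sub>R u | r u. 0 < r \<and> r < 1 \<and> u \<in> A}" by blast
  next
    fix x assume "x \<in> {r *\<^sub>R u | r u. 0 < r \<and> r < 1 \<and> u \<in> A}"
    then obtain r u where ru: "x = r *\<^sub>R u" "0 < r" "r < 1" "u \<in> A" by blast
    moreover have "norm u = 1" using ru assms by auto
    ultimately show "x \<in> ?g -` A \<inter> space ?R"
      by (auto simp: space_restrict_space)
  qed
  have "emeasure ?R (?g -` A \<inter> space ?R) = emeasure lborel (?g -` A \<inter> space ?R)"
    by (rule emeasure_restrict_space) (auto simp: space_restrict_space)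
  then show ?thesis
    unfolding surface_measure_def emeasure_scale_measure emeasure_distr[OF m A] eq by simp
qed

definition angular_function :: "(real \<Rightarrow> real) \<Rightarrow> bool" where
  "angular_function f \<longleftrightarrow> f \<in> borel_measurable borel \<and> (\<forall>x. 0 \<le> f x) \<and> f 0 = 1"

text \<open>
  Each derivative has to exist on a neighbourhood of 0 (depending on the order) for the next one
  to make sense at 0; nothing is required away from 0.
\<close>

definition infinitely_differentiable_at_zero :: "(real \<Rightarrow> real) \<Rightarrow> bool" where
  "infinitely_differentiable_at_zero f \<longleftrightarrow>
     (\<forall>k. \<forall>\<^sub>F x in nhds 0. (deriv ^^ k) f field_differentiable at x)"

text \<open>
  If the normalising integral is 0 or infinite, this is the null measure (as division in
  \<^typ>\<open>ennreal\<close> satisfies 0 / 0 = 0 and c / top = 0). If f is continuous at 0, this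
  does not happen for small kappa.
\<close>

definition rotsym_law :: "real \<Rightarrow> (real \<Rightarrow> real) \<Rightarrow> (real ^ 'p::{finite,linorder}) measure" where
  "rotsym_law \<kappa> f = density (surface_measure :: (real ^ 'p::{finite,linorder}) measure)
     (\<lambda>u. ennreal (f (\<kappa> * (u \<bullet> theta0))) /
          (\<integral>\<^sup>+ x. ennreal (f (\<kappa> * (x \<bullet> theta0))) \<partial>(surface_measure :: (real ^ 'p::{finite,linorder}) measure)))"

definition rotsym_sample ::
    "nat \<Rightarrow> real \<Rightarrow> (real \<Rightarrow> real) \<Rightarrow> (nat \<Rightarrow> real ^ 'p::{finite,linorder}) measure" where
  "rotsym_sample n \<kappa> f = PiM {1..n} (\<lambda>_. rotsym_law \<kappa> f)"


subsection \<open>Chebyshev and Gegenbauer polynomials\<close>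

definition chebyshev :: "nat \<Rightarrow> real poly" where
  "chebyshev q = (THE P. \<forall>\<theta>. poly P (cos \<theta>) = cos (real q * \<theta>))"

definition gegenbauer :: "real \<Rightarrow> nat \<Rightarrow> real poly" where
  "gegenbauer \<nu> q = (\<Sum>j\<le>q div 2. monom
     ((-1) ^ j * 2 ^ (q - 2 * j) * Gamma (real (q - j) + \<nu>) /
        (Gamma \<nu> * fact j * fact (q - 2 * j))) (q - 2 * j))"

text \<open>The polynomials $C_q^\nu$ for $\nu \ge 0$.\<close>

definition C_poly :: "real \<Rightarrow> nat \<Rightarrow> real poly" where
  "C_poly \<nu> q = (if \<nu> = 0 then chebyshev q else gegenbauer \<nu> q)"

text \<open>
  The coefficients $m_{k,i}$ of $t^i$ in the basis $C_0^\nu, \dots, C_i^\nu$;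
  see \<open>m_coeff\<close> and \<open>m_coeff_unique\<close>.
\<close>

definition m_coeff :: "real \<Rightarrow> nat \<Rightarrow> nat \<Rightarrow> real" where
  "m_coeff \<nu> k i = (THE m. (\<forall>k>i. m k = 0) \<and>
     (\<forall>t. t ^ i = (\<Sum>k\<le>i. m k * poly (C_poly \<nu> k) t))) k"

lemma chebyshev_unique:
  assumes "\<forall>\<theta>. poly P (cos \<theta>) = cos (real q * \<theta>)" "\<forall>\<theta>. poly Q (cos \<theta>) = cos (real q * \<theta>)"
  shows "P = Q"
proof (rule ccontr)
  assume "P \<noteq> Q"
  then have "finite {x. poly (P - Q) x = 0}"
    by (intro poly_roots_finite) simp
  moreover have "{-1..1} \<subseteq> {x. poly (P - Q) x = 0}"
  proof
    fix x :: real assume "x \<in> {-1..1}"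
    then have "x = cos (arccos x)" by simp
    then show "x \<in> {x. poly (P - Q) x = 0}"
      using assms by (metis (mono_tags) diff_self mem_Collect_eq poly_diff)
  qed
  ultimately have "finite {-1..1::real}" by (rule rev_finite_subset)
  moreover have "infinite {-1..1::real}"
    by (rule infinite_Icc) simp
  ultimately show False by simp
qed

fun cheb_rec :: "nat \<Rightarrow> real poly" where
  "cheb_rec 0 = 1"
| "cheb_rec (Suc 0) = [:0, 1:]"
| "cheb_rec (Suc (Suc q)) = [:0, 2:] * cheb_rec (Suc q) - cheb_rec q"

lemma poly_cheb_rec: "poly (cheb_rec q) (cos \<theta>) = cos (real q * \<theta>)"
proof (induction q rule: cheb_rec.induct)
  case (3 q)
  have "cos (real (Suc (Suc q)) * \<theta>) + cos (real q * \<theta>) = 2 * cos \<theta> * cos (real (Suc q) * \<theta>)"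
    using cos_add[of "real (Suc q) * \<theta>" \<theta>] cos_diff[of "real (Suc q) * \<theta>" \<theta>]
    by (simp add: algebra_simps)
  with 3 show ?case by simp
qed auto

lemma chebyshev_eq_cheb_rec: "chebyshev q = cheb_rec q"
  unfolding chebyshev_def
  by (rule the_equality) (auto simp: poly_cheb_rec intro!: chebyshev_unique)

lemma poly_chebyshev: "poly (chebyshev q) (cos \<theta>) = cos (real q * \<theta>)"
  by (simp add: chebyshev_eq_cheb_rec poly_cheb_rec)

lemma cheb_rec_degree: "degree (cheb_rec q) \<le> q \<and> coeff (cheb_rec q) q > 0"
proof (induction q rule: cheb_rec.induct)
  case (3 q)
  have "degree ([:0, 2:] * cheb_rec (Suc q)) \<le> Suc (Suc q)"
    using degree_mult_le[of "[:0, 2:]" "cheb_rec (Suc q)"] 3 by simp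
  moreover have "coeff (cheb_rec q) (Suc (Suc q)) = 0"
    using 3 by (intro coeff_eq_0) auto
  ultimately show ?case
    using 3 by (auto intro!: degree_diff_le)
qed auto

lemma gegenbauer_degree:
  assumes "\<nu> > 0"
  shows "degree (gegenbauer \<nu> q) \<le> q \<and> coeff (gegenbauer \<nu> q) q > 0"
proof
  show "degree (gegenbauer \<nu> q) \<le> q"
    unfolding gegenbauer_def
    by (rule degree_sum_le) (auto intro: order_trans[OF degree_monom_le])
  have "coeff (gegenbauer \<nu> q) q =
      (\<Sum>j\<le>q div 2. if j = 0 then 2 ^ q * Gamma (real q + \<nu>) / (Gamma \<nu> * fact q) else 0)"
    unfolding gegenbauer_def coeff_sum by (intro sum.cong) auto
  also have "\<dots> = 2 ^ q * Gamma (real q + \<nu>) / (Gamma \<nu> * fact q)"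
    by simp
  also have "\<dots> > 0"
    using assms by (simp add: Gamma_real_pos add_nonneg_pos)
  finally show "coeff (gegenbauer \<nu> q) q > 0" .
qed

lemma C_poly_degree:
  assumes "\<nu> \<ge> 0"
  shows "degree (C_poly \<nu> q) \<le> q \<and> coeff (C_poly \<nu> q) q > 0"
  using assms cheb_rec_degree[of q] gegenbauer_degree[of \<nu> q]
  by (simp add: C_poly_def chebyshev_eq_cheb_rec)

lemma triangular_basis_ex:
  fixes B :: "nat \<Rightarrow> real poly"
  assumes B: "\<And>k. degree (B k) \<le> k \<and> coeff (B k) k > 0"
  shows "degree P \<le> i \<Longrightarrow> \<exists>m. (\<forall>k>i. m k = 0) \<and> P = (\<Sum>k\<le>i. smult (m k) (B k))"
proof (induction i arbitrary: P)
  case 0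
  obtain a where a: "P = [:a:]" using 0 degree_eq_zeroE by blast
  obtain b where b: "B 0 = [:b:]" using B[of 0] degree_eq_zeroE by blast
  have "b > 0" using B[of 0] b by simp
  then show ?case
    using a b by (intro exI[of _ "\<lambda>k. if k = 0 then a / b else 0"]) auto
next
  case (Suc i)
  define c where "c = coeff P (Suc i) / coeff (B (Suc i)) (Suc i)"
  let ?Q = "P - smult c (B (Suc i))"
  have "degree ?Q \<le> Suc i"
    using Suc B[of "Suc i"] by (intro degree_diff_le) (auto intro: order_trans[OF degree_smult_le])
  moreover have "coeff ?Q (Suc i) = 0"
    using B[of "Suc i"] by (simp add: c_def)
  ultimately have "degree ?Q \<le> i"
    by (metis Suc_leI degree_0 eq_zero_or_degree_less less_Suc_eq_le zero_le)
  from Suc.IH[OF this] obtain m where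
    m: "\<forall>k>i. m k = 0" "?Q = (\<Sum>k\<le>i. smult (m k) (B k))" by blast
  have "P = ?Q + smult c (B (Suc i))" by simp
  also have "\<dots> = (\<Sum>k\<le>Suc i. smult ((m(Suc i := c)) k) (B k))"
    unfolding m(2) by (auto intro!: sum.cong)
  finally show ?case using m(1) by (intro exI[of _ "m(Suc i := c)"]) auto
qed

lemma triangular_basis_independent:
  fixes B :: "nat \<Rightarrow> real poly"
  assumes B: "\<And>k. degree (B k) \<le> k \<and> coeff (B k) k > 0"
  shows "(\<Sum>k\<le>i. smult (m k) (B k)) = 0 \<Longrightarrow> \<forall>k\<le>i. m k = 0"
proof (induction i)
  case 0
  then show ?case using B[of 0] by auto
next
  case (Suc i)
  have "coeff (\<Sum>k\<le>Suc i. smult (m k) (B k)) (Suc i) =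
      (\<Sum>k\<le>Suc i. if k = Suc i then m k * coeff (B k) k else 0)"
    unfolding coeff_sum
  proof (rule sum.cong)
    fix k assume "k \<in> {..Suc i}"
    moreover have "k < Suc i \<Longrightarrow> coeff (B k) (Suc i) = 0"
      using B[of k] by (intro coeff_eq_0) auto
    ultimately show "coeff (smult (m k) (B k)) (Suc i) = (if k = Suc i then m k * coeff (B k) k else 0)"
      by auto
  qed simp
  then have "coeff (\<Sum>k\<le>Suc i. smult (m k) (B k)) (Suc i) = m (Suc i) * coeff (B (Suc i)) (Suc i)"
    by (simp del: sum.atMost_Suc)
  then have "m (Suc i) * coeff (B (Suc i)) (Suc i) = 0"
    unfolding Suc.prems by simp
  then have "m (Suc i) = 0" using B[of "Suc i"] by simp
  with Suc show ?case by (auto simp: le_Suc_eq)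
qed

lemma m_coeff_ex1:
  assumes "\<nu> \<ge> 0"
  shows "\<exists>!m. (\<forall>k>i. m k = 0) \<and> (\<forall>t. t ^ i = (\<Sum>k\<le>i. m k * poly (C_poly \<nu> k) t))"
proof (rule ex_ex1I)
  have "degree (monom 1 i :: real poly) \<le> i" by (rule degree_monom_le)
  from triangular_basis_ex[OF C_poly_degree[OF assms] this] obtain m where
    m: "\<forall>k>i. m k = 0" "monom 1 i = (\<Sum>k\<le>i. smult (m k) (C_poly \<nu> k))" by blast
  have "t ^ i = (\<Sum>k\<le>i. m k * poly (C_poly \<nu> k) t)" for t
    using arg_cong[OF m(2), of "\<lambda>P. poly P t"] by (simp add: poly_monom poly_sum)
  then show "\<exists>m. (\<forall>k>i. m k = 0) \<and> (\<forall>t. t ^ i = (\<Sum>k\<le>i. m k * poly (C_poly \<nu> k) t))"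
    using m(1) by blast
next
  fix m m'
  assume m: "(\<forall>k>i. m k = 0) \<and> (\<forall>t. t ^ i = (\<Sum>k\<le>i. m k * poly (C_poly \<nu> k) t))"
    and m': "(\<forall>k>i. m' k = 0) \<and> (\<forall>t. t ^ i = (\<Sum>k\<le>i. m' k * poly (C_poly \<nu> k) t))"
  have "poly (\<Sum>k\<le>i. smult (m k - m' k) (C_poly \<nu> k)) t = 0" for t
    using m m' by (simp add: poly_sum left_diff_distrib sum_subtractf)
  then have "(\<Sum>k\<le>i. smult (m k - m' k) (C_poly \<nu> k)) = 0"
    using poly_all_0_iff_0 by blast
  from triangular_basis_independent[OF C_poly_degree[OF assms] this] m m'
  show "m = m'"
    by (metis eq_iff_diff_eq_0 ext not_le_imp_less)
qed

lemma m_coeff: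
  assumes "\<nu> \<ge> 0"
  shows "t ^ i = (\<Sum>k\<le>i. m_coeff \<nu> k i * poly (C_poly \<nu> k) t)"
  using theI'[OF m_coeff_ex1[OF assms, of i]] unfolding m_coeff_def by blast

lemma m_coeff_unique:
  assumes "\<nu> \<ge> 0" "\<And>t. t ^ i = (\<Sum>k\<le>i. m k * poly (C_poly \<nu> k) t)" "k \<le> i"
  shows "m_coeff \<nu> k i = m k"
proof -
  let ?m = "\<lambda>k. if k \<le> i then m k else 0"
  have "(THE m. (\<forall>k>i. m k = 0) \<and> (\<forall>t. t ^ i = (\<Sum>k\<le>i. m k * poly (C_poly \<nu> k) t))) = ?m"
    by (rule the1_equality[OF m_coeff_ex1[OF assms(1)]]) (simp add: assms(2))
  then show ?thesis using assms(3) by (simp add: m_coeff_def)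
qed


subsection \<open>Sobolev statistics\<close>

text \<open>Meaningful for $p \ge 2$ and $k \ge 1$ only, because of the truncated subtraction.\<close>

definition d_const :: "nat \<Rightarrow> nat \<Rightarrow> nat" where
  "d_const p k = ((p + k - 3) choose (p - 2)) + ((p + k - 2) choose (p - 2))"

definition t_const :: "nat \<Rightarrow> nat \<Rightarrow> real" where
  "t_const p k = (if p = 2 then sqrt 2
     else (1 + 2 * real k / (real p - 2)) / sqrt (real (d_const p k)))"

definition h_fun :: "nat \<Rightarrow> nat \<Rightarrow> real \<Rightarrow> real" where
  "h_fun p k s = (if p = 2 then 2 * poly (C_poly 0 k) s
     else (1 + 2 * real k / (real p - 2)) * poly (C_poly ((real p - 2) / 2) k) s)"

text \<open>
  Sequences indexed by the positive integers are functions on \<^typ>\<open>nat\<close> whose value at 0 is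
  never used; sums over $k \ge 1$ are series in \<^term>\<open>Suc k\<close>.
\<close>

definition sobolev_stat :: "(nat \<Rightarrow> real) \<Rightarrow> nat \<Rightarrow> (nat \<Rightarrow> real ^ 'p::finite) \<Rightarrow> real" where
  "sobolev_stat v n u = 1 / real n *
     (\<Sum>i=1..n. \<Sum>j=1..n. \<Sum>k. (v (Suc k))\<^sup>2 * h_fun CARD('p) (Suc k) (u i \<bullet> u j))"

definition xi_const :: "nat \<Rightarrow> (real \<Rightarrow> real) \<Rightarrow> nat \<Rightarrow> real \<Rightarrow> real" where
  "xi_const p f k \<tau> =
     (m_coeff ((real p - 2) / 2) k k)\<^sup>2 * ((deriv ^^ k) f 0)\<^sup>2 * \<tau> ^ (2 * k) /
     ((fact k)\<^sup>2 * (t_const p k)\<^sup>2)"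


subsection \<open>Weighted sums of non-central chi-square variables\<close>

text \<open>
  The law of the squared norm of a Gaussian vector with identity covariance in dimension d depends
  on the mean only through its norm; here the mean is $(\sqrt{\xi}, 0, \dots, 0)$.
\<close>

definition noncentral_chi_square :: "nat \<Rightarrow> real \<Rightarrow> real measure" where
  "noncentral_chi_square d \<xi> =
     distr (PiM {..<d} (\<lambda>i. density lborel
              (\<lambda>x. ennreal (normal_density (if i = 0 then sqrt \<xi> else 0) 1 x))))
       borel (\<lambda>z. \<Sum>i<d. (z i)\<^sup>2)"

definition weighted_chi_square :: "(nat \<Rightarrow> real) \<Rightarrow> (nat \<Rightarrow> nat) \<Rightarrow> (nat \<Rightarrow> real) \<Rightarrow> real measure" where
  "weighted_chi_square w d \<xi> =
     distr (PiM {1..} (\<lambda>k. noncentral_chi_square (d k) (\<xi> k)))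
       borel (\<lambda>x. \<Sum>k. w (Suc k) * x (Suc k))"

definition upper_quantile :: "real measure \<Rightarrow> real \<Rightarrow> real" where
  "upper_quantile L \<alpha> = Inf {c. measure L {c<..} \<le> \<alpha>}"

end

theory Submission
  imports Defs "HOL-Real_Asymp.Real_Asymp"
begin

text \<open>
  By the addition formula, the statistic is a weighted sum of squares of the normalised sums of
  orthonormal spherical harmonics. Its Laplace transform is computed by Gaussian randomisation of
  each square, which reduces a multivariate central limit theorem to the univariate one, and
  convergence of Laplace transforms of nonnegative random variables yields weak convergence by the
  Weierstrass theorem. Harmonics of degree k are orthogonal to all polynomials of lower degree, so
  under the alternatives the degree k_v feels only the derivative of order k_v of f at 0, at rate
  \<kappa>^k_v, and the higher degrees feel nothing at that rate. The harmonics are obtained from the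
  reproducing property of the zonal polynomials, which in turn rests on the two-point moments of the
  uniform distribution, determined by rotation invariance alone.
\<close>

subsection \<open>Weak convergence from Laplace transforms\<close>

text \<open>The surface measure is known only through volumes of cones. No density of x . u on
  [-1,1] is at hand, so orthogonality cannot be read off from integrals against (1 - t^2)^((p-3)/2).
  Explicit moments take their place: the mean of (x . (u + t w))^N depends on u + t w through its
  norm alone, and comparing powers of t yields every mixed moment. Of the polynomials only degree, a
  two-step recurrence of the coefficients, the leading coefficient and the value at 1 then matter,
  which lets the Chebyshev case p = 2 and the Gegenbauer case p \<ge> 3 run together. The other
  obstacle is the infinite series over k. Taylor expansions of order k would have constants that
  depend on k, so the order stays at k_v. A harmonic of higher degree leaves only the remainder,
  measured against its L^2 norm, and the bias has the same bound for all k. Under the rates of (i)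
  and (ii) the mean of the k-th square is therefore at most a constant times d_k, uniformly in n,
  and the convergence of the sum of v_k^2 d_k controls the tail.\<close>

lemma weak_conv_m_eventually_cong:
  assumes "eventually (\<lambda>n. M n = M' n) sequentially" "weak_conv_m M' L"
  shows "weak_conv_m M L"
  unfolding weak_conv_m_def weak_conv_def
proof (intro allI impI)
  fix x assume "isCont (cdf L) x"
  with assms(2) have "(\<lambda>n. cdf (M' n) x) \<longlonglongrightarrow> cdf L x"
    by (auto simp: weak_conv_m_def weak_conv_def)
  moreover have "eventually (\<lambda>n. cdf (M' n) x = cdf (M n) x) sequentially"
    using assms(1) by eventually_elim simp
  ultimately show "(\<lambda>n. cdf (M n) x) \<longlonglongrightarrow> cdf L x"
    by (rule Lim_transform_eventually)
qed

text \<open>A polynomial in exp (- x) integrates to a combination of values of the Laplace transform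
  at integers. A uniform approximation on [0,1] thus gives an approximation of the integral, with
  the same error for every law on the half-line.\<close>

lemma polynomial_exp_approx:
  fixes M :: "real measure"
  assumes "real_distribution M" "AE x in M. 0 \<le> x"
    and g: "\<And>z. z \<in> {0..1} \<Longrightarrow> \<bar>\<phi> z - (\<Sum>i\<le>d. a i * z ^ i)\<bar> < e"
    and \<psi>: "\<And>x. 0 \<le> x \<Longrightarrow> \<psi> x = \<phi> (exp (- x))" "integrable M \<psi>"
  shows "\<bar>(\<integral>x. \<psi> x \<partial>M) - (\<Sum>i\<le>d. a i * (\<integral>x. exp (- (real i * x)) \<partial>M))\<bar> \<le> e"
proof -
  interpret real_distribution M by fact
  have int: "integrable M (\<lambda>x. exp (- (real i * x)))" for i
  proof (rule integrable_const_bound[of _ 1])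
    show "AE x in M. norm (exp (- (real i * x))) \<le> 1"
      using assms(2) by eventually_elim simp
  qed simp
  have "(\<Sum>i\<le>d. a i * (\<integral>x. exp (- (real i * x)) \<partial>M)) = (\<integral>x. (\<Sum>i\<le>d. a i * exp (- (real i * x))) \<partial>M)"
    by (subst Bochner_Integration.integral_sum) (auto intro: int)
  then have "\<bar>(\<integral>x. \<psi> x \<partial>M) - (\<Sum>i\<le>d. a i * (\<integral>x. exp (- (real i * x)) \<partial>M))\<bar>
     = \<bar>\<integral>x. \<psi> x - (\<Sum>i\<le>d. a i * exp (- (real i * x))) \<partial>M\<bar>"
    by (subst Bochner_Integration.integral_diff) (auto intro!: \<psi> int)
  also have "\<dots> \<le> (\<integral>x. \<bar>\<psi> x - (\<Sum>i\<le>d. a i * exp (- (real i * x)))\<bar> \<partial>M)"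
    by (rule integral_abs_bound)
  also have "\<dots> \<le> (\<integral>x. e \<partial>M)"
  proof (rule integral_mono_AE)
    show "AE x in M. \<bar>\<psi> x - (\<Sum>i\<le>d. a i * exp (- (real i * x)))\<bar> \<le> e"
      using assms(2)
    proof eventually_elim
      case (elim x)
      have "exp (- x) ^ i = exp (- (real i * x))" for i
        using exp_of_nat_mult[of i "-x"] by simp
      then show ?case using g[of "exp (- x)"] \<psi>(1)[OF elim] elim by auto
    qed
  qed (auto intro!: \<psi> int Bochner_Integration.integrable_abs Bochner_Integration.integrable_diff
      Bochner_Integration.integrable_sum)
  also have "\<dots> = e" using prob_space by simp
  finally show ?thesis .
qed

text \<open>
  By the Weierstrass theorem, convergence of the moments of exp (- X) in [0,1] suffices.
\<close>

lemma weak_conv_m_laplace: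
  assumes M: "\<And>n. real_distribution (M n)" "\<And>n. AE x in M n. 0 \<le> x"
    and L: "real_distribution L" "AE x in L. 0 \<le> x"
    and conv: "\<And>t::nat. (\<lambda>n. \<integral>x. exp (- (real t * x)) \<partial>M n) \<longlonglongrightarrow> (\<integral>x. exp (- (real t * x)) \<partial>L)"
  shows "weak_conv_m M L"
proof (rule integral_cts_step_conv_imp_weak_conv)
  fix x y :: real assume xy: "x < y"
  \<comment> \<open>The step function in the variable z = exp (- x). It vanishes for large x, that
    is for z near 0, so the value 0 at z \<le> 0 extends it continuously to the closed
    interval.\<close>
  define \<phi> where "\<phi> z = (if z \<le> 0 then 0 else cts_step x y (- ln z))" for z
  have cts: "continuous_on {0..1} \<phi>"
  proof (rule continuous_at_imp_continuous_on, rule ballI)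
    fix z :: real assume "z \<in> {0..1}"
    show "isCont \<phi> z"
    proof (cases "z < exp (- y)")
      case True
      have "eventually (\<lambda>z. z \<in> {..<exp (- y)}) (nhds z)"
        using True by (intro eventually_nhds_in_open) auto
      then have "eventually (\<lambda>z. \<phi> z = 0) (nhds z)"
      proof eventually_elim
        case (elim z)
        show ?case
        proof (cases "z \<le> 0")
          case False
          then have "ln z < - y" using elim by (metis exp_less_cancel_iff exp_ln lessThan_iff not_le)
          then show ?thesis using xy by (auto simp: \<phi>_def cts_step_def)
        qed (auto simp: \<phi>_def)
      qed
      then show ?thesis using isCont_cong[of \<phi> "\<lambda>_. 0" z] by simp
    next
      case False
      then have z: "z > 0" by (meson exp_gt_zero less_le_trans not_le)
      have c: "isCont (cts_step x y) u" for u
        using uniformly_continuous_imp_continuous[OF cts_step_uniformly_continuous[OF xy]]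
        by (simp add: continuous_on_eq_continuous_at)
      have "isCont (\<lambda>z. cts_step x y (- ln z)) z"
        using z by (intro isCont_o2[OF _ c] continuous_intros) auto
      moreover have "eventually (\<lambda>z. z \<in> {0<..}) (nhds z)"
        using z by (intro eventually_nhds_in_open) auto
      then have "eventually (\<lambda>z. \<phi> z = cts_step x y (- ln z)) (nhds z)"
        by eventually_elim (auto simp: \<phi>_def)
      ultimately show ?thesis using isCont_cong[of \<phi> "\<lambda>z. cts_step x y (- ln z)" z] by simp
    qed
  qed
  have \<phi>: "cts_step x y u = \<phi> (exp (- u))" for u by (simp add: \<phi>_def)
  show "(\<lambda>n. integral\<^sup>L (M n) (cts_step x y)) \<longlonglongrightarrow> integral\<^sup>L L (cts_step x y)"
  proof (rule LIMSEQ_I)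
    fix r :: real assume r: "r > 0"
    obtain g where g: "real_polynomial_function g" "\<And>z. z \<in> {0..1} \<Longrightarrow> \<bar>\<phi> z - g z\<bar> < r / 3"
      using Stone_Weierstrass_real_polynomial_function[OF compact_Icc cts, of "r/3"] r by auto
    obtain a d where a: "g = (\<lambda>x. \<Sum>i\<le>d. a i * x ^ i)"
      using g(1) real_polynomial_function_iff_sum by blast
    let ?P = "\<lambda>M. (\<Sum>i\<le>d. a i * (\<integral>x. exp (- (real i * x)) \<partial>M))"
    have le: "\<bar>integral\<^sup>L K (cts_step x y) - ?P K\<bar> \<le> r / 3"
      if "real_distribution K" "AE x in K. 0 \<le> x" for K
    proof (rule polynomial_exp_approx[OF that, where \<phi> = \<phi>])
      show "\<bar>\<phi> z - (\<Sum>i\<le>d. a i * z ^ i)\<bar> < r / 3" if "z \<in> {0..1}" for z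
        using g(2)[OF that] by (simp add: a)
      show "integrable K (cts_step x y)"
        by (rule real_distribution.integrable_cts_step[OF that(1) xy])
    qed (rule \<phi>)
    have "(\<lambda>n. ?P (M n)) \<longlonglongrightarrow> ?P L" by (intro tendsto_intros conv)
    from LIMSEQ_D[OF this, of "r / 3"] r
    obtain N where N: "\<And>n. n \<ge> N \<Longrightarrow> norm (?P (M n) - ?P L) < r / 3"
      by auto
    have "norm (integral\<^sup>L (M n) (cts_step x y) - integral\<^sup>L L (cts_step x y)) < r" if "n \<ge> N" for n
    proof -
      have "norm (?P (M n) - ?P L) < r / 3" using N that by blast
      then show ?thesis
        using le[OF M, of n] le[OF L] unfolding real_norm_def by linarith
    qed
    then show "\<exists>N. \<forall>n\<ge>N. norm (integral\<^sup>L (M n) (cts_step x y) - integral\<^sup>L L (cts_step x y)) < r"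
      by blast
  qed
qed (use M L in auto)

subsection \<open>Laplace transforms of quadratic forms of normalised sums\<close>

text \<open>Re c \<le> 0 puts exp (c / n) into the closed unit disc, where n-th powers of two
  numbers differ by at most n times their distance. This avoids complex logarithms.\<close>

lemma power_tendsto_exp:
  fixes c :: complex
  assumes "\<And>n. norm (\<phi> n) \<le> 1" "Re c \<le> 0" "(\<lambda>n. of_nat n * (\<phi> n - 1)) \<longlonglongrightarrow> c"
  shows "(\<lambda>n. \<phi> n ^ n) \<longlonglongrightarrow> exp c"
proof -
  have e: "(\<lambda>n. of_nat n * (exp (c / of_nat n) - 1)) \<longlonglongrightarrow> c"
  proof (cases "c = 0")
    case False
    have "(\<lambda>n. c / of_nat n) \<longlonglongrightarrow> 0"
      by (rule lim_const_over_n)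
    then have "filterlim (\<lambda>n. c / of_nat n) (at 0) sequentially"
      using False by (auto simp: filterlim_at intro!: eventually_sequentiallyI[of 1])
    from filterlim_compose[OF lim_exp_minus_1 this]
    have "(\<lambda>n. c * ((exp (c / of_nat n) - 1) / (c / of_nat n))) \<longlonglongrightarrow> c * 1"
      by (intro tendsto_intros)
    moreover have "c * ((exp (c / of_nat n) - 1) / (c / of_nat n)) = of_nat n * (exp (c / of_nat n) - 1)" for n
      using False by simp
    ultimately show ?thesis
      by simp
  qed simp
  have "(\<lambda>n. of_nat n * (\<phi> n - 1) - of_nat n * (exp (c / of_nat n) - 1)) \<longlonglongrightarrow> c - c"
    by (intro tendsto_diff assms e)
  then have "(\<lambda>n. of_nat n * (\<phi> n - exp (c / of_nat n))) \<longlonglongrightarrow> 0"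
    by (simp add: algebra_simps)
  then have z: "(\<lambda>n. norm (of_nat n * (\<phi> n - exp (c / of_nat n)))) \<longlonglongrightarrow> 0"
    by (rule tendsto_norm_zero)
  have "(\<lambda>n. \<phi> n ^ n - exp c) \<longlonglongrightarrow> 0"
  proof (rule Lim_null_comparison[OF _ z])
    show "\<forall>\<^sub>F n in sequentially. norm (\<phi> n ^ n - exp c) \<le> norm (of_nat n * (\<phi> n - exp (c / of_nat n)))"
    proof (rule eventually_sequentiallyI[of 1])
      fix n :: nat assume n: "1 \<le> n"
      have "exp c = exp (c / of_nat n) ^ n"
        using n by (simp flip: exp_of_nat_mult)
      moreover have "norm (exp (c / of_nat n)) \<le> 1"
        using assms(2) by (simp add: divide_nonpos_nonneg)
      ultimately show "norm (\<phi> n ^ n - exp c) \<le> norm (of_nat n * (\<phi> n - exp (c / of_nat n)))"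
        using norm_power_diff[of "\<phi> n" "exp (c / of_nat n)" n] assms(1)
        by (simp add: norm_mult)
    qed
  qed
  then show ?thesis by (simp add: LIM_zero_iff)
qed

text \<open>Expansion of the characteristic function to second order: the remainder is at most (B /
  sqrt n)^3, hence O(1 / sqrt n) after multiplication by n. The second moment may stand in for the
  variance since the mean is O(1 / sqrt n).\<close>

lemma char_power_tendsto:
  fixes Z :: "'a \<Rightarrow> real" and M :: "nat \<Rightarrow> 'a measure"
  assumes M: "\<And>n. prob_space (M n)" "\<And>n. Z \<in> borel_measurable (M n)"
    and B: "\<And>n x. x \<in> space (M n) \<Longrightarrow> \<bar>Z x\<bar> \<le> B"
    and m: "(\<lambda>n. sqrt n * (\<integral>x. Z x \<partial>M n)) \<longlonglongrightarrow> m"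
    and s: "(\<lambda>n. \<integral>x. (Z x)\<^sup>2 \<partial>M n) \<longlonglongrightarrow> s"
  shows "(\<lambda>n. (\<integral>x. iexp (Z x / sqrt n) \<partial>M n) ^ n) \<longlonglongrightarrow> exp (\<i> * of_real m - of_real s / 2)"
proof (rule power_tendsto_exp)
  have "0 \<le> (\<integral>x. (Z x)\<^sup>2 \<partial>M n)" for n
    by simp
  then have s0: "0 \<le> s"
    using s by (meson LIMSEQ_le_const)
  then show "Re (\<i> * of_real m - of_real s / 2) \<le> 0"
    by simp
  show "norm (\<integral>x. iexp (Z x / sqrt n) \<partial>M n) \<le> 1" for n
  proof -
    interpret prob_space "M n" by fact
    have "norm (\<integral>x. iexp (Z x / sqrt n) \<partial>M n) \<le> (\<integral>x. norm (iexp (Z x / sqrt n)) \<partial>M n)"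
      by (rule integral_norm_bound)
    then show ?thesis by (simp add: prob_space)
  qed
  have B0: "B \<ge> 0"
    using B prob_space.not_empty[OF M(1)] by (metis abs_ge_zero all_not_in_conv order_trans)
  \<comment> \<open>n times the first- and second-order terms of the expansion.\<close>
  let ?q = "\<lambda>n. \<i> * of_real (sqrt n * (\<integral>x. Z x \<partial>M n)) - of_real (\<integral>x. (Z x)\<^sup>2 \<partial>M n) / 2 :: complex"
  have q: "?q \<longlonglongrightarrow> \<i> * of_real m - of_real s / 2"
    by (intro tendsto_intros m s) simp
  have "(\<lambda>n. of_nat n * ((\<integral>x. iexp (Z x / sqrt n) \<partial>M n) - 1) - ?q n) \<longlonglongrightarrow> 0"
  proof (rule Lim_null_comparison)
    show "(\<lambda>n. B ^ 3 / sqrt n) \<longlonglongrightarrow> 0"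
      by real_asymp
    show "\<forall>\<^sub>F n in sequentially. norm (of_nat n * ((\<integral>x. iexp (Z x / sqrt n) \<partial>M n) - 1) - ?q n) \<le> B ^ 3 / sqrt n"
    proof (rule eventually_sequentiallyI[of 1])
      fix n :: nat assume n: "1 \<le> n"
      interpret prob_space "M n" by fact
      have iZ: "integrable (M n) Z"
        by (rule integrable_const_bound[of _ B]) (use B M in \<open>auto intro!: AE_I2\<close>)
      have iZ2: "integrable (M n) (\<lambda>x. (Z x)\<^sup>2)"
        by (rule integrable_const_bound[of _ "B\<^sup>2"])
          (use B B0 M in \<open>auto intro!: AE_I2 simp: abs_le_square_iff[symmetric]\<close>)
      have iE: "integrable (M n) (\<lambda>x. iexp (Z x / sqrt n))"
        by (rule integrable_const_bound[of _ 1]) (use M(2)[of n] in auto)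
      let ?r = "\<lambda>x. iexp (Z x / sqrt n) - (1 + \<i> * of_real (Z x) / of_real (sqrt n) - of_real ((Z x)\<^sup>2) / (2 * of_nat n)) :: complex"
      have sq: "complex_of_real (sqrt n) * complex_of_real (sqrt n) = of_nat n"
        by (metis of_nat_0_le_iff of_real_mult of_real_of_nat_eq real_sqrt_mult_self abs_of_nonneg)
      have A1: "complex_integrable (M n) (\<lambda>x. \<i> * of_real (Z x) / of_real (sqrt n))"
        by (intro integrable_divide_zero integrable_mult_right integrable_of_real iZ)
      have A2: "complex_integrable (M n) (\<lambda>x. of_real (Z x) ^ 2 / (2 * of_nat n))"
        unfolding of_real_power[symmetric] by (intro integrable_divide_zero integrable_of_real iZ2)
      have r: "norm (?r x) \<le> (B / sqrt n) ^ 3" if "x \<in> space (M n)" for x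
      proof -
        have "(\<Sum>k\<le>2. (\<i> * (Z x / sqrt n)) ^ k / fact k)
            = 1 + \<i> * of_real (Z x) / of_real (sqrt n) - of_real ((Z x)\<^sup>2) / (2 * of_nat n)"
          using sq n by (simp add: numeral_2_eq_2 field_simps)
        then have "norm (?r x) \<le> \<bar>Z x / sqrt n\<bar> ^ 3 / fact 3"
          using iexp_approx1[of "Z x / sqrt n" 2] by (simp add: numeral_3_eq_3)
        also have "\<dots> \<le> \<bar>Z x / sqrt n\<bar> ^ 3"
          by (simp add: fact_numeral)
        also have "\<dots> \<le> (B / sqrt n) ^ 3"
          using B[OF that] n by (intro power_mono) (auto simp: divide_right_mono)
        finally show ?thesis .
      qed
      have "of_nat n * ((\<integral>x. iexp (Z x / sqrt n) \<partial>M n) - 1) - ?q n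
          = of_nat n * (\<integral>x. ?r x \<partial>M n)"
      proof -
        have sqZ: "(\<integral>x. (complex_of_real (Z x))\<^sup>2 \<partial>M n) = of_real (\<integral>x. (Z x)\<^sup>2 \<partial>M n)"
          by (simp flip: of_real_power)
        have 1: "(\<integral>x. ?r x \<partial>M n) = (\<integral>x. iexp (Z x / sqrt n) \<partial>M n) - (1 + \<i> * of_real (\<integral>x. Z x \<partial>M n) / of_real (sqrt n)
            - of_real (\<integral>x. (Z x)\<^sup>2 \<partial>M n) / (2 * of_nat n))"
        proof -
          have "(\<integral>x. \<i> * of_real (Z x) / of_real (sqrt n) \<partial>M n) = \<i> * of_real (\<integral>x. Z x \<partial>M n) / of_real (sqrt n)"
            by simp
          moreover have "(\<integral>x. of_real (Z x) ^ 2 / (2 * of_nat n) \<partial>M n) = of_real (\<integral>x. (Z x)\<^sup>2 \<partial>M n) / (2 * complex_of_nat n)"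
            using sqZ by simp
          moreover have "integrable (M n) (\<lambda>x. 1 :: complex)" "(\<integral>x. 1 \<partial>M n) = (1 :: complex)"
            using prob_space by simp_all
          ultimately show ?thesis
            using Bochner_Integration.integral_diff[OF iE Bochner_Integration.integrable_diff[OF Bochner_Integration.integrable_add[OF _ A1] A2], of "\<lambda>_. 1"]
              Bochner_Integration.integral_diff[OF Bochner_Integration.integrable_add[OF _ A1] A2, of "\<lambda>_. 1"]
              Bochner_Integration.integral_add[OF _ A1, of "\<lambda>_. 1"] by (simp only: of_real_power)
        qed
        have 2: "complex_of_nat n * (w / complex_of_real (sqrt n)) = complex_of_real (sqrt n) * w" for w
          using sq n by (simp add: field_simps)
        show ?thesis
          using n 2[of "\<i> * of_real (\<integral>x. Z x \<partial>M n)"] unfolding 1 by (simp add: right_diff_distrib distrib_left)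
      qed
      also have "norm \<dots> \<le> n * (B / sqrt n) ^ 3"
      proof -
        have "norm (\<integral>x. ?r x \<partial>M n) \<le> (\<integral>x. norm (?r x) \<partial>M n)"
          by (rule integral_norm_bound)
        also have "\<dots> \<le> (\<integral>x. (B / sqrt n) ^ 3 \<partial>M n)"
          by (intro integral_mono r integrable_norm Bochner_Integration.integrable_diff iE
              Bochner_Integration.integrable_add A1) (auto intro!: A2)
        also have "\<dots> = (B / sqrt n) ^ 3" by (simp add: prob_space)
        finally show ?thesis by (simp add: norm_mult mult_left_mono)
      qed
      also have "\<dots> = B ^ 3 / sqrt n"
        using n by (simp add: power3_eq_cube field_simps)
      finally show "norm (of_nat n * ((\<integral>x. iexp (Z x / sqrt n) \<partial>M n) - 1) - ?q n) \<le> B ^ 3 / sqrt n" .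
    qed
  qed
  from tendsto_add[OF this q]
  show "(\<lambda>n. of_nat n * ((\<integral>x. iexp (Z x / sqrt n) \<partial>M n) - 1)) \<longlonglongrightarrow> \<i> * of_real m - of_real s / 2"
    by simp
qed

section \<open>Gaussian integrals and randomisation\<close>

text \<open>The Laplace transform at \<alpha> of the square of a normal variable with mean m and
  variance 1.\<close>

definition gauss_laplace :: "real \<Rightarrow> real \<Rightarrow> real" where
  "gauss_laplace \<alpha> m = exp (- \<alpha> * m\<^sup>2 / (1 + 2 * \<alpha>)) / sqrt (1 + 2 * \<alpha>)"

text \<open>Completing the square leaves a multiple of the normal density with mean m / c and
  variance 1 / c, where c = 1 + 2 \<alpha>.\<close>

lemma integral_exp_square_normal:
  assumes "\<alpha> \<ge> 0"
  shows "(\<integral>z. exp (- \<alpha> * z\<^sup>2) \<partial>density lborel (normal_density m 1)) = gauss_laplace \<alpha> m"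
proof -
  define c where "c = 1 + 2 * \<alpha>"
  have c: "c > 0" "\<alpha> = (c - 1) / 2" using assms by (auto simp: c_def)
  have "(\<integral>z. exp (- \<alpha> * z\<^sup>2) \<partial>density lborel (normal_density m 1))
      = (\<integral>z. normal_density m 1 z * exp (- \<alpha> * z\<^sup>2) \<partial>lborel)"
    by (subst integral_density) (auto simp: normal_density_nonneg)
  also have "\<dots> = (\<integral>z. gauss_laplace \<alpha> m * normal_density (m / c) (1 / sqrt c) z \<partial>lborel)"
  proof (intro Bochner_Integration.integral_cong refl)
    fix z
    have "- (z - m)\<^sup>2 / 2 - \<alpha> * z\<^sup>2 = - \<alpha> * m\<^sup>2 / c - (z - m / c)\<^sup>2 * c / 2"
      unfolding c(2) using c(1) by (simp add: field_simps power2_eq_square)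
    then have "exp (- (z - m)\<^sup>2 / 2) * exp (- \<alpha> * z\<^sup>2) = exp (- \<alpha> * m\<^sup>2 / c) * exp (- (z - m / c)\<^sup>2 * c / 2)"
      by (simp flip: exp_add)
    then show "normal_density m 1 z * exp (- \<alpha> * z\<^sup>2) = gauss_laplace \<alpha> m * normal_density (m / c) (1 / sqrt c) z"
      using c(1) unfolding normal_density_def gauss_laplace_def c_def[symmetric]
      by (simp add: power_divide real_sqrt_divide real_sqrt_mult mult_ac)
  qed
  also have "\<dots> = gauss_laplace \<alpha> m"
    using c(1) by simp
  finally show ?thesis .
qed

text \<open>The same value as in \<open>integral_exp_square_normal\<close>, reached from the side of
  the randomising variable: this is what one coordinate of G contributes in the limit. Rescaling by
  c = 1 / sqrt (1 + 2 \<alpha>) absorbs the quadratic term into the density and leaves a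
  characteristic function.\<close>

lemma integral_iexp_square_std_normal:
  assumes "\<alpha> \<ge> 0"
  shows "(\<integral>x. exp (\<i> * of_real (sqrt (2 * \<alpha>) * m * x) - of_real (\<alpha> * x\<^sup>2)) \<partial>std_normal_distribution)
    = of_real (gauss_laplace \<alpha> m)"
proof -
  define c where "c = 1 / sqrt (1 + 2 * \<alpha>)"
  have c: "c > 0" "c\<^sup>2 = 1 / (1 + 2 * \<alpha>)" using assms by (auto simp: c_def power_divide)
  have d: "1 + 2 * \<alpha> > 0" using assms by simp
  define b where "b = sqrt (2 * \<alpha>) * m"
  have "(\<integral>x. exp (\<i> * of_real (b * x) - of_real (\<alpha> * x\<^sup>2)) \<partial>std_normal_distribution)
      = (\<integral>x. std_normal_density x *\<^sub>R exp (\<i> * of_real (b * x) - of_real (\<alpha> * x\<^sup>2)) \<partial>lborel)"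
    by (subst integral_density) auto
  also have "\<dots> = c *\<^sub>R (\<integral>x. std_normal_density (c * x) *\<^sub>R exp (\<i> * of_real (b * (c * x)) - of_real (\<alpha> * (c * x)\<^sup>2)) \<partial>lborel)"
    using c(1) lborel_integral_real_affine[of c "\<lambda>x. std_normal_density x *\<^sub>R exp (\<i> * of_real (b * x) - of_real (\<alpha> * x\<^sup>2))" 0]
    by simp
  also have "(\<lambda>x. std_normal_density (c * x) *\<^sub>R exp (\<i> * of_real (b * (c * x)) - of_real (\<alpha> * (c * x)\<^sup>2)))
      = (\<lambda>x. std_normal_density x *\<^sub>R iexp (b * c * x))"
  proof
    fix x
    have "- (c * x)\<^sup>2 / 2 - \<alpha> * (c * x)\<^sup>2 = - x\<^sup>2 / 2"
    proof -
      have "- (c * x)\<^sup>2 / 2 - \<alpha> * (c * x)\<^sup>2 = - x\<^sup>2 / 2 * (c\<^sup>2 * (1 + 2 * \<alpha>))"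
        by (simp add: power_mult_distrib algebra_simps)
      also have "c\<^sup>2 * (1 + 2 * \<alpha>) = 1"
        using d by (simp add: c(2))
      finally show ?thesis by simp
    qed
    then have "exp (- (c * x)\<^sup>2 / 2) * exp (- (\<alpha> * (c * x)\<^sup>2)) = exp (- x\<^sup>2 / 2)"
      by (simp flip: exp_add)
    then have e: "std_normal_density (c * x) * exp (- (\<alpha> * (c * x)\<^sup>2)) = std_normal_density x"
      by (simp add: std_normal_density_def)
    have "std_normal_density (c * x) *\<^sub>R exp (\<i> * of_real (b * (c * x)) - of_real (\<alpha> * (c * x)\<^sup>2))
        = of_real (std_normal_density (c * x) * exp (- (\<alpha> * (c * x)\<^sup>2))) * iexp (b * c * x)"
      by (simp add: scaleR_conv_of_real exp_diff exp_minus exp_of_real divide_inverse mult_ac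
          flip: of_real_exp of_real_mult of_real_power of_real_inverse)
    then show "std_normal_density (c * x) *\<^sub>R exp (\<i> * of_real (b * (c * x)) - of_real (\<alpha> * (c * x)\<^sup>2))
      = std_normal_density x *\<^sub>R iexp (b * c * x)"
      unfolding e by (simp add: scaleR_conv_of_real)
  qed
  also have "(\<integral>x. std_normal_density x *\<^sub>R iexp (b * c * x) \<partial>lborel) = char std_normal_distribution (b * c)"
    unfolding char_def by (subst integral_density) auto
  also have "\<dots> = of_real (exp (- (b * c)\<^sup>2 / 2))"
    by (simp add: char_std_normal_distribution)
  also have "- (b * c)\<^sup>2 / 2 = - \<alpha> * m\<^sup>2 / (1 + 2 * \<alpha>)"
    using assms d by (simp add: power_mult_distrib c(2) b_def divide_simps)
  finally show ?thesis
    using c(1) by (simp add: gauss_laplace_def b_def c_def scaleR_conv_of_real)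
qed

lemma integral_iexp_std_normal_prod:
  assumes "finite I"
  shows "(\<integral>G. iexp (\<Sum>i\<in>I. G i * y i) \<partial>PiM I (\<lambda>_. std_normal_distribution))
    = of_real (exp (- (\<Sum>i\<in>I. (y i)\<^sup>2) / 2))"
proof -
  interpret N: real_distribution std_normal_distribution
    by (rule real_dist_normal_dist)
  interpret product_sigma_finite "\<lambda>_. std_normal_distribution" ..
  have "(\<integral>G. iexp (\<Sum>i\<in>I. G i * y i) \<partial>PiM I (\<lambda>_. std_normal_distribution))
      = (\<integral>G. (\<Prod>i\<in>I. iexp (y i * G i)) \<partial>PiM I (\<lambda>_. std_normal_distribution))"
    using assms by (simp add: exp_sum sum_distrib_left mult_ac)
  also have "\<dots> = (\<Prod>i\<in>I. char std_normal_distribution (y i))"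
    unfolding char_def
    by (rule product_integral_prod[OF assms]) (auto intro!: N.integrable_const_bound[of _ 1])
  also have "\<dots> = of_real (exp (- (\<Sum>i\<in>I. (y i)\<^sup>2) / 2))"
    using assms by (simp add: char_std_normal_distribution exp_sum sum_negf[symmetric] sum_divide_distrib del: sum_negf)
  finally show ?thesis .
qed

text \<open>With the i-th normalised sum multiplied by sqrt (2 t a_i), the exponent is minus half a
  squared norm, so randomisation applies. After Fubini the exponent is, for fixed G, a sum over the
  independent observations, and the inner mean is an n-th power.\<close>

lemma laplace_quadratic_form:
  fixes g :: "'i \<Rightarrow> 'a \<Rightarrow> real"
  assumes "prob_space M" and I: "finite I" and g[measurable]: "\<And>i. i \<in> I \<Longrightarrow> g i \<in> borel_measurable M"
    and a: "\<And>i. i \<in> I \<Longrightarrow> a i \<ge> 0" and t: "t \<ge> 0"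
  shows "complex_of_real (\<integral>u. exp (- (t * (\<Sum>i\<in>I. a i * ((\<Sum>j=1..n. g i (u j)) / sqrt n)\<^sup>2))) \<partial>PiM {1..n} (\<lambda>_. M))
    = (\<integral>G. (\<integral>x. iexp ((\<Sum>i\<in>I. sqrt (2 * t * a i) * G i * g i x) / sqrt n) \<partial>M) ^ n
        \<partial>PiM I (\<lambda>_. std_normal_distribution))"
proof -
  interpret M: prob_space M by fact
  interpret N: real_distribution std_normal_distribution
    by (rule real_dist_normal_dist)
  interpret Mp: product_prob_space "\<lambda>_. M" "{1..n}" ..
  interpret Np: product_prob_space "\<lambda>_. std_normal_distribution" I ..
  interpret Ms: product_sigma_finite "\<lambda>_. M" ..
  let ?\<Gamma> = "PiM I (\<lambda>_. std_normal_distribution)"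
  let ?U = "PiM {1..n} (\<lambda>_. M)"
  interpret U: prob_space ?U by (rule Mp.P.prob_space_axioms)
  interpret \<Gamma>: prob_space ?\<Gamma> by (rule Np.P.prob_space_axioms)
  interpret pair_prob_space ?U ?\<Gamma> ..
  define y where "y i u = sqrt (2 * t * a i) * ((\<Sum>j=1..n. g i (u j)) / sqrt n)" for i and u :: "nat \<Rightarrow> 'a"
  have y2: "(\<Sum>i\<in>I. (y i u)\<^sup>2) / 2 = t * (\<Sum>i\<in>I. a i * ((\<Sum>j=1..n. g i (u j)) / sqrt n)\<^sup>2)" for u
    unfolding sum_distrib_left[of t] sum_divide_distrib[of _ I]
    by (rule sum.cong) (use a t in \<open>auto simp: y_def power_mult_distrib power_divide real_sqrt_pow2\<close>)
  have y: "y i \<in> borel_measurable ?U" if "i \<in> I" for i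
    unfolding y_def using that by (auto intro!: borel_measurable_times borel_measurable_divide borel_measurable_sum)
  have meas: "(\<lambda>(u, G). iexp (\<Sum>i\<in>I. G i * y i u)) \<in> borel_measurable (?U \<Otimes>\<^sub>M ?\<Gamma>)"
    using y by measurable
  have "complex_of_real (\<integral>u. exp (- (t * (\<Sum>i\<in>I. a i * ((\<Sum>j=1..n. g i (u j)) / sqrt n)\<^sup>2))) \<partial>?U)
      = (\<integral>u. (\<integral>G. iexp (\<Sum>i\<in>I. G i * y i u) \<partial>?\<Gamma>) \<partial>?U)"
    unfolding integral_iexp_std_normal_prod[OF I] minus_divide_left[symmetric] y2 by simp
  also have "\<dots> = (\<integral>G. (\<integral>u. iexp (\<Sum>i\<in>I. G i * y i u) \<partial>?U) \<partial>?\<Gamma>)"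
    by (rule Fubini_integral[symmetric])
      (rule P.integrable_const_bound[of _ 1], use meas in auto)
  also have "\<dots> = (\<integral>G. (\<integral>x. iexp ((\<Sum>i\<in>I. sqrt (2 * t * a i) * G i * g i x) / sqrt n) \<partial>M) ^ n \<partial>?\<Gamma>)"
  proof (intro Bochner_Integration.integral_cong refl)
    fix G
    let ?Z = "\<lambda>x. (\<Sum>i\<in>I. sqrt (2 * t * a i) * G i * g i x) / sqrt n"
    have "(\<Sum>i\<in>I. G i * y i u) = (\<Sum>j=1..n. ?Z (u j))" for u
      unfolding y_def sum_divide_distrib sum_distrib_left
      by (subst sum.swap) (simp add: mult_ac)
    then have "(\<integral>u. iexp (\<Sum>i\<in>I. G i * y i u) \<partial>?U) = (\<integral>u. (\<Prod>j\<in>{1..n}. iexp (?Z (u j))) \<partial>?U)"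
      by (simp add: sum_distrib_left exp_sum)
    also have "\<dots> = (\<Prod>j\<in>{1..n}. \<integral>x. iexp (?Z x) \<partial>M)"
      by (rule Ms.product_integral_prod) (auto intro!: M.integrable_const_bound[of _ 1])
    finally show "(\<integral>u. iexp (\<Sum>i\<in>I. G i * y i u) \<partial>?U) = (\<integral>x. iexp (?Z x) \<partial>M) ^ n"
      by simp
  qed
  finally show ?thesis .
qed

text \<open>
  Gaussian randomisation exp (- |x|^2 / 2) = E exp (i G x) replaces a multivariate central limit
  theorem by the univariate one, applied for each fixed direction G.
\<close>

lemma laplace_quadratic_form_tendsto:
  fixes g :: "'i \<Rightarrow> 'a \<Rightarrow> real" and M :: "nat \<Rightarrow> 'a measure"
  assumes M: "\<And>n. prob_space (M n)" and I: "finite I"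
    and g: "\<And>n i. i \<in> I \<Longrightarrow> g i \<in> borel_measurable (M n)"
    and B: "\<And>n i x. i \<in> I \<Longrightarrow> x \<in> space (M n) \<Longrightarrow> \<bar>g i x\<bar> \<le> B i"
    and m: "\<And>i. i \<in> I \<Longrightarrow> (\<lambda>n. sqrt n * (\<integral>x. g i x \<partial>M n)) \<longlonglongrightarrow> m i"
    and cov: "\<And>i j. i \<in> I \<Longrightarrow> j \<in> I \<Longrightarrow> (\<lambda>n. \<integral>x. g i x * g j x \<partial>M n) \<longlonglongrightarrow> (if i = j then 1 else 0)"
    and a: "\<And>i. i \<in> I \<Longrightarrow> a i \<ge> 0" and t: "t \<ge> 0"
  shows "(\<lambda>n. \<integral>u. exp (- (t * (\<Sum>i\<in>I. a i * ((\<Sum>j=1..n. g i (u j)) / sqrt n)\<^sup>2))) \<partial>PiM {1..n} (\<lambda>_. M n))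
    \<longlonglongrightarrow> (\<Prod>i\<in>I. gauss_laplace (t * a i) (m i))"
proof -
  interpret N: real_distribution std_normal_distribution
    by (rule real_dist_normal_dist)
  interpret Np: product_prob_space "\<lambda>_. std_normal_distribution" I ..
  interpret Ns: product_sigma_finite "\<lambda>_. std_normal_distribution" ..
  let ?\<Gamma> = "PiM I (\<lambda>_. std_normal_distribution)"
  interpret \<Gamma>: prob_space ?\<Gamma> by (rule Np.P.prob_space_axioms)
  define s where "s i = sqrt (2 * t * a i)" for i
  define Z where "Z G x = (\<Sum>i\<in>I. s i * G i * g i x)" for G x
  have s2: "(s i)\<^sup>2 = 2 * t * a i" if "i \<in> I" for i
    using a t that by (simp add: s_def)
  have int1: "integrable (M n) (g i)" if "i \<in> I" for i n
  proof -
    interpret prob_space "M n" by fact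
    show ?thesis
      by (rule integrable_const_bound[of _ "B i"]) (use that g B in \<open>auto intro!: AE_I2\<close>)
  qed
  have int2: "integrable (M n) (\<lambda>x. g i x * g j x)" if "i \<in> I" "j \<in> I" for i j n
  proof -
    interpret prob_space "M n" by fact
    show ?thesis
    proof (rule integrable_const_bound[of _ "B i * B j"])
      show "AE x in M n. norm (g i x * g j x) \<le> B i * B j"
        using B[OF that(1)] B[OF that(2)]
        by (intro AE_I2) (auto simp: abs_mult intro!: mult_mono order_trans[OF abs_ge_zero B[OF that(1)]])
    qed (use that g in auto)
  qed
  \<comment> \<open>For fixed G the univariate limit theorem applies to the combination
    \<open>Z G\<close>. The limit factorises over i because the limiting covariance is the
    identity.\<close>
  have lim: "(\<lambda>n. (\<integral>x. iexp (Z G x / sqrt n) \<partial>M n) ^ n)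
      \<longlonglongrightarrow> (\<Prod>i\<in>I. exp (\<i> * of_real (sqrt (2 * (t * a i)) * m i * G i) - of_real (t * a i * (G i)\<^sup>2)))" for G
  proof -
    have "(\<lambda>n. \<Sum>i\<in>I. s i * G i * (sqrt n * (\<integral>x. g i x \<partial>M n))) \<longlonglongrightarrow> (\<Sum>i\<in>I. s i * G i * m i)"
      by (intro tendsto_intros m)
    moreover have "(\<Sum>i\<in>I. s i * G i * (sqrt n * (\<integral>x. g i x \<partial>M n))) = sqrt n * (\<integral>x. Z G x \<partial>M n)" for n
      unfolding Z_def by (subst Bochner_Integration.integral_sum) (auto simp: int1 sum_distrib_left mult_ac)
    ultimately have l1: "(\<lambda>n. sqrt n * (\<integral>x. Z G x \<partial>M n)) \<longlonglongrightarrow> (\<Sum>i\<in>I. s i * G i * m i)"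
      by simp
    have "(\<lambda>n. \<Sum>i\<in>I. \<Sum>j\<in>I. s i * G i * (s j * G j) * (\<integral>x. g i x * g j x \<partial>M n))
        \<longlonglongrightarrow> (\<Sum>i\<in>I. \<Sum>j\<in>I. s i * G i * (s j * G j) * (if i = j then 1 else 0))"
      by (intro tendsto_intros cov)
    moreover have "(\<Sum>i\<in>I. \<Sum>j\<in>I. s i * G i * (s j * G j) * (\<integral>x. g i x * g j x \<partial>M n)) = (\<integral>x. (Z G x)\<^sup>2 \<partial>M n)" for n
    proof -
      have "(\<integral>x. (Z G x)\<^sup>2 \<partial>M n) = (\<integral>x. (\<Sum>i\<in>I. \<Sum>j\<in>I. s i * G i * (s j * G j) * (g i x * g j x)) \<partial>M n)"
        unfolding Z_def power2_eq_square sum_product by (simp add: mult_ac)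
      then show ?thesis
        by (simp add: int2)
    qed
    moreover have "(\<Sum>i\<in>I. \<Sum>j\<in>I. s i * G i * (s j * G j) * (if i = j then 1 else 0)) = (\<Sum>i\<in>I. 2 * t * a i * (G i)\<^sup>2)"
    proof (rule sum.cong[OF refl])
      fix i assume i: "i \<in> I"
      have "(\<Sum>j\<in>I. s i * G i * (s j * G j) * (if i = j then 1 else 0)) = (\<Sum>j\<in>I. if i = j then s i * G i * (s j * G j) else 0)"
        by (rule sum.cong) auto
      also have "\<dots> = (s i)\<^sup>2 * (G i)\<^sup>2"
        using i I by (simp add: power2_eq_square mult_ac)
      finally show "(\<Sum>j\<in>I. s i * G i * (s j * G j) * (if i = j then 1 else 0)) = 2 * t * a i * (G i)\<^sup>2"
        by (simp add: s2[OF i])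
    qed
    ultimately have l2: "(\<lambda>n. \<integral>x. (Z G x)\<^sup>2 \<partial>M n) \<longlonglongrightarrow> (\<Sum>i\<in>I. 2 * t * a i * (G i)\<^sup>2)"
      by simp
    have "(\<lambda>n. (\<integral>x. iexp (Z G x / sqrt n) \<partial>M n) ^ n)
        \<longlonglongrightarrow> exp (\<i> * of_real (\<Sum>i\<in>I. s i * G i * m i) - of_real (\<Sum>i\<in>I. 2 * t * a i * (G i)\<^sup>2) / 2)"
    proof (rule char_power_tendsto[OF M _ _ l1 l2])
      show "Z G \<in> borel_measurable (M n)" for n
        unfolding Z_def using g by auto
      show "\<bar>Z G x\<bar> \<le> (\<Sum>i\<in>I. \<bar>s i * G i\<bar> * B i)" if "x \<in> space (M n)" for n x
        unfolding Z_def using B that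
        by (intro order_trans[OF sum_abs] sum_mono) (auto simp: abs_mult intro!: mult_left_mono)
    qed
    also have "\<i> * of_real (\<Sum>i\<in>I. s i * G i * m i) - of_real (\<Sum>i\<in>I. 2 * t * a i * (G i)\<^sup>2) / 2
        = (\<Sum>i\<in>I. \<i> * of_real (sqrt (2 * (t * a i)) * m i * G i) - of_real (t * a i * (G i)\<^sup>2))"
      by (simp add: s_def sum_subtractf sum_distrib_left sum_divide_distrib mult_ac)
    finally show ?thesis using I by (simp add: exp_sum)
  qed
  \<comment> \<open>Characteristic functions have modulus at most 1, so convergence for each G
    carries over to the mean over G.\<close>
  have "(\<lambda>n. \<integral>G. (\<integral>x. iexp (Z G x / sqrt n) \<partial>M n) ^ n \<partial>?\<Gamma>)
      \<longlonglongrightarrow> (\<integral>G. (\<Prod>i\<in>I. exp (\<i> * of_real (sqrt (2 * (t * a i)) * m i * G i) - of_real (t * a i * (G i)\<^sup>2))) \<partial>?\<Gamma>)"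
  proof (rule integral_dominated_convergence[where w = "\<lambda>_. 1"])
    show "(\<lambda>G. (\<integral>x. iexp (Z G x / sqrt n) \<partial>M n) ^ n) \<in> borel_measurable ?\<Gamma>" for n
    proof -
      interpret M: prob_space "M n" by fact
      have "(\<lambda>(G, x). iexp (Z G x / sqrt n)) \<in> borel_measurable (?\<Gamma> \<Otimes>\<^sub>M M n)"
        unfolding Z_def using g by measurable
      then show ?thesis
        by (intro borel_measurable_power M.borel_measurable_lebesgue_integral)
    qed
    show "AE G in ?\<Gamma>. norm ((\<integral>x. iexp (Z G x / sqrt n) \<partial>M n) ^ n) \<le> 1" for n
    proof (rule AE_I2)
      fix G
      interpret M: prob_space "M n" by fact
      have "norm (\<integral>x. iexp (Z G x / sqrt n) \<partial>M n) \<le> (\<integral>x. norm (iexp (Z G x / sqrt n)) \<partial>M n)"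
        by (rule integral_norm_bound)
      then have "norm (\<integral>x. iexp (Z G x / sqrt n) \<partial>M n) \<le> 1" by (simp add: M.prob_space)
      then show "norm ((\<integral>x. iexp (Z G x / sqrt n) \<partial>M n) ^ n) \<le> 1"
        by (simp add: norm_power power_le_one)
    qed
    show "AE G in ?\<Gamma>. (\<lambda>n. (\<integral>x. iexp (Z G x / sqrt n) \<partial>M n) ^ n)
       \<longlonglongrightarrow> (\<Prod>i\<in>I. exp (\<i> * of_real (sqrt (2 * (t * a i)) * m i * G i) - of_real (t * a i * (G i)\<^sup>2)))"
      using lim by simp
  qed auto
  also have "(\<integral>G. (\<Prod>i\<in>I. exp (\<i> * of_real (sqrt (2 * (t * a i)) * m i * G i) - of_real (t * a i * (G i)\<^sup>2))) \<partial>?\<Gamma>)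
      = (\<Prod>i\<in>I. of_real (gauss_laplace (t * a i) (m i)))"
  proof (subst Ns.product_integral_prod[OF I])
    show "integrable std_normal_distribution (\<lambda>x. exp (\<i> * of_real (sqrt (2 * (t * a i)) * m i * x) - of_real (t * a i * x\<^sup>2)))"
      if "i \<in> I" for i
      by (rule N.integrable_const_bound[of _ 1]) (use that a t in auto)
  next
    show "(\<Prod>i\<in>I. \<integral>x. exp (\<i> * of_real (sqrt (2 * (t * a i)) * m i * x) - of_real (t * a i * x\<^sup>2)) \<partial>std_normal_distribution)
      = (\<Prod>i\<in>I. of_real (gauss_laplace (t * a i) (m i)))"
      using a t by (intro prod.cong refl integral_iexp_square_std_normal) simp
  qed
  also have "(\<lambda>n. \<integral>G. (\<integral>x. iexp (Z G x / sqrt n) \<partial>M n) ^ n \<partial>?\<Gamma>) = (\<lambda>n. complex_of_real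
      (\<integral>u. exp (- (t * (\<Sum>i\<in>I. a i * ((\<Sum>j=1..n. g i (u j)) / sqrt n)\<^sup>2))) \<partial>PiM {1..n} (\<lambda>_. M n)))"
    unfolding Z_def s_def by (rule ext, rule laplace_quadratic_form[symmetric]) (use M I g a t in auto)
  finally show ?thesis
    by (simp flip: of_real_prod add: tendsto_of_real_iff)
qed

subsection \<open>Reproducing kernels of finite trace\<close>

text \<open>The linear span of the sections K(., z), given inductively so that a linear property has
  to be checked on sections only.\<close>

inductive_set kernel_span :: "('a \<Rightarrow> 'a \<Rightarrow> real) \<Rightarrow> 'a set \<Rightarrow> ('a \<Rightarrow> real) set"
  for K :: "'a \<Rightarrow> 'a \<Rightarrow> real" and S :: "'a set" where
  kernel: "z \<in> S \<Longrightarrow> (\<lambda>x. K x z) \<in> kernel_span K S"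
| lincomb: "f \<in> kernel_span K S \<Longrightarrow> g \<in> kernel_span K S \<Longrightarrow> (\<lambda>x. a * f x + b * g x) \<in> kernel_span K S"

lemma kernel_span_diff_sum:
  assumes "f \<in> kernel_span K S" "\<And>i. i < (r::nat) \<Longrightarrow> g i \<in> kernel_span K S"
  shows "(\<lambda>x. f x - (\<Sum>i<r. c i * g i x)) \<in> kernel_span K S"
  using assms(2)
proof (induction r)
  case (Suc r)
  then have "(\<lambda>x. 1 * (f x - (\<Sum>i<r. c i * g i x)) + (- c r) * g r x) \<in> kernel_span K S"
    by (intro kernel_span.lincomb) auto
  then show ?case by (simp add: algebra_simps)
qed (use assms(1) in simp)

text \<open>The kernel of an orthogonal projection of rank d, described without its range: the
  reproducing identity is idempotence, and a diagonal equal to d over a probability space means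
  trace d.\<close>

locale reproducing_kernel = prob_space M for M :: "'a measure" +
  fixes K :: "'a \<Rightarrow> 'a \<Rightarrow> real" and d :: nat and B :: real
  assumes kernel_measurable: "\<And>z. z \<in> space M \<Longrightarrow> (\<lambda>x. K x z) \<in> borel_measurable M"
    and kernel_bound: "\<And>x z. x \<in> space M \<Longrightarrow> z \<in> space M \<Longrightarrow> \<bar>K x z\<bar> \<le> B"
    and kernel_sym: "\<And>x z. K x z = K z x"
    and kernel_reproducing: "\<And>x z. x \<in> space M \<Longrightarrow> z \<in> space M \<Longrightarrow> (\<integral>y. K x y * K y z \<partial>M) = K x z"
    and kernel_diagonal: "\<And>x. x \<in> space M \<Longrightarrow> K x x = d"
begin

abbreviation "kspan \<equiv> kernel_span K (space M)"

lemma span_measurable: "f \<in> kspan \<Longrightarrow> f \<in> borel_measurable M"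
  by (induction rule: kernel_span.induct) (auto intro: kernel_measurable)

lemma span_bounded: "f \<in> kspan \<Longrightarrow> \<exists>C. \<forall>x\<in>space M. \<bar>f x\<bar> \<le> C"
proof (induction rule: kernel_span.induct)
  case (lincomb f g a b)
  then obtain C D where "\<forall>x\<in>space M. \<bar>f x\<bar> \<le> C" "\<forall>x\<in>space M. \<bar>g x\<bar> \<le> D" by blast
  then show ?case
    by (intro exI[of _ "\<bar>a\<bar> * C + \<bar>b\<bar> * D"])
      (auto simp: abs_mult intro!: order_trans[OF abs_triangle_ineq] add_mono mult_left_mono)
qed (use kernel_bound in blast)

lemma span_mult_integrable:
  assumes "f \<in> kspan" "g \<in> kspan"
  shows "integrable M (\<lambda>x. f x * g x)"
proof -
  obtain C D where C: "\<And>x. x \<in> space M \<Longrightarrow> \<bar>f x\<bar> \<le> C" and D: "\<And>x. x \<in> space M \<Longrightarrow> \<bar>g x\<bar> \<le> D"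
    using assms[THEN span_bounded] by blast
  show ?thesis
  proof (rule integrable_const_bound[of _ "C * D"])
    show "AE x in M. norm (f x * g x) \<le> C * D"
      by (rule AE_I2) (auto simp: abs_mult intro!: mult_mono C D order_trans[OF abs_ge_zero C])
  qed (use assms[THEN span_measurable] in auto)
qed

lemma span_reproducing:
  assumes "f \<in> kspan" "x \<in> space M"
  shows "(\<integral>y. f y * K y x \<partial>M) = f x"
  using assms(1)
proof (induction rule: kernel_span.induct)
  case (kernel z)
  have "(\<integral>y. K y z * K y x \<partial>M) = (\<integral>y. K x y * K y z \<partial>M)"
    by (simp add: kernel_sym[of _ x] mult.commute)
  then show ?case
    using kernel_reproducing[OF assms(2) kernel] by simp
next
  case (lincomb f g a b)
  have k: "(\<lambda>y. K y x) \<in> kspan" using assms(2) by (rule kernel_span.kernel)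
  have "(\<integral>y. (a * f y + b * g y) * K y x \<partial>M) = (\<integral>y. a * (f y * K y x) + b * (g y * K y x) \<partial>M)"
    by (simp add: algebra_simps)
  also have "\<dots> = a * f x + b * g x"
    using span_mult_integrable[OF lincomb(1) k] span_mult_integrable[OF lincomb(2) k] lincomb(3,4) by simp
  finally show ?case .
qed

text \<open>The kernel of the projection onto the part of the span orthogonal to g 0, ..., g (r -
  1), when these are orthonormal.\<close>

definition residual :: "(nat \<Rightarrow> 'a \<Rightarrow> real) \<Rightarrow> nat \<Rightarrow> 'a \<Rightarrow> 'a \<Rightarrow> real" where
  "residual g r z x = K x z - (\<Sum>i<r. g i z * g i x)"

definition orthonormal :: "(nat \<Rightarrow> 'a \<Rightarrow> real) \<Rightarrow> nat \<Rightarrow> bool" where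
  "orthonormal g r \<longleftrightarrow> (\<forall>i<r. g i \<in> kspan) \<and> (\<forall>i<r. \<forall>j<r. (\<integral>x. g i x * g j x \<partial>M) = (if i = j then 1 else 0))"

context
  fixes g r assumes g: "orthonormal g r"
begin

lemma residual_span: "z \<in> space M \<Longrightarrow> residual g r z \<in> kspan"
  unfolding residual_def using g
  by (intro kernel_span_diff_sum kernel_span.kernel) (auto simp: orthonormal_def)

lemma integral_mult_residual:
  assumes "f \<in> kspan" "z \<in> space M"
  shows "(\<integral>x. f x * residual g r z x \<partial>M) = f z - (\<Sum>i<r. g i z * (\<integral>x. f x * g i x \<partial>M))"
proof -
  have i: "integrable M (\<lambda>x. f x * g i x)" if "i < r" for i
    using g that assms(1) by (auto simp: orthonormal_def intro: span_mult_integrable)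
  have k: "integrable M (\<lambda>x. f x * K x z)"
    using assms by (intro span_mult_integrable kernel_span.kernel)
  have "(\<integral>x. f x * residual g r z x \<partial>M) = (\<integral>x. f x * K x z - (\<Sum>i<r. g i z * (f x * g i x)) \<partial>M)"
    by (simp add: residual_def algebra_simps sum_distrib_left)
  also have "\<dots> = (\<integral>x. f x * K x z \<partial>M) - (\<Sum>i<r. g i z * (\<integral>x. f x * g i x \<partial>M))"
    using i k by (subst Bochner_Integration.integral_diff) auto
  finally show ?thesis using assms by (simp add: span_reproducing)
qed

lemma residual_orthogonal:
  assumes "z \<in> space M" "j < r"
  shows "(\<integral>x. residual g r z x * g j x \<partial>M) = 0"
proof -
  have "(\<integral>x. g j x * residual g r z x \<partial>M) = g j z - (\<Sum>i<r. g i z * (\<integral>x. g j x * g i x \<partial>M))"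
    using g assms by (intro integral_mult_residual) (auto simp: orthonormal_def)
  also have "(\<Sum>i<r. g i z * (\<integral>x. g j x * g i x \<partial>M)) = (\<Sum>i<r. if j = i then g i z else 0)"
    using g assms by (intro sum.cong) (auto simp: orthonormal_def)
  also have "\<dots> = g j z" using assms by simp
  finally show ?thesis by (simp add: mult.commute)
qed

text \<open>The residual kernel is again idempotent. In particular its diagonal is a squared norm
  and therefore nonnegative.\<close>

lemma integral_residual_residual:
  assumes "y \<in> space M" "z \<in> space M"
  shows "(\<integral>x. residual g r z x * residual g r y x \<partial>M) = residual g r z y"
  using assms by (simp add: integral_mult_residual residual_span residual_orthogonal)

lemma integral_residual_diagonal: "(\<integral>z. residual g r z z \<partial>M) = real d - real r"
proof -
  have i: "integrable M (\<lambda>x. g i x * g i x)" if "i < r" for i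
    using g that by (auto simp: orthonormal_def intro: span_mult_integrable)
  have "(\<integral>z. residual g r z z \<partial>M) = (\<integral>z. real d - (\<Sum>i<r. g i z * g i z) \<partial>M)"
    by (rule Bochner_Integration.integral_cong) (auto simp: residual_def kernel_diagonal)
  also have "\<dots> = real d - (\<Sum>i<r. \<integral>z. g i z * g i z \<partial>M)"
    using i by (subst Bochner_Integration.integral_diff) (auto simp: prob_space)
  also have "(\<Sum>i<r. \<integral>z. g i z * g i z \<partial>M) = (\<Sum>i<r. 1)"
    using g by (intro sum.cong) (auto simp: orthonormal_def)
  finally show ?thesis by simp
qed

text \<open>For r < d the residual kernel has positive trace, hence a positive diagonal value at
  some z. Its section at z is orthogonal to the functions already chosen and not zero.\<close>

lemma orthonormal_extend:
  assumes "r < d"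
  shows "\<exists>h. orthonormal (g(r := h)) (Suc r)"
proof -
  have "\<exists>z\<in>space M. residual g r z z > 0"
  proof (rule ccontr)
    assume "\<not> ?thesis"
    then have "0 \<le> (\<integral>z. - residual g r z z \<partial>M)"
      by (intro integral_nonneg_AE AE_I2) (auto simp: not_less)
    with integral_residual_diagonal assms show False by simp
  qed
  then obtain z where z: "z \<in> space M" "residual g r z z > 0" by blast
  \<comment> \<open>By idempotence the section at z has squared norm
    \<open>residual g r z z\<close>.\<close>
  define c where "c = 1 / sqrt (residual g r z z)"
  define h where "h x = c * residual g r z x" for x
  have "(\<lambda>x. c * residual g r z x + 0 * residual g r z x) \<in> kspan"
    using z by (intro kernel_span.lincomb residual_span)
  then have h: "h \<in> kspan" by (simp add: h_def[abs_def])
  have hg: "(\<integral>x. h x * g j x \<partial>M) = 0" if "j < r" for j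
    unfolding h_def mult.assoc using residual_orthogonal[OF z(1) that] by simp
  have "(\<integral>x. h x * h x \<partial>M) = c * (c * (\<integral>x. residual g r z x * residual g r z x \<partial>M))"
    unfolding h_def by (simp add: mult_ac)
  also have "\<dots> = 1"
    using integral_residual_residual[OF z(1) z(1)] z(2) by (simp add: c_def field_simps)
  finally have "(\<integral>x. h x * h x \<partial>M) = 1" .
  moreover have "(\<integral>x. g j x * h x \<partial>M) = 0" if "j < r" for j
    using hg[OF that] by (simp add: mult.commute)
  ultimately have "orthonormal (g(r := h)) (Suc r)"
    using g h hg by (auto simp: orthonormal_def less_Suc_eq)
  then show ?thesis by blast
qed

text \<open>A nonnegative diagonal with integral 0 vanishes almost everywhere. At such a point y the
  section has norm 0, and idempotence turns \<open>residual g r z y\<close> into an inner product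
  with that section.\<close>

lemma residual_eq_0:
  assumes "r = d" "x \<in> space M" "z \<in> space M"
  shows "residual g r z x = 0"
proof -
  have nonneg: "residual g r y y \<ge> 0" if "y \<in> space M" for y
    unfolding integral_residual_residual[OF that that, symmetric] by simp
  have rm: "residual g r y \<in> borel_measurable M" if "y \<in> space M" for y
    by (rule span_measurable[OF residual_span[OF that]])
  have meas: "(\<lambda>y. residual g r y y) \<in> borel_measurable M"
  proof -
    have "g i \<in> borel_measurable M" if "i < r" for i
      using g that by (auto simp: orthonormal_def intro: span_measurable)
    then have "(\<lambda>y. real d - (\<Sum>i<r. g i y * g i y)) \<in> borel_measurable M"
      by auto
    then show ?thesis
      by (rule measurable_cong[THEN iffD1, rotated]) (simp add: residual_def kernel_diagonal)
  qed
  have "integrable M (\<lambda>y. residual g r y y)"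
  proof (rule integrable_const_bound[of _ d])
    show "AE y in M. norm (residual g r y y) \<le> real d"
    proof (rule AE_I2)
      fix y assume y: "y \<in> space M"
      have "residual g r y y \<le> real d"
        unfolding residual_def using y by (simp add: kernel_diagonal sum_nonneg)
      with nonneg[OF y] show "norm (residual g r y y) \<le> real d" by simp
    qed
  qed (rule meas)
  from integral_nonneg_eq_0_iff_AE[OF this] have "AE y in M. residual g r y y = 0"
    using integral_residual_diagonal assms(1) nonneg by simp
  then have "AE y in M. residual g r z y = 0"
  proof (rule AE_mp, intro AE_I2 impI)
    fix y assume y: "y \<in> space M" "residual g r y y = 0"
    have "AE u in M. residual g r y u * residual g r y u = 0"
      using integral_residual_residual[OF y(1) y(1)] y(2)
        integral_nonneg_eq_0_iff_AE[OF span_mult_integrable[OF residual_span[OF y(1)] residual_span[OF y(1)]]]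
      by simp
    then have "(\<integral>u. residual g r z u * residual g r y u \<partial>M) = (\<integral>u. 0 \<partial>M)"
      using rm[OF assms(3)] rm[OF y(1)] by (intro integral_cong_AE) auto
    then show "residual g r z y = 0"
      using integral_residual_residual[OF y(1) assms(3)] by simp
  qed
  \<comment> \<open>Integration against a section of K evaluates a function of the span at a point;
    this improves "almost everywhere" to "everywhere".\<close>
  then have "(\<integral>y. residual g r z y * K y x \<partial>M) = (\<integral>y. 0 \<partial>M)"
    using rm[OF assms(3)] kernel_measurable[OF assms(2)] by (intro integral_cong_AE) auto
  then show ?thesis
    using span_reproducing[OF residual_span assms(2)] assms(3) by simp
qed

end

lemma orthonormal_ex: "r \<le> d \<Longrightarrow> \<exists>g. orthonormal g r"
proof (induction r)
  case (Suc r)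
  then obtain g where "orthonormal g r" by auto
  with orthonormal_extend[of g r] Suc show ?case by auto
qed (simp add: orthonormal_def)

text \<open>
  The trace of the kernel is the dimension: each new orthonormal function lowers the trace of the
  residual kernel by one, and a residual kernel of trace 0 vanishes.
\<close>

theorem kernel_decomposition:
  obtains g where "\<And>i. i < d \<Longrightarrow> g i \<in> kspan"
    and "\<And>i j. i < d \<Longrightarrow> j < d \<Longrightarrow> (\<integral>x. g i x * g j x \<partial>M) = (if i = j then 1 else 0)"
    and "\<And>x z. x \<in> space M \<Longrightarrow> z \<in> space M \<Longrightarrow> K x z = (\<Sum>i<d. g i x * g i z)"
proof -
  obtain g where g: "orthonormal g d" using orthonormal_ex by blast
  show thesis
  proof (rule that[of g])
    fix x z assume "x \<in> space M" "z \<in> space M"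
    then show "K x z = (\<Sum>i<d. g i x * g i z)"
      using residual_eq_0[OF g refl, of x z] by (simp add: residual_def mult.commute)
  qed (use g in \<open>auto simp: orthonormal_def\<close>)
qed

end

subsection \<open>Coefficients of two-point moments\<close>

text \<open>For unit vectors with inner product s the squared norm of u + t w is 1 + 2 s t + t^2.
  Splitting off the middle term leaves powers of 1 + t^2, which have even exponents only.\<close>

lemma coeff_quadratic_power:
  fixes s :: real
  shows "coeff ([:1, 2 * s, 1:] ^ c) b = (\<Sum>m\<le>c. if m \<le> b \<and> even (b - m)
    then real (c choose m) * real ((c - m) choose ((b - m) div 2)) * (2 * s) ^ m else 0)"
proof -
  have sq: "coeff ([:1, 0, 1:] ^ n) r = (if even r then real (n choose (r div 2)) else 0)" for n r
  proof -
    have "[:1, 0, 1:] = monom 1 2 + (1 :: real poly)"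
      by (simp add: monom_altdef numeral_2_eq_2 one_pCons)
    then have "[:1, 0, 1:] ^ n = (\<Sum>k\<le>n. of_nat (n choose k) * monom 1 2 ^ k :: real poly)"
      by (simp add: binomial_ring)
    also have "\<dots> = (\<Sum>k\<le>n. monom (real (n choose k)) (2 * k))"
      by (intro sum.cong refl) (simp add: monom_power of_nat_poly smult_monom)
    finally have "coeff ([:1, 0, 1:] ^ n) r = (\<Sum>k\<le>n. if 2 * k = r then real (n choose k) else 0)"
      by (simp add: coeff_sum)
    also have "\<dots> = (if even r then real (n choose (r div 2)) else 0)"
    proof (cases "even r")
      case True
      then obtain q where q: "r = 2 * q" by blast
      then show ?thesis
        using sum.delta[of "{..n}" q "\<lambda>k. real (n choose k)"]
        by (auto simp: if_distrib cong: if_cong)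
    qed (auto intro!: sum.neutral)
    finally show ?thesis .
  qed
  have "[:1, 2 * s, 1:] = monom (2 * s) 1 + [:1, 0, 1:]"
    by (simp add: monom_altdef)
  then have "[:1, 2 * s, 1:] ^ c = (\<Sum>m\<le>c. of_nat (c choose m) * monom (2 * s) 1 ^ m * [:1, 0, 1:] ^ (c - m))"
    by (simp only: binomial_ring)
  also have "\<dots> = (\<Sum>m\<le>c. monom (real (c choose m) * (2 * s) ^ m) m * [:1, 0, 1:] ^ (c - m))"
    by (intro sum.cong refl) (simp add: monom_power of_nat_poly smult_monom)
  finally have "coeff ([:1, 2 * s, 1:] ^ c) b = (\<Sum>m\<le>c. coeff (monom (real (c choose m) * (2 * s) ^ m) m * [:1, 0, 1:] ^ (c - m)) b)"
    by (simp only: coeff_sum)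
  also have "\<dots> = (\<Sum>m\<le>c. if m \<le> b \<and> even (b - m)
      then real (c choose m) * real ((c - m) choose ((b - m) div 2)) * (2 * s) ^ m else 0)"
  proof (rule sum.cong[OF refl])
    fix m
    show "coeff (monom (real (c choose m) * (2 * s) ^ m) m * [:1, 0, 1:] ^ (c - m)) b = (if m \<le> b \<and> even (b - m)
      then real (c choose m) * real ((c - m) choose ((b - m) div 2)) * (2 * s) ^ m else 0)"
      unfolding coeff_monom_mult sq by (simp only: not_le[symmetric] mult_ac if_not_P) auto
  qed
  finally show ?thesis .
qed

text \<open>The product p (p + 2) ... (p + 2 c - 2), the denominator of the moment of order 2 c of a
  coordinate of a uniform unit vector.\<close>

definition sphere_weight :: "nat \<Rightarrow> nat \<Rightarrow> real" where
  "sphere_weight p c = (\<Prod>l<c. real p + 2 * real l)"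

lemma sphere_weight_pos: "p > 0 \<Longrightarrow> sphere_weight p c > 0"
  unfolding sphere_weight_def by (intro prod_pos) auto

lemma sphere_weight_Suc: "sphere_weight p (Suc c) = sphere_weight p c * (real p + 2 * real c)"
  by (simp add: sphere_weight_def)

text \<open>The coefficient of $s^m$ in the mean of $(x \cdot u)^a (x \cdot w)^b$ over unit vectors x,
  where u and w are unit vectors with inner product s.\<close>

definition moment_coeff :: "nat \<Rightarrow> nat \<Rightarrow> nat \<Rightarrow> nat \<Rightarrow> real" where
  "moment_coeff p m a b = (if m \<le> a \<and> m \<le> b \<and> even (a - m) \<and> even (b - m)
     then fact a * fact b / (fact m * fact ((a - m) div 2) * fact ((b - m) div 2) *
        2 ^ ((a - m) div 2 + (b - m) div 2) * sphere_weight p ((a + b) div 2)) else 0)"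

text \<open>The generic case: all three coefficients are multiples of the common factor
  \<open>Q\<close>, and the polynomial identity \<open>id\<close> in the half-differences is all
  that remains.\<close>

lemma moment_coeff_recurrence_aux:
  assumes "p > 0" and a: "a = m + 2 * i'" and b: "b = m + 2 * j"
  shows "(real m + 2) * (real m + 1) * moment_coeff p (m + 2) (a + 2) b
     = (real m * (real m + real p - 2) - (real a + 2) * (real a + real p)) * moment_coeff p m (a + 2) b
       + (real a + 2) * (real a + 1) * moment_coeff p m a b"
proof -
  have w: "sphere_weight p (m + i' + j) > 0" by (rule sphere_weight_pos[OF assms(1)])
  have e: "a + 2 = m + 2 * Suc i'" using a by simp
  have 1: "moment_coeff p m a b = fact a * fact b / (fact m * fact i' * fact j * 2 ^ (i' + j) * sphere_weight p (m + i' + j))"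
    unfolding moment_coeff_def a b by (simp add: add.assoc)
  have 2: "moment_coeff p m (a + 2) b = fact (a + 2) * fact b /
      (fact m * fact (Suc i') * fact j * 2 ^ (Suc i' + j) * sphere_weight p (Suc (m + i' + j)))"
    unfolding moment_coeff_def e b by (simp add: add.assoc)
  \<comment> \<open>For j = 0 the index m + 2 exceeds b and the coefficient is 0. The factor j in
    \<open>Q3\<close> makes the two cases agree.\<close>
  have 3: "moment_coeff p (m + 2) (a + 2) b = (if j = 0 then 0 else fact (a + 2) * fact b /
      (fact (m + 2) * fact i' * fact (j - 1) * 2 ^ (i' + (j - 1)) * sphere_weight p (Suc (m + i' + j))))"
  proof (cases j)
    case (Suc j')
    then show ?thesis unfolding moment_coeff_def e b by (simp add: add.assoc)
  qed (simp add: moment_coeff_def a b)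
  define Q where "Q = fact a * fact b / (fact m * fact i' * fact j * 2 ^ (i' + j) * sphere_weight p (m + i' + j))"
  define P where "P = real p + 2 * real (m + i' + j)"
  have P: "P > 0" using assms by (simp add: P_def)
  have Q2: "moment_coeff p m (a + 2) b = Q * (real a + 2) * (real a + 1) / (2 * (real i' + 1) * P)"
    unfolding 2 Q_def P_def sphere_weight_Suc using w assms by (simp add: field_simps)
  have Q3: "(real m + 2) * (real m + 1) * moment_coeff p (m + 2) (a + 2) b = Q * (real a + 2) * (real a + 1) * (2 * real j) / P"
  proof (cases j)
    case (Suc j')
    have m: "fact (m + 2) = (real m + 2) * (real m + 1) * fact m" by (simp add: algebra_simps)
    have a2: "fact (a + 2) = (real a + 2) * (real a + 1) * fact a" by (simp add: algebra_simps)
    have "fact j = (real j) * fact (j - 1)" "(2::real) ^ (i' + j) = 2 * 2 ^ (i' + (j - 1))" using Suc by simp_all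
    moreover have "real m + 2 > 0" "real m + 1 > 0" by simp_all
    ultimately show ?thesis
      using Suc w P unfolding 3 Q_def m a2 sphere_weight_Suc P_def[symmetric] by (simp add: divide_simps)
  qed (use 3 in simp)
  have ii: "real i' + 1 > 0" by simp
  have id: "2 * real j * (2 * (real i' + 1)) = (real m * (real m + real p - 2) - (real a + 2) * (real a + real p)) + 2 * (real i' + 1) * P"
    unfolding P_def a by (simp add: algebra_simps)
  have "Q * (real a + 2) * (real a + 1) * (2 * real j) / P =
       (real m * (real m + real p - 2) - (real a + 2) * (real a + real p)) *
        (Q * (real a + 2) * (real a + 1) / (2 * (real i' + 1) * P)) + (real a + 2) * (real a + 1) * Q"
  proof -
    have "Q * (real a + 2) * (real a + 1) * (2 * real j) / P
      = Q * (real a + 2) * (real a + 1) / (2 * (real i' + 1) * P) * (2 * real j * (2 * (real i' + 1)))"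
      using ii by simp
    also have "\<dots> = (real m * (real m + real p - 2) - (real a + 2) * (real a + real p)) *
        (Q * (real a + 2) * (real a + 1) / (2 * (real i' + 1) * P))
        + Q * (real a + 2) * (real a + 1) / (2 * (real i' + 1) * P) * (2 * (real i' + 1) * P)"
      unfolding id by (simp only: distrib_left mult.commute)
    also have "Q * (real a + 2) * (real a + 1) / (2 * (real i' + 1) * P) * (2 * (real i' + 1) * P) = (real a + 2) * (real a + 1) * Q"
      using ii P by simp
    finally show ?thesis .
  qed
  then show ?thesis
    unfolding Q3 Q2 1 Q_def[symmetric] .
qed

text \<open>Let J_q(s) be the sum over m of \<open>moment_coeff p m q b\<close> times s^m and L = (1
  - s^2) D^2 - (p - 1) s D. Then L J_q = q (q - 1) J_(q-2) - q (q + p - 2) J_q, just as L t^q = q (q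
  - 1) t^(q-2) - q (q + p - 2) t^q; here the coefficients of s^m are compared. The first part is q =
  a + 2, the second q \<le> 1, where the term J_(q-2) has factor 0.\<close>

lemma moment_coeff_recurrence:
  assumes "p > 0"
  shows "(real m + 2) * (real m + 1) * moment_coeff p (m + 2) (a + 2) b
     = (real m * (real m + real p - 2) - (real a + 2) * (real a + real p)) * moment_coeff p m (a + 2) b
       + (real a + 2) * (real a + 1) * moment_coeff p m a b" (is ?A)
    and "a \<le> 1 \<Longrightarrow> (real m + 2) * (real m + 1) * moment_coeff p (m + 2) a b
     = (real m * (real m + real p - 2) - real a * (real a + real p - 2)) * moment_coeff p m a b" (is "_ \<Longrightarrow> ?B")
proof -
  show ?A
  proof (cases "m \<le> a + 2 \<and> m \<le> b \<and> even (a + 2 - m) \<and> even (b - m)")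
    case False
    then have "moment_coeff p (m + 2) (a + 2) b = 0" "moment_coeff p m (a + 2) b = 0" "moment_coeff p m a b = 0"
      by (auto simp: moment_coeff_def)
    then show ?thesis by simp
  next
    case True
    then obtain i j where ij: "a + 2 = m + 2 * i" "b = m + 2 * j"
      by (metis dvdE le_add_diff_inverse)
    show ?thesis
    proof (cases i)
      case 0
      \<comment> \<open>The bracket vanishes at m = a + 2, and the other two coefficients are 0
        there.\<close>
      then have "m = a + 2" using ij by simp
      then show ?thesis by (simp add: moment_coeff_def algebra_simps)
    next
      case (Suc i')
      then have a: "a = m + 2 * i'" using ij by simp
      show ?thesis
        by (rule moment_coeff_recurrence_aux[OF assms a ij(2)])
    qed
  qed
  show ?B if "a \<le> 1"
  proof (cases "m = a")
    case False
    with that have "\<not> (m \<le> a \<and> even (a - m))" "\<not> m + 2 \<le> a"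
      by presburger+
    then have "moment_coeff p (m + 2) a b = 0" "moment_coeff p m a b = 0"
      unfolding moment_coeff_def by auto
    then show ?thesis by simp
  qed (use that in \<open>auto simp: moment_coeff_def\<close>)
qed

text \<open>
  In the two-point moments, the Laplace-Beltrami operator acts in the same way on both arguments,
  so that an eigenpolynomial is mapped to a multiple of itself; this is the coefficient form.
\<close>

lemma moment_coeff_eigen:
  fixes c :: "nat \<Rightarrow> real"
  assumes p: "p \<ge> 2" and k: "k \<ge> 1" "b \<le> k"
    and c0: "\<And>q. q > k \<Longrightarrow> c q = 0"
    and rec: "\<And>q. (real q + 2) * (real q + 1) * c (q + 2) = - (real k - real q) * (real k + real q + real p - 2) * c q"
  shows "(\<Sum>a\<le>k. c a * moment_coeff p m a b) = (if b = k then fact k / sphere_weight p k else 0) * c m"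
proof -
  define j where "j m = (\<Sum>a\<le>k. c a * moment_coeff p m a b)" for m
  define \<rho> where "\<rho> = (if b = k then fact k / sphere_weight p k else 0)"
  \<comment> \<open>Additional zero terms at the top, so that the shift from a to a + 2 has no upper
    boundary terms.\<close>
  have j_ext: "j m = (\<Sum>a<k + 2 + i. c a * moment_coeff p m a b)" for m i
    unfolding j_def by (rule sum.mono_neutral_left) (auto simp: c0)
  have jrec: "(real m + 2) * (real m + 1) * j (m + 2) = - (real k - real m) * (real k + real m + real p - 2) * j m" for m
  proof -
    let ?M = "\<lambda>m a. moment_coeff p m a b"
    let ?e = "\<lambda>a. real a * (real a + real p - 2)"
    have split2: "(\<Sum>a<k + 2. f a) = f 0 + f 1 + (\<Sum>a<k. f (a + 2))" for f :: "nat \<Rightarrow> real"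
      unfolding add_2_eq_Suc' sum.lessThan_Suc_shift by simp
    have "(real m + 2) * (real m + 1) * j (m + 2) = (\<Sum>a<k + 2. c a * ((real m + 2) * (real m + 1) * ?M (m + 2) a))"
      using j_ext[of "m + 2" 0] by (simp add: sum_distrib_left mult_ac del: sum.lessThan_Suc)
    also have "\<dots> = (\<Sum>a<k + 2. c a * ((?e m - ?e a) * ?M m a)) + (\<Sum>a<k. c (a + 2) * ((real a + 2) * (real a + 1) * ?M m a))"
    proof -
      have "c (a + 2) * ((real m + 2) * (real m + 1) * ?M (m + 2) (a + 2)) =
          c (a + 2) * ((?e m - ?e (a + 2)) * ?M m (a + 2)) + c (a + 2) * ((real a + 2) * (real a + 1) * ?M m a)" for a
        unfolding moment_coeff_recurrence(1)[of p m a b, OF order_less_le_trans[OF zero_less_numeral p]]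
        by (simp add: algebra_simps)
      moreover have "(real m + 2) * (real m + 1) * ?M (m + 2) a = (?e m - ?e a) * ?M m a" if "a \<le> 1" for a
        using moment_coeff_recurrence(2)[of p a m b] p that by simp
      ultimately show ?thesis
        unfolding split2 by (simp add: sum.distrib)
    qed
    \<comment> \<open>The recurrence of \<open>c\<close> moves the operator from the moments to the
      polynomial; the terms depending on a then cancel, and only the eigenvalue of degree k
      remains.\<close>
    also have "(\<Sum>a<k. c (a + 2) * ((real a + 2) * (real a + 1) * ?M m a)) = (\<Sum>a<k + 2. - (?e k - ?e a) * (c a * ?M m a))"
    proof -
      have "(\<Sum>a<k + 2. - (?e k - ?e a) * (c a * ?M m a)) = (\<Sum>a<k. - (?e k - ?e a) * (c a * ?M m a))"
        by (simp add: c0)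
      also have "\<dots> = (\<Sum>a<k. c (a + 2) * ((real a + 2) * (real a + 1) * ?M m a))"
      proof (rule sum.cong[OF refl])
        fix a
        have "- (?e k - ?e a) * c a = (real a + 2) * (real a + 1) * c (a + 2)"
          unfolding rec by (simp add: algebra_simps)
        then show "- (?e k - ?e a) * (c a * ?M m a) = c (a + 2) * ((real a + 2) * (real a + 1) * ?M m a)"
          by (metis mult.assoc mult.commute)
      qed
      finally show ?thesis ..
    qed
    also have "(\<Sum>a<k + 2. c a * ((?e m - ?e a) * ?M m a)) + (\<Sum>a<k + 2. - (?e k - ?e a) * (c a * ?M m a))
        = - (?e k - ?e m) * (\<Sum>a<k + 2. c a * ?M m a)"
      unfolding sum.distrib[symmetric] sum_distrib_left by (intro sum.cong refl) (simp add: algebra_simps)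
    also have "(\<Sum>a<k + 2. c a * ?M m a) = j m"
      using j_ext[of m 0] by simp
    finally show ?thesis by (simp add: algebra_simps)
  qed
  \<comment> \<open>\<open>j\<close> and \<open>c\<close> obey the same two-step recurrence, which
    runs downwards from k. It remains to compare them from k on, where the only nonzero coefficient
    has m = a = b = k and equals \<open>fact k / sphere_weight p k\<close>.\<close>
  have ge: "j m = \<rho> * c m" if "m \<ge> k" for m
  proof (cases "m = k \<and> b = k")
    case True
    have "j m = (\<Sum>a\<le>k. if a = k then c a * moment_coeff p m a b else 0)"
      unfolding j_def by (rule sum.cong) (use True in \<open>auto simp: moment_coeff_def\<close>)
    then show ?thesis using True by (simp add: moment_coeff_def \<rho>_def)
  next
    case False
    then have "\<And>a. moment_coeff p m a b = 0" "\<rho> * c m = 0"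
      using that k(2) c0 by (auto simp: moment_coeff_def \<rho>_def)
    then show ?thesis by (simp add: j_def)
  qed
  have "j (k - n) = \<rho> * c (k - n)" for n
  proof (induction n rule: less_induct)
    case (less n)
    show ?case
    proof (cases "n = 0 \<or> k < n")
      case True
      show ?thesis
      proof (cases "n = 0")
        case False
        \<comment> \<open>Truncated subtraction: for n > k the index k - n is 0, which is the case n
          = k already known by induction.\<close>
        with True have "k - n = k - k" by simp
        then show ?thesis using less[of k] True False by (simp del: diff_self_eq_0)
      qed (use ge in simp)
    next
      case False
      define q where "q = k - n"
      have q: "q < k" "q + 2 \<ge> k \<or> q + 2 = k - (n - 2)" "n - 2 < n" using False by (auto simp: q_def)
      have "j (q + 2) = \<rho> * c (q + 2)"
        using q(2)
      proof
        assume "q + 2 = k - (n - 2)"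
        then show ?thesis using less.IH[OF q(3)] by simp
      qed (rule ge)
      note jq = this
      have "(real k - real q) * (real k + real q + real p - 2) * j q = - ((real q + 2) * (real q + 1) * j (q + 2))"
        unfolding jrec by (simp add: algebra_simps)
      also have "\<dots> = \<rho> * - ((real q + 2) * (real q + 1) * c (q + 2))"
        unfolding jq by simp
      also have "\<dots> = (real k - real q) * (real k + real q + real p - 2) * (\<rho> * c q)"
        unfolding rec by (simp add: algebra_simps)
      finally have "(real k - real q) * (real k + real q + real p - 2) * j q
          = (real k - real q) * (real k + real q + real p - 2) * (\<rho> * c q)" .
      moreover have "(real k - real q) * (real k + real q + real p - 2) \<noteq> 0"
        using q(1) p by auto
      ultimately show ?thesis by (simp add: q_def)
    qed
  qed
  from this[of "k - m"] ge[of m] show ?thesis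
    unfolding j_def[symmetric] \<rho>_def[symmetric] by (cases "m \<le> k") auto
qed

subsection \<open>The uniform distribution on the sphere\<close>

lemma nn_integral_lborel_translate:
  fixes f :: "'a::euclidean_space \<Rightarrow> ennreal"
  assumes [measurable]: "f \<in> borel_measurable borel"
  shows "(\<integral>\<^sup>+ x. f (c + x) \<partial>lborel) = (\<integral>\<^sup>+ x. f x \<partial>lborel)"
proof -
  have "(\<integral>\<^sup>+ x. f x \<partial>lborel) = (\<integral>\<^sup>+ x. f x \<partial>distr lborel borel ((+) c))"
    by (simp add: lborel_distr_plus)
  then show ?thesis by (simp add: nn_integral_distr)
qed

lemma nn_integral_lborel_reflect:
  fixes f :: "'a::euclidean_space \<Rightarrow> ennreal"
  assumes [measurable]: "f \<in> borel_measurable borel"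
  shows "(\<integral>\<^sup>+ x. f (c - x) \<partial>lborel) = (\<integral>\<^sup>+ x. f x \<partial>lborel)"
proof -
  have "(\<integral>\<^sup>+ x. f x \<partial>lborel) = (\<integral>\<^sup>+ x. f x \<partial>density (distr lborel borel (\<lambda>x. c - x)) (\<lambda>_. 1))"
    using lborel_affine[of "-1" c] by simp
  then show ?thesis by (simp add: nn_integral_density nn_integral_distr)
qed

text \<open>Uniqueness of translation-invariant measures, normalised on the unit ball.\<close>

lemma distr_lborel_orthogonal:
  fixes T :: "'a::euclidean_space \<Rightarrow> 'a"
  assumes T: "orthogonal_transformation T"
  shows "distr lborel borel T = lborel"
proof (rule measure_eqI)
  fix A assume "A \<in> sets (distr lborel borel T)"
  then have A[measurable]: "A \<in> sets borel" by simp
  have cont: "continuous_on UNIV T"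
    using T by (simp add: linear_continuous_on linear_linear orthogonal_transformation_linear)
  have Tm[measurable]: "T \<in> borel_measurable borel"
    using cont by (rule borel_measurable_continuous_onI)
  let ?B = "ball 0 1 :: 'a set"
  let ?A = "indicator A :: 'a \<Rightarrow> ennreal" and ?b = "indicator ?B :: 'a \<Rightarrow> ennreal"
  have [measurable]: "?B \<in> sets borel" by simp
  have b: "?b (T z) = ?b z" for z
    using orthogonal_transformation_norm[OF T] by (simp add: indicator_def)
  \<comment> \<open>The product of the measure of the preimage of A with that of the ball. Fubini
    and translations move T from A to the ball, which T preserves; the volume of the ball cancels at
    the end.\<close>
  have "(\<integral>\<^sup>+ z. ?A (T z) \<partial>lborel) * (\<integral>\<^sup>+ y. ?b y \<partial>lborel) = (\<integral>\<^sup>+ z. \<integral>\<^sup>+ y. ?A (T z) * ?b y \<partial>lborel \<partial>lborel)"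
    by (subst nn_integral_multc[symmetric]) (auto simp: nn_integral_cmult_indicator)
  also have "\<dots> = (\<integral>\<^sup>+ z. \<integral>\<^sup>+ y. ?A (T z) * ?b (T z + y) \<partial>lborel \<partial>lborel)"
  proof (rule nn_integral_cong)
    fix z
    show "(\<integral>\<^sup>+ y. ?A (T z) * ?b y \<partial>lborel) = (\<integral>\<^sup>+ y. ?A (T z) * ?b (T z + y) \<partial>lborel)"
      by (rule nn_integral_lborel_translate[symmetric, of "\<lambda>y. ?A (T z) * ?b y" "T z"]) measurable
  qed
  also have "\<dots> = (\<integral>\<^sup>+ y. \<integral>\<^sup>+ z. ?A (T z) * ?b (T z + y) \<partial>lborel \<partial>lborel)"
    by (rule lborel_pair.Fubini') measurable
  also have "\<dots> = (\<integral>\<^sup>+ y. \<integral>\<^sup>+ z. ?A (T z - y) * ?b (T z) \<partial>lborel \<partial>lborel)"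
  proof (rule nn_integral_cong)
    fix y
    obtain c where c: "y = T c"
      using orthogonal_transformation_surj[OF T] by (metis surj_def)
    have add: "T (c + z) = T z + y" for z
      using linear_add[OF orthogonal_transformation_linear[OF T]] c by simp
    have "(\<integral>\<^sup>+ z. ?A (T z - y) * ?b (T z) \<partial>lborel) = (\<integral>\<^sup>+ z. ?A (T (c + z) - y) * ?b (T (c + z)) \<partial>lborel)"
      by (rule nn_integral_lborel_translate[symmetric]) measurable
    then show "(\<integral>\<^sup>+ z. ?A (T z) * ?b (T z + y) \<partial>lborel) = (\<integral>\<^sup>+ z. ?A (T z - y) * ?b (T z) \<partial>lborel)"
      by (simp add: add)
  qed
  also have "\<dots> = (\<integral>\<^sup>+ z. \<integral>\<^sup>+ y. ?A (T z - y) * ?b (T z) \<partial>lborel \<partial>lborel)"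
    by (rule lborel_pair.Fubini') measurable
  also have "\<dots> = (\<integral>\<^sup>+ z. \<integral>\<^sup>+ y. ?A y * ?b z \<partial>lborel \<partial>lborel)"
  proof (rule nn_integral_cong)
    fix z
    show "(\<integral>\<^sup>+ y. ?A (T z - y) * ?b (T z) \<partial>lborel) = (\<integral>\<^sup>+ y. ?A y * ?b z \<partial>lborel)"
      unfolding b by (rule nn_integral_lborel_reflect[of "\<lambda>y. ?A y * ?b z"]) measurable
  qed
  also have "\<dots> = (\<integral>\<^sup>+ y. ?A y \<partial>lborel) * (\<integral>\<^sup>+ z. ?b z \<partial>lborel)"
    by (simp add: nn_integral_cmult nn_integral_multc del: nn_integral_indicator)
  finally have eq: "(\<integral>\<^sup>+ z. ?A (T z) \<partial>lborel) * emeasure lborel ?B = emeasure lborel A * emeasure lborel ?B"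
    by simp
  have "emeasure lborel ?B < \<infinity>" by (rule emeasure_lborel_ball_finite)
  moreover have "emeasure lborel ?B \<noteq> 0"
    using content_ball_pos[of 1 "0::'a"] unfolding measure_def by (metis enn2real_0 less_irrefl zero_less_one)
  ultimately have "(\<integral>\<^sup>+ z. ?A (T z) \<partial>lborel) = emeasure lborel A"
    using eq by (metis ennreal_mult_divide_eq infinity_ennreal_def less_irrefl)
  moreover have "emeasure (distr lborel borel T) A = (\<integral>\<^sup>+ z. ?A (T z) \<partial>lborel)"
    by (subst nn_integral_indicator[symmetric]) (auto simp: nn_integral_distr simp del: nn_integral_indicator)
  ultimately show "emeasure (distr lborel borel T) A = emeasure lborel A" by simp
qed simp

lemma cone_sphere_measurable:
  fixes A :: "(real ^ 'p::finite) set"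
  assumes "A \<in> sets borel" "A \<subseteq> sphere 0 1"
  shows "{r *\<^sub>R u | r u. 0 < r \<and> r < 1 \<and> u \<in> A} \<in> sets borel"
    and "{r *\<^sub>R u | r u. 0 < r \<and> r < 1 \<and> u \<in> A} \<subseteq> ball 0 1"
proof -
  let ?C = "{r *\<^sub>R u | r u. 0 < r \<and> r < 1 \<and> u \<in> A}"
  have n: "norm u = 1" if "u \<in> A" for u using assms(2) that by auto
  have "?C = (\<lambda>x. x /\<^sub>R norm x) -` A \<inter> (ball 0 1 - {0})"
  proof (intro set_eqI iffI)
    fix x assume x: "x \<in> (\<lambda>x. x /\<^sub>R norm x) -` A \<inter> (ball 0 1 - {0})"
    then have "x = norm x *\<^sub>R (x /\<^sub>R norm x)" "0 < norm x" "norm x < 1" "x /\<^sub>R norm x \<in> A" by auto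
    then show "x \<in> ?C" by blast
  qed (use n[of 0] in \<open>auto simp: n\<close>)
  moreover have "(\<lambda>x::real ^ 'p. x /\<^sub>R norm x) -` A \<inter> space borel \<in> sets borel"
    by (rule measurable_sets[OF _ assms(1)]) simp
  ultimately show "?C \<in> sets borel" by simp
  show "?C \<subseteq> ball 0 1" using n by auto
qed

lemma sets_surface_measure: "sets (surface_measure :: (real ^ 'p::finite) measure) = sets (restrict_space borel (sphere 0 1))"
  by (simp add: surface_measure_def)

lemma emeasure_surface_measure_image:
  fixes T :: "real ^ 'p::finite \<Rightarrow> real ^ 'p"
  assumes T: "orthogonal_transformation T" and A: "A \<in> sets borel" "A \<subseteq> sphere 0 1" "T ` A \<in> sets borel"
  shows "emeasure surface_measure (T ` A) = emeasure surface_measure A"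
proof -
  let ?C = "\<lambda>A. {r *\<^sub>R u | r u. 0 < r \<and> r < 1 \<and> u \<in> (A :: (real ^ 'p) set)}"
  have TA: "T ` A \<subseteq> sphere 0 1"
    using A T by (auto simp: orthogonal_transformation_norm)
  have eq: "?C (T ` A) = T ` ?C A"
    using linear_scale[OF orthogonal_transformation_linear[OF T]] by (auto simp: image_iff) metis+
  note C = cone_sphere_measurable(1)[OF A(1,2)] cone_sphere_measurable(1)[OF A(3) TA]
  have "continuous_on UNIV T"
    using T by (simp add: linear_continuous_on linear_linear orthogonal_transformation_linear)
  then have "T \<in> borel_measurable borel"
    by (rule borel_measurable_continuous_onI)
  then have "emeasure (distr lborel borel T) (T ` ?C A) = emeasure lborel (T -` (T ` ?C A))"
    using C(2) unfolding eq by (subst emeasure_distr) auto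
  then have "emeasure lborel (T ` ?C A) = emeasure lborel (?C A)"
    unfolding distr_lborel_orthogonal[OF T] by (simp add: inj_vimage_image_eq orthogonal_transformation_inj[OF T])
  then show ?thesis
    unfolding emeasure_surface_measure[OF A(1,2)] emeasure_surface_measure[OF A(3) TA] eq by simp
qed

lemma surface_measure_total:
  "0 < emeasure (surface_measure :: (real ^ 'p::finite) measure) (sphere 0 1)"
  "emeasure (surface_measure :: (real ^ 'p::finite) measure) (sphere 0 1) < \<infinity>"
proof -
  let ?C = "{r *\<^sub>R u | r u. 0 < r \<and> r < 1 \<and> u \<in> (sphere 0 1 :: (real ^ 'p) set)}"
  have C: "?C = ball 0 1 - {0}"
  proof (intro set_eqI iffI)
    fix x :: "real ^ 'p" assume x: "x \<in> ball 0 1 - {0}"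
    then have "x = norm x *\<^sub>R (x /\<^sub>R norm x)" "0 < norm x" "norm x < 1" "x /\<^sub>R norm x \<in> sphere 0 1" by auto
    then show "x \<in> ?C" by blast
  qed auto
  have "emeasure lborel (ball 0 1 - {0::real ^ 'p}) = emeasure lborel (ball (0::real ^ 'p) 1)"
    by (rule emeasure_Diff_null_set) (auto simp: null_sets_def)
  also have "\<dots> = ennreal (measure lborel (ball (0::real ^ 'p) 1))"
    by (rule emeasure_eq_ennreal_measure) (use emeasure_lborel_ball_finite[of "0::real ^ 'p" 1] in auto)
  finally have "emeasure (surface_measure :: (real ^ 'p::finite) measure) (sphere 0 1)
      = ennreal (real CARD('p) * measure lborel (ball (0::real ^ 'p) 1))"
    using emeasure_surface_measure[of "sphere 0 1 :: (real ^ 'p) set"] unfolding C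
    by (simp add: ennreal_mult' ennreal_of_nat_eq_real_of_nat)
  moreover have "measure lborel (ball (0::real ^ 'p) 1) > 0"
    using content_ball_pos[of 1 "0::real ^ 'p"] by simp
  ultimately show "0 < emeasure (surface_measure :: (real ^ 'p::finite) measure) (sphere 0 1)"
    "emeasure (surface_measure :: (real ^ 'p::finite) measure) (sphere 0 1) < \<infinity>" by auto
qed

definition uniform_sphere :: "(real ^ 'p::finite) measure" where
  "uniform_sphere = density surface_measure (\<lambda>_. 1 / emeasure (surface_measure :: (real ^ 'p) measure) (sphere 0 1))"

lemma sets_uniform_sphere: "sets (uniform_sphere :: (real ^ 'p::finite) measure) = sets (restrict_space borel (sphere 0 1))"
  by (simp add: uniform_sphere_def sets_surface_measure)

lemma space_uniform_sphere [simp]: "space (uniform_sphere :: (real ^ 'p::finite) measure) = sphere 0 1"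
  by (simp add: uniform_sphere_def space_surface_measure)

lemma emeasure_uniform_sphere:
  "A \<in> sets (restrict_space borel (sphere 0 1)) \<Longrightarrow> emeasure (uniform_sphere :: (real ^ 'p::finite) measure) A =
     emeasure surface_measure A / emeasure (surface_measure :: (real ^ 'p) measure) (sphere 0 1)"
  using emeasure_density_const[of A surface_measure "1 / emeasure (surface_measure :: (real ^ 'p) measure) (sphere 0 1)"]
  by (simp add: uniform_sphere_def sets_surface_measure ennreal_divide_times)

lemma prob_space_uniform_sphere: "prob_space (uniform_sphere :: (real ^ 'p::finite) measure)"
proof
  have "sphere 0 1 \<in> sets (restrict_space borel (sphere (0::real ^ 'p) 1))"
    by (simp add: sets_restrict_space_iff)
  then show "emeasure (uniform_sphere :: (real ^ 'p::finite) measure) (space uniform_sphere) = 1"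
    using surface_measure_total[where 'p = 'p]
    by (simp add: emeasure_uniform_sphere)
qed

interpretation uniform_sphere: prob_space "uniform_sphere :: (real ^ 'p::finite) measure"
  by (rule prob_space_uniform_sphere)

lemma borel_measurable_uniform_sphere:
  "F \<in> borel_measurable borel \<Longrightarrow> F \<in> borel_measurable (uniform_sphere :: (real ^ 'p::finite) measure)"
  by (subst measurable_cong_sets[OF sets_uniform_sphere refl]) (rule measurable_restrict_space1)

lemma distr_uniform_sphere:
  fixes T :: "real ^ 'p::finite \<Rightarrow> real ^ 'p"
  assumes T: "orthogonal_transformation T"
  shows "T \<in> measurable uniform_sphere uniform_sphere" "distr uniform_sphere uniform_sphere T = uniform_sphere"
proof -
  have cont: "continuous_on UNIV T"
    using T by (simp add: linear_continuous_on linear_linear orthogonal_transformation_linear)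
  have "T \<in> measurable (restrict_space borel (sphere 0 1)) borel"
    using cont by (intro measurable_restrict_space1 borel_measurable_continuous_onI)
  then have "T \<in> measurable (restrict_space borel (sphere 0 1)) (restrict_space borel (sphere 0 1))"
    using T by (intro measurable_restrict_space2) (auto simp: space_restrict_space orthogonal_transformation_norm)
  then show m: "T \<in> measurable uniform_sphere uniform_sphere"
    by (simp add: measurable_cong_sets[OF sets_uniform_sphere sets_uniform_sphere])
  show "distr uniform_sphere uniform_sphere T = (uniform_sphere :: (real ^ 'p) measure)"
  proof (rule measure_eqI)
    fix A assume "A \<in> sets (distr uniform_sphere (uniform_sphere :: (real ^ 'p) measure) T)"
    then have A: "A \<in> sets (restrict_space borel (sphere 0 1))" by (simp add: sets_uniform_sphere)
    then have A2: "A \<in> sets borel" "A \<subseteq> sphere 0 1"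
      by (auto simp: sets_restrict_space_iff)
    let ?B = "T -` A \<inter> sphere 0 1"
    have B: "?B \<in> sets (restrict_space borel (sphere 0 1))"
      using measurable_sets[OF m, of A] A by (simp add: sets_uniform_sphere)
    then have B2: "?B \<in> sets borel" "?B \<subseteq> sphere 0 1"
      by (auto simp: sets_restrict_space_iff)
    have "T ` ?B = A"
    proof (intro equalityI subsetI)
      fix x assume x: "x \<in> A"
      then obtain y where y: "x = T y"
        using orthogonal_transformation_surj[OF T] by (metis surj_def)
      with x A2 have "norm y = 1" using orthogonal_transformation_norm[OF T, of y] by auto
      with x y show "x \<in> T ` ?B" by auto
    qed auto
    then have "emeasure surface_measure ?B = emeasure surface_measure A"
      using emeasure_surface_measure_image[OF T B2] A2 by simp
    then show "emeasure (distr uniform_sphere uniform_sphere T) A = emeasure uniform_sphere A"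
      using A B m by (simp add: emeasure_distr sets_uniform_sphere emeasure_uniform_sphere)
  qed simp
qed

lemma integral_uniform_sphere_orthogonal:
  fixes T :: "real ^ 'p::finite \<Rightarrow> real ^ 'p" and F :: "real ^ 'p \<Rightarrow> real"
  assumes T: "orthogonal_transformation T" and F: "F \<in> borel_measurable uniform_sphere"
  shows "(\<integral>x. F (T x) \<partial>uniform_sphere) = (\<integral>x. F x \<partial>uniform_sphere)"
  using integral_distr[OF distr_uniform_sphere(1)[OF T] F] by (simp add: distr_uniform_sphere(2)[OF T])

lemma abs_inner_unit: "norm x = 1 \<Longrightarrow> norm w = 1 \<Longrightarrow> \<bar>x \<bullet> w\<bar> \<le> 1"
  using Cauchy_Schwarz_ineq2[of x w] by simp

lemma integrable_uniform_sphere: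
  fixes F :: "real ^ 'p::finite \<Rightarrow> real"
  assumes "continuous_on UNIV F"
  shows "integrable uniform_sphere F"
proof -
  have "compact (F ` sphere 0 1)"
    by (intro compact_continuous_image continuous_on_subset[OF assms]) auto
  then obtain B where B: "\<forall>y\<in>F ` sphere 0 1. norm y \<le> B"
    using compact_imp_bounded bounded_iff by metis
  show ?thesis
    by (rule uniform_sphere.integrable_const_bound[of _ B])
      (use B assms in \<open>auto intro!: AE_I2 borel_measurable_uniform_sphere borel_measurable_continuous_onI\<close>)
qed

section \<open>Moments of the uniform distribution on the sphere\<close>

definition sphere_moment :: "nat \<Rightarrow> real ^ 'p::finite \<Rightarrow> real" where
  "sphere_moment q w = (\<integral>x. (x \<bullet> w) ^ q \<partial>uniform_sphere)"

text \<open>Some orthogonal map carries w to w', and the uniform distribution is invariant under it.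
  All later moment formulas rest on this.\<close>

lemma sphere_moment_cong_norm:
  fixes w w' :: "real ^ 'p::finite"
  assumes "norm w = norm w'"
  shows "sphere_moment q w = sphere_moment q w'"
proof -
  obtain T where T: "orthogonal_transformation T" "T w = w'"
    using assms by (rule orthogonal_transformation_exists)
  have "sphere_moment q w = (\<integral>x. (T x \<bullet> T w) ^ q \<partial>uniform_sphere)"
    using T(1) by (simp add: sphere_moment_def orthogonal_transformation_def)
  also have "\<dots> = sphere_moment q w'"
    unfolding T(2) sphere_moment_def
    by (rule integral_uniform_sphere_orthogonal[OF T(1), of "\<lambda>x. (x \<bullet> w') ^ q"])
      (intro borel_measurable_uniform_sphere, simp)
  finally show ?thesis .
qed

lemma sphere_moment_norm:
  fixes w e :: "real ^ 'p::finite"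
  assumes "norm e = 1"
  shows "sphere_moment q w = norm w ^ q * sphere_moment q e"
proof -
  have "sphere_moment q w = sphere_moment q (norm w *\<^sub>R e)"
    using assms by (intro sphere_moment_cong_norm) simp
  then show ?thesis by (simp add: sphere_moment_def power_mult_distrib)
qed

lemma sphere_moment_odd:
  fixes w :: "real ^ 'p::finite"
  assumes "odd q"
  shows "sphere_moment q w = 0"
proof -
  have "sphere_moment q w = sphere_moment q (- w)"
    by (intro sphere_moment_cong_norm) simp
  also have "\<dots> = - sphere_moment q w"
    using assms by (simp add: sphere_moment_def)
  finally show ?thesis by simp
qed

definition two_point_moment :: "nat \<Rightarrow> nat \<Rightarrow> real ^ 'p::finite \<Rightarrow> real ^ 'p \<Rightarrow> real" where
  "two_point_moment a b u w = (\<integral>x. (x \<bullet> u) ^ a * (x \<bullet> w) ^ b \<partial>uniform_sphere)"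

text \<open>As a polynomial in t, the moment in direction u + t w has the mixed moments of u and w
  as its coefficients.\<close>

lemma two_point_moment_polarize:
  fixes u w :: "real ^ 'p::finite"
  shows "sphere_moment N (u + t *\<^sub>R w) = (\<Sum>b\<le>N. real (N choose b) * two_point_moment (N - b) b u w * t ^ b)"
proof -
  have "(x \<bullet> (u + t *\<^sub>R w)) ^ N = (\<Sum>b\<le>N. real (N choose b) * t ^ b * ((x \<bullet> u) ^ (N - b) * (x \<bullet> w) ^ b))" for x
  proof -
    have "x \<bullet> (u + t *\<^sub>R w) = t * (x \<bullet> w) + x \<bullet> u"
      by (simp add: inner_add_right)
    then show ?thesis
      by (simp only: binomial_ring power_mult_distrib) (simp add: mult_ac)
  qed
  then show ?thesis
    unfolding sphere_moment_def two_point_moment_def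
    by (simp add: Bochner_Integration.integral_sum integrable_uniform_sphere continuous_intros mult_ac)
qed

text \<open>Two expressions for the moment of order 2 c in direction u + t w, one by the binomial
  theorem and one by homogeneity in the norm, are compared at t^b. The unit vector e is arbitrary,
  as all unit vectors have the same moments.\<close>

lemma two_point_moment_even:
  fixes u w e :: "real ^ 'p::finite"
  assumes u: "norm u = 1" "norm w = 1" "norm e = 1" and ab: "a + b = 2 * c"
  shows "real ((2 * c) choose b) * two_point_moment a b u w
    = sphere_moment (2 * c) e * coeff ([:1, 2 * (u \<bullet> w), 1:] ^ c) b"
proof -
  let ?N = "2 * c"
  let ?P = "\<Sum>b\<le>?N. monom (real (?N choose b) * two_point_moment (?N - b) b u w) b"
  let ?Q = "smult (sphere_moment ?N e) ([:1, 2 * (u \<bullet> w), 1:] ^ c)"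
  have "poly ?P t = poly ?Q t" for t
  proof -
    have "norm (u + t *\<^sub>R w) ^ ?N = ((norm (u + t *\<^sub>R w))\<^sup>2) ^ c" by (simp add: power_mult)
    also have "(norm (u + t *\<^sub>R w))\<^sup>2 = 1 + 2 * t * (u \<bullet> w) + t\<^sup>2"
      unfolding power2_norm_eq_inner using u
      by (simp add: inner_add_left inner_add_right inner_commute[of w u] power2_eq_square norm_eq_1 algebra_simps)
    finally have "sphere_moment ?N (u + t *\<^sub>R w) = (1 + 2 * t * (u \<bullet> w) + t\<^sup>2) ^ c * sphere_moment ?N e"
      using sphere_moment_norm[OF u(3), of ?N "u + t *\<^sub>R w"] by simp
    then show ?thesis
      unfolding two_point_moment_polarize
      by (simp add: poly_sum poly_monom poly_power power2_eq_square algebra_simps)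
  qed
  then have "?P = ?Q" by (intro poly_eqI_degree_lead_coeff poly_ext) 
  then have "coeff ?P b = coeff ?Q b" by simp
  moreover have "coeff ?P b = real (?N choose b) * two_point_moment a b u w"
  proof -
    have "b \<le> ?N" "?N - b = a" using ab by auto
    then show ?thesis by (simp add: coeff_sum)
  qed
  ultimately show ?thesis by simp
qed

lemma two_point_moment_odd:
  fixes u w :: "real ^ 'p::finite"
  assumes "odd (a + b)"
  shows "two_point_moment a b u w = 0"
proof -
  let ?N = "a + b"
  let ?P = "\<Sum>b\<le>?N. monom (real (?N choose b) * two_point_moment (?N - b) b u w) b"
  have "poly ?P t = 0" for t
    using two_point_moment_polarize[of ?N u t w] sphere_moment_odd[OF assms, of "u + t *\<^sub>R w"]
    by (simp only: poly_sum poly_monom)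
  then have "?P = 0" using poly_all_0_iff_0 by blast
  then have "coeff ?P b = 0" by simp
  then show ?thesis by (simp add: coeff_sum)
qed

text \<open>Insert 1 = sum of squares of the coordinates into the moment of order 2 c of one
  coordinate. The square of that coordinate gives the next moment, and each of the p - 1 others the
  next moment divided by 2 c + 1, by \<open>two_point_moment_even\<close> for orthogonal
  vectors.\<close>

lemma sphere_moment_rec:
  fixes e :: "real ^ 'p::finite"
  assumes e: "norm e = 1"
  shows "(real CARD('p) + 2 * real c) * sphere_moment (2 * c + 2) e = (2 * real c + 1) * sphere_moment (2 * c) e"
proof -
  obtain i0 :: 'p where True by simp
  define e1 where "e1 = (axis i0 1 :: real ^ 'p)"
  have e1: "norm e1 = 1" by (simp add: e1_def)
  have m: "sphere_moment q e1 = sphere_moment q e" for q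
    using e e1 by (intro sphere_moment_cong_norm) simp
  have x: "(\<Sum>i\<in>UNIV. (x \<bullet> axis i 1)\<^sup>2) = 1" if "norm x = 1" for x :: "real ^ 'p"
    using that by (simp add: cart_eq_inner_axis[symmetric] norm_vec_def L2_set_def)
  have "(\<Sum>i\<in>UNIV. two_point_moment (2 * c) 2 e1 (axis i 1)) = (\<integral>x. (x \<bullet> e1) ^ (2 * c) * (\<Sum>i\<in>UNIV. (x \<bullet> axis i 1)\<^sup>2) \<partial>uniform_sphere)"
    unfolding two_point_moment_def sum_distrib_left
    by (subst Bochner_Integration.integral_sum) (auto intro!: integrable_uniform_sphere continuous_intros)
  also have "\<dots> = sphere_moment (2 * c) e1"
    unfolding sphere_moment_def by (intro Bochner_Integration.integral_cong) (auto simp: x)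
  finally have 1: "(\<Sum>i\<in>UNIV. two_point_moment (2 * c) 2 e1 (axis i 1)) = sphere_moment (2 * c) e" using m by simp
  have 2: "two_point_moment (2 * c) 2 e1 (axis i0 1) = sphere_moment (2 * c + 2) e"
    unfolding m[symmetric] by (simp add: two_point_moment_def sphere_moment_def e1_def power2_eq_square mult_ac)
  have 3: "(2 * real c + 1) * two_point_moment (2 * c) 2 e1 (axis i 1) = sphere_moment (2 * c + 2) e" if "i \<noteq> i0" for i
  proof -
    have s: "e1 \<bullet> axis i 1 = 0" using that by (simp add: e1_def inner_axis_axis)
    have "real ((2 * Suc c) choose 2) * two_point_moment (2 * c) 2 e1 (axis i 1)
      = sphere_moment (2 * Suc c) e * coeff ([:1, 2 * (e1 \<bullet> axis i 1), 1:] ^ Suc c) 2"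
      by (rule two_point_moment_even[OF e1 _ e]) auto
    also have "coeff ([:1, 2 * (e1 \<bullet> axis i 1), 1:] ^ Suc c) 2 = real (Suc c)"
    proof -
      have "coeff ([:1, 2 * (e1 \<bullet> axis i 1), 1:] ^ Suc c) 2 = (\<Sum>m\<le>Suc c. if m = 0 then real (Suc c) else 0)"
        unfolding coeff_quadratic_power s by (intro sum.cong) (auto simp: power_0_left)
      then show ?thesis by simp
    qed
    also have "real ((2 * Suc c) choose 2) = real (Suc c) * (2 * real c + 1)"
      by (simp add: choose_two) (simp add: algebra_simps)
    finally have "real (Suc c) * ((2 * real c + 1) * two_point_moment (2 * c) 2 e1 (axis i 1)) = real (Suc c) * sphere_moment (2 * Suc c) e"
      by (simp only: mult_ac)
    then show ?thesis by (simp del: of_nat_Suc)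
  qed
  have "(2 * real c + 1) * sphere_moment (2 * c) e = (\<Sum>i\<in>UNIV. (2 * real c + 1) * two_point_moment (2 * c) 2 e1 (axis i 1))"
    unfolding 1[symmetric] sum_distrib_left ..
  also have "\<dots> = (2 * real c + 1) * sphere_moment (2 * c + 2) e + (\<Sum>i\<in>UNIV - {i0}. sphere_moment (2 * c + 2) e)"
    by (subst sum.remove[of _ i0]) (auto simp: 2 3)
  also have "(\<Sum>i\<in>UNIV - {i0}. sphere_moment (2 * c + 2) e) = (real CARD('p) - 1) * sphere_moment (2 * c + 2) e"
    by (simp add: card_Diff_singleton of_nat_diff Suc_leI)
  finally show ?thesis by (simp add: algebra_simps)
qed

lemma sphere_moment_closed:
  fixes e :: "real ^ 'p::finite"
  assumes e: "norm e = 1"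
  shows "sphere_moment (2 * c) e = fact (2 * c) / (2 ^ c * fact c * sphere_weight CARD('p) c)"
proof (induction c)
  case 0
  show ?case by (simp add: sphere_moment_def sphere_weight_def uniform_sphere.prob_space[simplified])
next
  case (Suc c)
  have pc: "real CARD('p) + 2 * real c > 0" by (simp add: add_pos_nonneg)
  have "sphere_moment (2 * Suc c) e = (2 * real c + 1) * sphere_moment (2 * c) e / (real CARD('p) + 2 * real c)"
    using sphere_moment_rec[OF e, of c] pc by (simp add: field_simps)
  also have "\<dots> = (2 * real c + 1) * fact (2 * c) / (2 ^ c * fact c * (sphere_weight CARD('p) c * (real CARD('p) + 2 * real c)))"
    unfolding Suc by (simp add: mult_ac)
  also have "\<dots> = (2 * (real c + 1)) * ((2 * real c + 1) * fact (2 * c)) /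
      ((2 * (real c + 1)) * (2 ^ c * fact c * (sphere_weight CARD('p) c * (real CARD('p) + 2 * real c))))"
    by (rule mult_divide_mult_cancel_left[symmetric]) simp
  also have "(2 * (real c + 1)) * ((2 * real c + 1) * fact (2 * c)) = fact (2 * Suc c)"
    by (simp add: algebra_simps)
  also have "(2 * (real c + 1)) * (2 ^ c * fact c * (sphere_weight CARD('p) c * (real CARD('p) + 2 * real c)))
      = 2 ^ Suc c * fact (Suc c) * sphere_weight CARD('p) (Suc c)"
    unfolding sphere_weight_Suc by (simp add: algebra_simps)
  finally show ?case .
qed

lemma two_point_moment_closed:
  fixes u w :: "real ^ 'p::finite"
  assumes u: "norm u = 1" "norm w = 1"
  shows "two_point_moment a b u w = (\<Sum>m\<le>b. moment_coeff CARD('p) m a b * (u \<bullet> w) ^ m)"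
proof (cases "even (a + b)")
  case False
  then have "moment_coeff CARD('p) m a b = 0" for m
    by (auto simp: moment_coeff_def)
  then show ?thesis using two_point_moment_odd[OF False] by simp
next
  case True
  then obtain c where c: "a + b = 2 * c" by blast
  let ?f = "\<lambda>m. if m \<le> b \<and> even (b - m)
    then real (c choose m) * real ((c - m) choose ((b - m) div 2)) * (2 * (u \<bullet> w)) ^ m else 0"
  have W: "sphere_weight CARD('p) c > 0" by (rule sphere_weight_pos) simp
  have B: "real ((2 * c) choose b) > 0" using c by simp
  have "two_point_moment a b u w = sphere_moment (2 * c) u * (\<Sum>m\<le>c. ?f m) / real ((2 * c) choose b)"
    using two_point_moment_even[OF u u(1) c] B unfolding coeff_quadratic_power by (simp add: field_simps)
  also have "(\<Sum>m\<le>c. ?f m) = (\<Sum>m\<le>b. ?f m)"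
    by (rule sum.mono_neutral_cong) auto
  also have "sphere_moment (2 * c) u * (\<Sum>m\<le>b. ?f m) / real ((2 * c) choose b)
      = (\<Sum>m\<le>b. moment_coeff CARD('p) m a b * (u \<bullet> w) ^ m)"
    unfolding sum_distrib_left sum_divide_distrib
  proof (rule sum.cong[OF refl])
    fix m assume m: "m \<in> {..b}"
    show "sphere_moment (2 * c) u * ?f m / real ((2 * c) choose b) = moment_coeff CARD('p) m a b * (u \<bullet> w) ^ m"
    proof (cases "even (b - m)")
      case False
      then show ?thesis by (simp add: moment_coeff_def)
    next
      case True
      then obtain j where j: "b = m + 2 * j" using m by (metis atMost_iff dvdE le_add_diff_inverse)
      show ?thesis
      proof (cases "m \<le> a")
        case False
        \<comment> \<open>m > a forces c < m + j, so one of the two binomial coefficients is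
          0.\<close>
        then have "c < m \<or> c - m < j" using c j by arith
        then show ?thesis using False j by (auto simp: moment_coeff_def)
      next
        case True
        moreover have "even (a - m)"
          using True c j by presburger
        ultimately obtain i where i: "a = m + 2 * i" by (metis dvdE le_add_diff_inverse)
        have cc: "c = m + (i + j)" "2 * c - b = a" using c i j by simp_all
        have 1: "real ((2 * c) choose b) = fact (2 * c) / (fact b * fact a)"
          using binomial_fact[of b "2 * c"] c cc(2) by simp
        have 2: "real (c choose m) = fact c / (fact m * fact (i + j))"
          using binomial_fact[of m c] cc(1) by simp
        have 3: "real ((c - m) choose j) = fact (i + j) / (fact j * fact i)"
          using binomial_fact[of j "i + j"] cc(1) by simp
        have f: "?f m = real (c choose m) * real ((c - m) choose j) * (2 * (u \<bullet> w)) ^ m"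
          using j by simp
        have M: "moment_coeff CARD('p) m a b = fact a * fact b / (fact m * fact i * fact j * 2 ^ (i + j) * sphere_weight CARD('p) c)"
          using c i j by (simp add: moment_coeff_def)
        have pw: "(2::real) ^ c = 2 ^ m * 2 ^ (i + j)" unfolding cc(1) by (simp add: power_add)
        show ?thesis
          unfolding f unfolding M 1 2 3 sphere_moment_closed[OF u(1)] pw
          using W by (simp add: power_mult_distrib field_simps)
      qed
    qed
  qed
  finally show ?thesis .
qed

text \<open>The recurrence says L H = - k (k + p - 2) H for L = (1 - s^2) D^2 - (p - 1) s D.
  Averaging against a power of x . w commutes with L; the outcome is a polynomial in u . w of degree
  at most b, which must be 0 for b < k and a multiple of H for b = k.\<close>

theorem funk_hecke_power:
  fixes H :: "real poly" and u w :: "real ^ 'p::finite"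
  assumes u: "norm u = 1" "norm w = 1" and p: "CARD('p) \<ge> 2" and k: "k \<ge> 1" "b \<le> k" and deg: "degree H \<le> k"
    and rec: "\<And>q. (real q + 2) * (real q + 1) * coeff H (q + 2)
        = - (real k - real q) * (real k + real q + real CARD('p) - 2) * coeff H q"
  shows "(\<integral>x. poly H (x \<bullet> u) * (x \<bullet> w) ^ b \<partial>uniform_sphere)
    = (if b = k then fact k / sphere_weight CARD('p) k else 0) * poly H (u \<bullet> w)"
proof -
  let ?\<rho> = "if b = k then fact k / sphere_weight CARD('p) k else 0 :: real"
  have poly_H: "poly H x = (\<Sum>a\<le>k. coeff H a * x ^ a)" for x
    unfolding poly_altdef using deg by (intro sum.mono_neutral_left) (auto simp: coeff_eq_0)
  have "(\<integral>x. poly H (x \<bullet> u) * (x \<bullet> w) ^ b \<partial>uniform_sphere)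
      = (\<integral>x. (\<Sum>a\<le>k. coeff H a * ((x \<bullet> u) ^ a * (x \<bullet> w) ^ b)) \<partial>uniform_sphere)"
    by (simp add: poly_H sum_distrib_right mult.assoc)
  also have "\<dots> = (\<Sum>a\<le>k. coeff H a * two_point_moment a b u w)"
    unfolding two_point_moment_def
    by (subst Bochner_Integration.integral_sum) (auto intro!: integrable_uniform_sphere continuous_intros)
  also have "\<dots> = (\<Sum>m\<le>b. (\<Sum>a\<le>k. coeff H a * moment_coeff CARD('p) m a b) * (u \<bullet> w) ^ m)"
    unfolding two_point_moment_closed[OF u] sum_distrib_left sum_distrib_right
    by (subst sum.swap) (simp add: mult_ac)
  also have "\<dots> = (\<Sum>m\<le>b. ?\<rho> * coeff H m * (u \<bullet> w) ^ m)"
    using deg by (intro sum.cong refl, subst moment_coeff_eigen[OF p k _ rec]) (auto simp: coeff_eq_0)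
  also have "\<dots> = ?\<rho> * poly H (u \<bullet> w)"
    by (cases "b = k") (auto simp: poly_H sum_distrib_left mult_ac)
  finally show ?thesis .
qed

subsection \<open>Gegenbauer and Chebyshev polynomials\<close>

text \<open>Differentiating P(cos \<theta>) = cos (k \<theta>) twice gives the equation on [-1,1],
  an infinite set, hence as an identity of polynomials.\<close>

lemma chebyshev_ode:
  "[:1, 0, -1:] * pderiv (pderiv (chebyshev k)) - [:0, 1:] * pderiv (chebyshev k) + smult ((real k)\<^sup>2) (chebyshev k) = 0"
proof -
  let ?P = "chebyshev k"
  let ?Q = "[:1, 0, -1:] * pderiv (pderiv ?P) - [:0, 1:] * pderiv ?P + smult ((real k)\<^sup>2) ?P"
  have d1: "poly (pderiv ?P) (cos \<theta>) * sin \<theta> = real k * sin (real k * \<theta>)" for \<theta>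
  proof -
    have "((\<lambda>\<theta>. poly ?P (cos \<theta>)) has_real_derivative poly (pderiv ?P) (cos \<theta>) * - sin \<theta>) (at \<theta>)"
      by (rule DERIV_chain2[OF poly_DERIV]) (auto intro!: derivative_eq_intros)
    moreover have "((\<lambda>\<theta>. poly ?P (cos \<theta>)) has_real_derivative - sin (real k * \<theta>) * real k) (at \<theta>)"
      unfolding poly_chebyshev by (auto intro!: derivative_eq_intros)
    ultimately show ?thesis by (auto dest: DERIV_unique)
  qed
  have d2: "poly ?Q (cos \<theta>) = 0" for \<theta>
  proof -
    have "((\<lambda>\<theta>. poly (pderiv ?P) (cos \<theta>) * sin \<theta>) has_real_derivative
        poly (pderiv (pderiv ?P)) (cos \<theta>) * - sin \<theta> * sin \<theta> + cos \<theta> * poly (pderiv ?P) (cos \<theta>)) (at \<theta>)"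
      by (rule DERIV_mult[OF DERIV_chain2[OF poly_DERIV] DERIV_sin]) (auto intro!: derivative_eq_intros)
    moreover have "((\<lambda>\<theta>. poly (pderiv ?P) (cos \<theta>) * sin \<theta>) has_real_derivative real k * (cos (real k * \<theta>) * real k)) (at \<theta>)"
      unfolding d1 by (auto intro!: derivative_eq_intros)
    ultimately have "poly (pderiv (pderiv ?P)) (cos \<theta>) * - sin \<theta> * sin \<theta> + cos \<theta> * poly (pderiv ?P) (cos \<theta>)
        = real k * (cos (real k * \<theta>) * real k)"
      by (rule DERIV_unique)
    moreover have "sin \<theta> * sin \<theta> = 1 - cos \<theta> * cos \<theta>"
      using sin_squared_eq[of \<theta>] by (simp add: power2_eq_square)
    then have "poly (pderiv (pderiv ?P)) (cos \<theta>) * (sin \<theta> * sin \<theta>) = poly (pderiv (pderiv ?P)) (cos \<theta>) * (1 - cos \<theta> * cos \<theta>)"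
      by simp
    ultimately show ?thesis
      by (simp add: poly_chebyshev power2_eq_square algebra_simps)
  qed
  show ?thesis
  proof (rule ccontr)
    assume "?Q \<noteq> 0"
    then have "finite {x. poly ?Q x = 0}" by (rule poly_roots_finite)
    moreover have "{-1..1} \<subseteq> {x. poly ?Q x = 0}"
    proof
      fix x :: real assume "x \<in> {-1..1}"
      then have "x = cos (arccos x)" by simp
      then show "x \<in> {x. poly ?Q x = 0}" using d2[of "arccos x"] by simp
    qed
    ultimately have "finite {-1..1::real}" by (rule rev_finite_subset)
    then show False using infinite_Icc[of "-1::real" 1] by simp
  qed
qed

lemma chebyshev_coeff_rec:
  "(real q + 2) * (real q + 1) * coeff (chebyshev k) (q + 2) = - (real k - real q) * (real k + real q) * coeff (chebyshev k) q"
proof -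
  let ?P = "chebyshev k"
  have x2: "coeff ([:1, 0, -1:] * R) q = coeff R q - (if q < 2 then 0 else coeff R (q - 2))" for R :: "real poly"
    by (simp add: coeff_pCons split: nat.split)
  have x1: "coeff ([:0, 1:] * R) q = (if q = 0 then 0 else coeff R (q - 1))" for R :: "real poly"
    by (simp add: coeff_pCons split: nat.split)
  have "coeff ([:1, 0, -1:] * pderiv (pderiv ?P) - [:0, 1:] * pderiv ?P + smult ((real k)\<^sup>2) ?P) q = 0"
    unfolding chebyshev_ode by simp
  then have "(real q + 2) * (real q + 1) * coeff ?P (q + 2) - real q * (real q - 1) * coeff ?P q - real q * coeff ?P q + (real k)\<^sup>2 * coeff ?P q = 0"
    unfolding coeff_add coeff_diff x2 x1 coeff_smult coeff_pderiv
    by (cases q; cases "q - 1") (auto simp: algebra_simps numeral_2_eq_2)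
  then show ?thesis by (simp add: algebra_simps power2_eq_square)
qed

lemma chebyshev_lead: "coeff (chebyshev (Suc k)) (Suc k) = 2 ^ k"
proof (induction k)
  case (Suc k)
  have "coeff (cheb_rec k) (Suc (Suc k)) = 0"
    using cheb_rec_degree[of k] by (intro coeff_eq_0) simp
  then show ?case using Suc by (simp add: chebyshev_eq_cheb_rec)
qed (simp add: chebyshev_eq_cheb_rec)

text \<open>Indexing the degree as i + 2 * j removes truncated subtractions.\<close>

lemma coeff_gegenbauer:
  "coeff (gegenbauer \<nu> (i + 2 * j)) i = (-1) ^ j * 2 ^ i * Gamma (real i + real j + \<nu>) / (Gamma \<nu> * fact j * fact i)"
proof -
  let ?q = "i + 2 * j"
  have "coeff (gegenbauer \<nu> ?q) i = (\<Sum>l\<le>?q div 2. if l = j then (-1) ^ j * 2 ^ i * Gamma (real i + real j + \<nu>) / (Gamma \<nu> * fact j * fact i) else 0)"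
    unfolding gegenbauer_def coeff_sum by (intro sum.cong) (auto simp: add_ac)
  then show ?thesis by simp
qed

lemma coeff_gegenbauer_eq_0:
  assumes "\<not> (i \<le> k \<and> even (k - i))"
  shows "coeff (gegenbauer \<nu> k) i = 0"
  unfolding gegenbauer_def coeff_sum
proof (rule sum.neutral, rule ballI)
  fix l assume "l \<in> {..k div 2}"
  then have "k - 2 * l \<noteq> i" using assms by auto
  then show "coeff (monom ((-1) ^ l * 2 ^ (k - 2 * l) * Gamma (real (k - l) + \<nu>) / (Gamma \<nu> * fact l * fact (k - 2 * l))) (k - 2 * l)) i = 0"
    by simp
qed

text \<open>Neighbouring coefficients differ by factorials and one step of the functional equation
  of Gamma. For 2 \<nu> = p - 2 this is the recurrence demanded by
  \<open>funk_hecke_power\<close>.\<close>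

lemma gegenbauer_coeff_rec:
  assumes \<nu>: "\<nu> > 0"
  shows "(real q + 2) * (real q + 1) * coeff (gegenbauer \<nu> k) (q + 2) = - (real k - real q) * (real k + real q + 2 * \<nu>) * coeff (gegenbauer \<nu> k) q"
proof (cases "q \<le> k \<and> even (k - q)")
  case False
  then have "\<not> (q + 2 \<le> k \<and> even (k - (q + 2)))" by auto
  with False show ?thesis by (simp add: coeff_gegenbauer_eq_0)
next
  case True
  then obtain j where k: "k = q + 2 * j" by (metis dvdE le_add_diff_inverse)
  show ?thesis
  proof (cases j)
    case 0
    then show ?thesis using k by (simp add: coeff_gegenbauer_eq_0)
  next
    case (Suc i)
    have k2: "k = (q + 2) + 2 * i" using k Suc by simp
    have "real q + real j + \<nu> \<notin> \<int>\<^sub>\<le>\<^sub>0"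
      using \<nu> by (auto elim!: nonpos_Ints_cases)
    then have g: "Gamma (real q + real j + \<nu> + 1) = (real q + real j + \<nu>) * Gamma (real q + real j + \<nu>)"
      by (rule Gamma_plus1)
    have c2: "coeff (gegenbauer \<nu> k) (q + 2) = (-1) ^ i * 2 ^ (q + 2) * Gamma (real q + real j + \<nu> + 1) / (Gamma \<nu> * fact i * fact (q + 2))"
      unfolding k2 coeff_gegenbauer using Suc by (simp add: add_ac)
    have c: "coeff (gegenbauer \<nu> k) q = (-1) ^ j * 2 ^ q * Gamma (real q + real j + \<nu>) / (Gamma \<nu> * fact j * fact q)"
      unfolding k coeff_gegenbauer ..
    have f: "fact (q + 2) = (real q + 2) * (real q + 1) * fact q" "fact j = real j * fact i"
      using Suc by (simp_all add: algebra_simps)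
    have nz: "real q + 2 \<noteq> 0" "real q + 1 \<noteq> 0" "real j \<noteq> 0" "Gamma \<nu> \<noteq> 0"
      using Suc Gamma_real_pos[OF \<nu>] by auto
    have kk: "- (real k - real q) * (real k + real q + 2 * \<nu>) = - 4 * real j * (real q + real j + \<nu>)"
      unfolding k by (simp add: algebra_simps)
    define D where "D = (-1) ^ i * 2 ^ q * Gamma (real q + real j + \<nu>) / (Gamma \<nu> * fact i * fact q)"
    have A: "(real q + 2) * (real q + 1) * coeff (gegenbauer \<nu> k) (q + 2) = 4 * (real q + real j + \<nu>) * D"
      unfolding c2 g f D_def using nz(1,2,4) by (simp add: divide_simps)
    have B: "coeff (gegenbauer \<nu> k) q = - D / real j"
      unfolding c f D_def using Suc by (simp add: divide_simps)
    show ?thesis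
      unfolding A B kk using nz(3) by simp
  qed
qed

lemma poly_eq_sum_coeff:
  fixes P :: "real poly"
  assumes "degree P \<le> k"
  shows "poly P x = (\<Sum>q<k + 1 + i. coeff P q * x ^ q)"
  unfolding poly_altdef using assms by (intro sum.mono_neutral_left) (auto simp: coeff_eq_0)

text \<open>The differential equation (1 - t^2) P'' - (2 \<nu> + 1) t P' + k (k + 2 \<nu>) P = 0 at
  t = 1, where the second-order term drops out; in coefficients, the sum of the recurrence over
  q.\<close>

lemma eigen_value_at_1:
  fixes P :: "real poly"
  assumes deg: "degree P \<le> k"
    and rec: "\<And>q. (real q + 2) * (real q + 1) * coeff P (q + 2) = - (real k - real q) * (real k + real q + 2 * \<nu>) * coeff P q"
  shows "real k * (real k + 2 * \<nu>) * poly P 1 = (2 * \<nu> + 1) * poly (pderiv P) 1"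
proof -
  have split2: "(\<Sum>a<k + 3. f a) = f 0 + f 1 + (\<Sum>a<k + 1. f (a + 2))" for f :: "nat \<Rightarrow> real"
    using sum.lessThan_Suc_shift[of f "k + 2"] sum.lessThan_Suc_shift[of "\<lambda>i. f (Suc i)" "k + 1"]
    by (simp add: numeral_3_eq_3 del: sum.lessThan_Suc)
  have z: "coeff P q = 0" if "q > k" for q using deg that by (intro coeff_eq_0) simp
  have "(\<Sum>q<k + 1. (real q + 2) * (real q + 1) * coeff P (q + 2)) = (\<Sum>q<k + 3. real q * (real q - 1) * coeff P q)"
    unfolding split2 by (simp add: algebra_simps)
  also have "\<dots> = (\<Sum>q<k + 1. real q * (real q - 1) * coeff P q)"
    by (rule sum.mono_neutral_right) (auto simp: z)
  finally have "(\<Sum>q<k + 1. real q * (real q - 1) * coeff P q) = (\<Sum>q<k + 1. - (real k - real q) * (real k + real q + 2 * \<nu>) * coeff P q)"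
    unfolding rec by simp
  note X = this
  have "(\<Sum>q<k + 1. real q * (real q - 1) * coeff P q + (real k - real q) * (real k + real q + 2 * \<nu>) * coeff P q) = 0"
    unfolding sum.distrib X unfolding sum.distrib[symmetric] by (intro sum.neutral ballI) (simp add: algebra_simps)
  then have "0 = (\<Sum>q<k + 1. real q * (real q - 1) * coeff P q + (real k - real q) * (real k + real q + 2 * \<nu>) * coeff P q)"
    by simp
  also have "\<dots> = (\<Sum>q<k + 1. real k * (real k + 2 * \<nu>) * coeff P q - (2 * \<nu> + 1) * (real q * coeff P q))"
    by (intro sum.cong refl) (simp add: algebra_simps)
  also have "\<dots> = real k * (real k + 2 * \<nu>) * poly P 1 - (2 * \<nu> + 1) * (\<Sum>q<k + 1. real q * coeff P q)"
    using poly_eq_sum_coeff[OF deg, of 1 0] by (simp only: sum_subtractf sum_distrib_left) simp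
  also have "(\<Sum>q<k + 1. real q * coeff P q) = poly (pderiv P) 1"
  proof -
    have "degree (pderiv P) \<le> k" using degree_pderiv[of P] deg by simp
    from poly_eq_sum_coeff[OF this, of 1 0]
    have "poly (pderiv P) 1 = (\<Sum>q<k + 1. real (Suc q) * coeff P (Suc q))"
      by (simp add: coeff_pderiv)
    also have "\<dots> = (\<Sum>q<Suc (k + 1). real q * coeff P q)"
      unfolding sum.lessThan_Suc_shift by simp
    also have "\<dots> = (\<Sum>q<k + 1. real q * coeff P q)" by (simp add: z)
    finally show ?thesis ..
  qed
  finally show ?thesis by simp
qed

lemma pderiv_gegenbauer:
  assumes "\<nu> > 0"
  shows "pderiv (gegenbauer \<nu> (Suc k)) = smult (2 * \<nu>) (gegenbauer (\<nu> + 1) k)"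
proof (rule poly_eqI)
  fix i
  show "coeff (pderiv (gegenbauer \<nu> (Suc k))) i = coeff (smult (2 * \<nu>) (gegenbauer (\<nu> + 1) k)) i"
  proof (cases "i \<le> k \<and> even (k - i)")
    case False
    then show ?thesis by (auto simp: coeff_pderiv coeff_gegenbauer_eq_0)
  next
    case True
    then obtain j where k: "k = i + 2 * j" by (metis dvdE le_add_diff_inverse)
    then have k2: "Suc k = Suc i + 2 * j" by simp
    have "\<nu> \<notin> \<int>\<^sub>\<le>\<^sub>0" using assms by (auto elim!: nonpos_Ints_cases)
    then have g: "Gamma (\<nu> + 1) = \<nu> * Gamma \<nu>" by (rule Gamma_plus1)
    have nz: "Gamma \<nu> \<noteq> 0" using Gamma_real_pos[OF assms] by simp
    have a: "real (Suc i) + real j + \<nu> = real i + real j + (\<nu> + 1)" by simp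
    have f: "fact (Suc i) = real (Suc i) * fact i" by simp
    show ?thesis
      unfolding coeff_pderiv k2 coeff_gegenbauer coeff_smult unfolding k coeff_gegenbauer g a f
      using nz assms by (simp add: divide_simps del: of_nat_Suc)
  qed
qed

text \<open>At 1 the value is a multiple of the derivative, and the derivative is a Gegenbauer
  polynomial of lower degree with parameter \<nu> + 1. The induction on k therefore has to range
  over all \<nu>.\<close>

lemma gegenbauer_at_1:
  "\<nu> > 0 \<Longrightarrow> poly (gegenbauer \<nu> k) 1 = pochhammer (2 * \<nu>) k / fact k"
proof (induction k arbitrary: \<nu>)
  case 0
  have "Gamma \<nu> \<noteq> 0" using Gamma_real_pos[OF 0] by simp
  then show ?case by (simp add: gegenbauer_def)
next
  case (Suc k)
  have "real (Suc k) * (real (Suc k) + 2 * \<nu>) * poly (gegenbauer \<nu> (Suc k)) 1 = (2 * \<nu> + 1) * poly (pderiv (gegenbauer \<nu> (Suc k))) 1"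
    using gegenbauer_degree[OF Suc.prems] by (intro eigen_value_at_1 gegenbauer_coeff_rec Suc.prems) auto
  also have "\<dots> = (2 * \<nu> + 1) * (2 * \<nu>) * pochhammer (2 * \<nu> + 2) k / fact k"
    using Suc.IH[of "\<nu> + 1"] Suc.prems by (simp add: pderiv_gegenbauer algebra_simps)
  also have "\<dots> = pochhammer (2 * \<nu>) (Suc (Suc k)) / fact k"
    by (simp only: pochhammer_rec) (simp add: algebra_simps)
  also have "\<dots> = (real (Suc k) + 2 * \<nu>) * pochhammer (2 * \<nu>) (Suc k) / fact k"
    by (subst pochhammer_Suc) (simp add: algebra_simps)
  finally have "(real (Suc k) + 2 * \<nu>) * (real (Suc k) * poly (gegenbauer \<nu> (Suc k)) 1) = (real (Suc k) + 2 * \<nu>) * (pochhammer (2 * \<nu>) (Suc k) / fact k)"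
    by (simp only: mult_ac times_divide_eq_right)
  moreover have "real (Suc k) + 2 * \<nu> \<noteq> 0" using Suc.prems by simp
  ultimately have "real (Suc k) * poly (gegenbauer \<nu> (Suc k)) 1 = pochhammer (2 * \<nu>) (Suc k) / fact k"
    by (metis mult_left_cancel)
  then show ?case
    by (simp only: fact_Suc of_nat_mult) (simp add: field_simps del: of_nat_Suc)
qed

section \<open>The zonal polynomials, with p = 2 and larger p treated together\<close>

text \<open>\<open>h_fun\<close> as a polynomial, so that its coefficients are available.\<close>

definition harmonic_poly :: "nat \<Rightarrow> nat \<Rightarrow> real poly" where
  "harmonic_poly p k = smult (if p = 2 then 2 else 1 + 2 * real k / (real p - 2)) (C_poly ((real p - 2) / 2) k)"

lemma poly_harmonic_poly: "poly (harmonic_poly p k) s = h_fun p k s"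
  by (simp add: harmonic_poly_def h_fun_def)

lemma degree_harmonic_poly: "p \<ge> 2 \<Longrightarrow> degree (harmonic_poly p k) \<le> k"
  unfolding harmonic_poly_def using C_poly_degree[of "(real p - 2) / 2" k] degree_smult_le
  by (metis diff_ge_0_iff_ge divide_nonneg_pos of_nat_le_iff of_nat_numeral order_trans zero_less_numeral)

lemma harmonic_poly_rec:
  assumes "p \<ge> 2"
  shows "(real q + 2) * (real q + 1) * coeff (harmonic_poly p k) (q + 2)
    = - (real k - real q) * (real k + real q + real p - 2) * coeff (harmonic_poly p k) q"
proof -
  have "(real q + 2) * (real q + 1) * coeff (C_poly ((real p - 2) / 2) k) (q + 2)
    = - (real k - real q) * (real k + real q + real p - 2) * coeff (C_poly ((real p - 2) / 2) k) q"
  proof (cases "p = 2")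
    case True
    then show ?thesis using chebyshev_coeff_rec[of q k] by (simp add: C_poly_def)
  next
    case False
    then show ?thesis using gegenbauer_coeff_rec[of "(real p - 2) / 2" q k] assms by (simp add: C_poly_def add_diff_eq)
  qed
  then have "\<alpha> * ((real q + 2) * (real q + 1) * coeff (C_poly ((real p - 2) / 2) k) (q + 2))
    = \<alpha> * (- (real k - real q) * (real k + real q + real p - 2) * coeff (C_poly ((real p - 2) / 2) k) q)" for \<alpha>
    by simp
  from this[of "if p = 2 then 2 else 1 + 2 * real k / (real p - 2)"]
  show ?thesis unfolding harmonic_poly_def coeff_smult by (simp only: mult.left_commute mult.assoc)
qed

text \<open>This is the reciprocal of the constant in \<open>funk_hecke_power\<close>: the
  normalisation of \<open>h_fun\<close> is exactly the one that makes the zonal kernel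
  reproducing.\<close>

lemma harmonic_poly_lead:
  assumes "p \<ge> 2" "k \<ge> 1"
  shows "coeff (harmonic_poly p k) k = sphere_weight p k / fact k"
proof (cases "p = 2")
  case True
  obtain i where i: "k = Suc i" using assms by (cases k) auto
  have "sphere_weight 2 k = 2 ^ k * fact k"
    by (induction k) (simp_all add: sphere_weight_Suc algebra_simps, simp add: sphere_weight_def)
  then show ?thesis
    using True chebyshev_lead[of i] i by (simp add: harmonic_poly_def C_poly_def)
next
  case False
  define \<nu> where "\<nu> = (real p - 2) / 2"
  have \<nu>: "\<nu> > 0" "real p - 2 = 2 * \<nu>" using False assms by (auto simp: \<nu>_def)
  have nz: "Gamma \<nu> \<noteq> 0" using Gamma_real_pos[OF \<nu>(1)] by simp
  have "2 ^ k * Gamma (real k + \<nu>) * (real k + \<nu>) = sphere_weight p k * (\<nu> * Gamma \<nu>)"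
  proof (induction k)
    case (Suc k)
    have "real k + \<nu> \<notin> \<int>\<^sub>\<le>\<^sub>0" using \<nu> by (auto elim!: nonpos_Ints_cases)
    then have g: "Gamma (real k + \<nu> + 1) = (real k + \<nu>) * Gamma (real k + \<nu>)" by (rule Gamma_plus1)
    have "2 ^ Suc k * Gamma (real (Suc k) + \<nu>) * (real (Suc k) + \<nu>) = 2 * (real (Suc k) + \<nu>) * (2 ^ k * Gamma (real k + \<nu>) * (real k + \<nu>))"
      using g by (simp add: add_ac)
    also have "\<dots> = 2 * (real (Suc k) + \<nu>) * (sphere_weight p k * (\<nu> * Gamma \<nu>))"
      unfolding Suc ..
    also have "2 * (real (Suc k) + \<nu>) = real p + 2 * real k" by (simp add: \<nu>_def field_simps)
    finally show ?case unfolding sphere_weight_Suc by simp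
  qed (simp add: sphere_weight_def)
  moreover have "coeff (harmonic_poly p k) k = (1 + 2 * real k / (2 * \<nu>)) * (2 ^ k * Gamma (real k + \<nu>) / (Gamma \<nu> * fact k))"
    using coeff_gegenbauer[of \<nu> k 0] False \<nu> by (simp add: harmonic_poly_def C_poly_def)
  moreover have "1 + 2 * real k / (2 * \<nu>) = (real k + \<nu>) / \<nu>" using \<nu>(1) by (simp add: field_simps)
  ultimately show ?thesis using nz \<nu>(1) by (simp add: field_simps)
qed

text \<open>As x . x = 1 on the sphere, this is the diagonal of the zonal kernel, hence its trace
  and the number of harmonics of degree k.\<close>

lemma harmonic_poly_at_1:
  assumes "p \<ge> 2" "k \<ge> 1"
  shows "poly (harmonic_poly p k) 1 = real (d_const p k)"
proof (cases "p = 2")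
  case True
  then show ?thesis using poly_chebyshev[of k 0] by (simp add: harmonic_poly_def C_poly_def d_const_def)
next
  case False
  \<comment> \<open>Here p \<ge> 3; writing p = n + 3 turns the truncated differences in
    \<open>d_const\<close> into sums.\<close>
  define n where "n = p - 3"
  have p: "p = n + 3" using False assms by (simp add: n_def)
  obtain i where i: "k = Suc i" using assms by (cases k) auto
  have ph: "pochhammer (real n + 1) m = fact (n + m) / fact n" for m
  proof (induction m)
    case (Suc m)
    show ?case unfolding pochhammer_Suc Suc by (simp add: algebra_simps)
  qed simp
  have d1: "real ((n + k) choose (n + 1)) = fact (n + k) / (fact (n + 1) * fact i)"
    using binomial_fact[of "n + 1" "n + k"] i by simp
  have d2: "real ((n + k + 1) choose (n + 1)) = fact (n + k + 1) / (fact (n + 1) * fact k)"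
    using binomial_fact[of "n + 1" "n + k + 1"] by simp
  have f: "fact (n + 1) = (real n + 1) * fact n" "fact (n + k + 1) = (real n + real k + 1) * fact (n + k)" "fact k = real k * fact i"
    using i by (simp_all add: algebra_simps)
  have nz: "real n + 1 \<noteq> 0" "real k \<noteq> 0" using i by simp_all
  have "2 * ((real n + 1) / 2) = real n + 1" by (simp add: field_simps)
  then have g1: "poly (gegenbauer ((real n + 1) / 2) k) 1 = pochhammer (real n + 1) k / fact k"
    using gegenbauer_at_1[of "(real n + 1) / 2" k] by (simp only:)
  have "real (d_const p k) = fact (n + k) / (fact (n + 1) * fact i) + fact (n + k + 1) / (fact (n + 1) * fact k)"
    unfolding d1[symmetric] d2[symmetric] by (simp add: d_const_def p eval_nat_numeral)
  also have "\<dots> = (1 + 2 * real k / (real n + 1)) * (fact (n + k) / fact n / fact k)"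
    unfolding f using nz by (simp add: divide_simps) (simp add: algebra_simps)
  also have "\<dots> = poly (harmonic_poly p k) 1"
    using g1 ph[of k] by (simp add: harmonic_poly_def C_poly_def p add_ac)
  finally show ?thesis ..
qed

text \<open>Leading coefficients in the expansion of t^k show that m_(k,k) is the reciprocal of the
  leading coefficient of C_k. By \<open>harmonic_poly_lead\<close> the latter, times the
  normalisation of \<open>h_fun\<close> and k!, is \<open>sphere_weight p k\<close>.\<close>

lemma xi_const_eq:
  assumes p: "p \<ge> 2" and k: "k \<ge> 1"
  shows "xi_const p f k \<tau> = real (d_const p k) * ((deriv ^^ k) f 0)\<^sup>2 * \<tau> ^ (2 * k) / (sphere_weight p k)\<^sup>2"
proof -
  define \<nu> where "\<nu> = (real p - 2) / 2"
  have \<nu>: "\<nu> \<ge> 0" using p by (simp add: \<nu>_def)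
  define l where "l = coeff (C_poly \<nu> k) k"
  define \<alpha> where "\<alpha> = (if p = 2 then 2 else 1 + 2 * real k / (real p - 2))"
  have l: "l > 0" using C_poly_degree[OF \<nu>] by (simp add: l_def)
  have "poly (monom 1 k) t = poly (\<Sum>i\<le>k. smult (m_coeff \<nu> i k) (C_poly \<nu> i)) t" for t
    using m_coeff[OF \<nu>, of t k] by (simp add: poly_monom poly_sum)
  then have "monom 1 k = (\<Sum>i\<le>k. smult (m_coeff \<nu> i k) (C_poly \<nu> i))" by (intro poly_ext)
  then have "coeff (monom 1 k) k = (\<Sum>i\<le>k. m_coeff \<nu> i k * coeff (C_poly \<nu> i) k)"
    by (simp add: coeff_sum)
  also have "\<dots> = (\<Sum>i\<le>k. if i = k then m_coeff \<nu> k k * l else 0)"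
  proof (rule sum.cong[OF refl])
    fix i assume "i \<in> {..k}"
    moreover have "coeff (C_poly \<nu> i) k = 0" if "i < k"
      using C_poly_degree[OF \<nu>, of i] that by (intro coeff_eq_0) auto
    ultimately show "m_coeff \<nu> i k * coeff (C_poly \<nu> i) k = (if i = k then m_coeff \<nu> k k * l else 0)"
      by (auto simp: l_def)
  qed
  finally have m: "m_coeff \<nu> k k = 1 / l" using l by (simp add: field_simps)
  have d: "real (d_const p k) > 0"
  proof -
    have "(p + k - 2) choose (p - 2) > 0" using p by simp
    then show ?thesis by (simp add: d_const_def add_nonneg_pos)
  qed
  have \<alpha>: "\<alpha> > 0" using p by (auto simp: \<alpha>_def intro!: add_pos_nonneg)
  have t: "(t_const p k)\<^sup>2 = \<alpha>\<^sup>2 / real (d_const p k)"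
    using d by (auto simp: t_const_def \<alpha>_def power_divide d_const_def)
  have w: "sphere_weight p k = \<alpha> * l * fact k"
    using harmonic_poly_lead[OF p k] by (simp add: harmonic_poly_def \<alpha>_def[symmetric] \<nu>_def[symmetric] l_def field_simps)
  show ?thesis
    unfolding xi_const_def \<nu>_def[symmetric] m t w using l \<alpha> d
    by (simp add: power_divide power_mult_distrib field_simps)
qed

subsection \<open>Spherical harmonics and rotationally symmetric laws\<close>

text \<open>The derivative of order k + 1 is itself differentiable near 0, hence continuous and
  bounded on a compact interval; its bound controls the Lagrange remainder.\<close>

lemma taylor_bound:
  assumes "infinitely_differentiable_at_zero f"
  obtains \<delta> C where "\<delta> > 0" "C \<ge> 0"
    "\<And>x. \<bar>x\<bar> \<le> \<delta> \<Longrightarrow> \<bar>f x - (\<Sum>b\<le>k. (deriv ^^ b) f 0 / fact b * x ^ b)\<bar> \<le> C * \<bar>x\<bar> ^ Suc k"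
proof -
  \<comment> \<open>The neighbourhood may shrink with the order, but only finitely many orders
    occur.\<close>
  have "\<forall>\<^sub>F x in nhds 0. \<forall>m\<in>{..Suc k}. (deriv ^^ m) f field_differentiable at x"
    using assms by (subst eventually_ball_finite_distrib) (auto simp: infinitely_differentiable_at_zero_def)
  then obtain e where e: "e > 0" "\<And>x m. \<bar>x\<bar> < e \<Longrightarrow> m \<le> Suc k \<Longrightarrow> (deriv ^^ m) f field_differentiable at x"
    unfolding eventually_nhds_metric by (auto simp: dist_real_def)
  have d: "((deriv ^^ m) f has_real_derivative (deriv ^^ Suc m) f x) (at x)" if "\<bar>x\<bar> < e" "m \<le> Suc k" for x m
    using e(2)[OF that] by (simp add: field_differentiable_derivI)
  have "continuous_on {-e/2..e/2} ((deriv ^^ Suc k) f)"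
  proof (intro continuous_at_imp_continuous_on ballI)
    fix x assume "x \<in> {-e/2..e/2}"
    then show "isCont ((deriv ^^ Suc k) f) x"
      using e(1) by (intro DERIV_isCont[OF d]) auto
  qed
  then have "compact ((deriv ^^ Suc k) f ` {-e/2..e/2})"
    by (intro compact_continuous_image) auto
  then obtain B where B: "\<forall>y\<in>(deriv ^^ Suc k) f ` {-e/2..e/2}. norm y \<le> B"
    using compact_imp_bounded bounded_iff by metis
  show ?thesis
  proof (rule that[of "e / 2" "B / fact (Suc k)"])
    have "norm ((deriv ^^ Suc k) f 0) \<le> B" using B e(1) by auto
    then have "B \<ge> 0" using norm_ge_zero order_trans by blast
    then show "B / fact (Suc k) \<ge> 0" by simp
    fix x :: real assume x: "\<bar>x\<bar> \<le> e / 2"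
    have "\<exists>t. \<bar>t\<bar> \<le> \<bar>x\<bar> \<and> f x = (\<Sum>m<Suc k. (deriv ^^ m) f 0 / fact m * x ^ m) + (deriv ^^ Suc k) f t / fact (Suc k) * x ^ Suc k"
      by (rule Maclaurin_bi_le) (use x e(1) d in auto)
    then obtain t where t: "\<bar>t\<bar> \<le> \<bar>x\<bar>" "f x = (\<Sum>m\<le>k. (deriv ^^ m) f 0 / fact m * x ^ m) + (deriv ^^ Suc k) f t / fact (Suc k) * x ^ Suc k"
      unfolding lessThan_Suc_atMost by blast
    have "t \<in> {-e/2..e/2}" using t(1) x by (simp add: abs_le_iff)
    then have "norm ((deriv ^^ Suc k) f t) \<le> B" using B by blast
    then have "\<bar>(deriv ^^ Suc k) f t / fact (Suc k) * x ^ Suc k\<bar> \<le> B / fact (Suc k) * \<bar>x\<bar> ^ Suc k"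
      unfolding abs_mult abs_divide power_abs by (intro mult_right_mono) (auto intro!: divide_right_mono simp del: fact_Suc)
    then show "\<bar>f x - (\<Sum>b\<le>k. (deriv ^^ b) f 0 / fact b * x ^ b)\<bar> \<le> B / fact (Suc k) * \<bar>x\<bar> ^ Suc k"
      unfolding t(2) by simp
  qed (use e(1) in auto)
qed

section \<open>Zonal functions and spherical harmonics\<close>

definition zonal :: "nat \<Rightarrow> real ^ 'p::finite \<Rightarrow> real ^ 'p \<Rightarrow> real" where
  "zonal k x z = h_fun CARD('p) k (x \<bullet> z)"

lemma zonal_poly: "zonal k x z = poly (harmonic_poly CARD('p) k) (x \<bullet> z)" for x z :: "real ^ 'p::finite"
  by (simp add: zonal_def poly_harmonic_poly)

lemma continuous_zonal: "continuous_on UNIV (\<lambda>x. zonal k x z)"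
  unfolding zonal_poly by (intro continuous_intros)

abbreviation zonal_span :: "nat \<Rightarrow> (real ^ 'p::finite \<Rightarrow> real) set" where
  "zonal_span k \<equiv> kernel_span (zonal k) (sphere 0 1)"

lemma zonal_span_continuous: "g \<in> zonal_span k \<Longrightarrow> continuous_on UNIV g"
  by (induction rule: kernel_span.induct) (auto intro!: continuous_zonal continuous_intros)

lemma zonal_span_measurable: "g \<in> zonal_span k \<Longrightarrow> g \<in> borel_measurable uniform_sphere"
  by (intro borel_measurable_uniform_sphere borel_measurable_continuous_onI zonal_span_continuous)

lemma zonal_span_power:
  fixes g :: "real ^ 'p::finite \<Rightarrow> real"
  assumes p: "CARD('p) \<ge> 2" and k: "k \<ge> 1" "b \<le> k" and w: "norm w = 1" and g: "g \<in> zonal_span k"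
  shows "(\<integral>x. g x * (x \<bullet> w) ^ b \<partial>uniform_sphere) = (if b = k then fact k / sphere_weight CARD('p) k else 0) * g w"
  using g
proof (induction rule: kernel_span.induct)
  case (kernel z)
  have "(\<integral>x. zonal k x z * (x \<bullet> w) ^ b \<partial>uniform_sphere) = (if b = k then fact k / sphere_weight CARD('p) k else 0) * zonal k z w"
    unfolding zonal_poly using kernel w p
    by (intro funk_hecke_power k degree_harmonic_poly harmonic_poly_rec) auto
  then show ?case by (simp add: zonal_def inner_commute)
next
  case (lincomb f g a c)
  have "integrable uniform_sphere (\<lambda>x. f x * (x \<bullet> w) ^ b)" "integrable uniform_sphere (\<lambda>x. g x * (x \<bullet> w) ^ b)"
    by (intro integrable_uniform_sphere continuous_intros zonal_span_continuous[OF lincomb(1)] zonal_span_continuous[OF lincomb(2)])+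
  then have "(\<integral>x. a * (f x * (x \<bullet> w) ^ b) + c * (g x * (x \<bullet> w) ^ b) \<partial>uniform_sphere)
    = a * (\<integral>x. f x * (x \<bullet> w) ^ b \<partial>uniform_sphere) + c * (\<integral>x. g x * (x \<bullet> w) ^ b \<partial>uniform_sphere)"
    by simp
  then show ?case unfolding lincomb.IH by (simp add: algebra_simps)
qed

text \<open>Expand the zonal function in powers of x . w: all powers below k integrate to 0 against
  g, and for l = k the leading coefficient cancels the constant of the k-th power. The case l = k is
  the reproducing property, the case l < k the orthogonality of degrees.\<close>

lemma zonal_span_zonal:
  fixes g :: "real ^ 'p::finite \<Rightarrow> real"
  assumes p: "CARD('p) \<ge> 2" and k: "k \<ge> 1" "l \<le> k" and w: "norm w = 1" and g: "g \<in> zonal_span k"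
  shows "(\<integral>x. g x * zonal l x w \<partial>uniform_sphere) = (if l = k then g w else 0)"
proof -
  let ?H = "harmonic_poly CARD('p) l"
  have "zonal l x w = (\<Sum>b\<le>l. coeff ?H b * (x \<bullet> w) ^ b)" for x
    unfolding zonal_poly poly_altdef using degree_harmonic_poly[OF p, of l]
    by (intro sum.mono_neutral_left) (auto simp: coeff_eq_0)
  then have "(\<integral>x. g x * zonal l x w \<partial>uniform_sphere) = (\<integral>x. (\<Sum>b\<le>l. coeff ?H b * (g x * (x \<bullet> w) ^ b)) \<partial>uniform_sphere)"
    by (simp add: sum_distrib_left mult_ac)
  also have "\<dots> = (\<Sum>b\<le>l. coeff ?H b * (\<integral>x. g x * (x \<bullet> w) ^ b \<partial>uniform_sphere))"
    by (subst Bochner_Integration.integral_sum)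
      (auto intro!: integrable_uniform_sphere continuous_intros zonal_span_continuous[OF g])
  also have "\<dots> = (\<Sum>b\<le>l. if b = k then coeff ?H k * (fact k / sphere_weight CARD('p) k) * g w else 0)"
    using k by (intro sum.cong refl, subst zonal_span_power[OF p k(1) _ w g]) auto
  also have "\<dots> = (if l = k then g w else 0)"
    using k harmonic_poly_lead[OF p k(1)] sphere_weight_pos[of "CARD('p)" k] by auto
  finally show ?thesis .
qed

lemma zonal_span_orthogonal:
  fixes f g :: "real ^ 'p::finite \<Rightarrow> real"
  assumes p: "CARD('p) \<ge> 2" and f: "f \<in> zonal_span k" and g: "g \<in> zonal_span l" and k: "k \<ge> 1" "l < k"
  shows "(\<integral>x. f x * g x \<partial>uniform_sphere) = 0"
  using g
proof (induction rule: kernel_span.induct)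
  case (kernel z)
  then show ?case using zonal_span_zonal[OF p k(1) _ _ f, of l z] k(2) by simp
next
  case (lincomb g h a c)
  have "integrable uniform_sphere (\<lambda>x. f x * g x)" "integrable uniform_sphere (\<lambda>x. f x * h x)"
    by (intro integrable_uniform_sphere continuous_intros zonal_span_continuous[OF f] zonal_span_continuous[OF lincomb(1)]
       zonal_span_continuous[OF lincomb(2)])+
  then have "(\<integral>x. a * (f x * g x) + c * (f x * h x) \<partial>uniform_sphere)
    = a * (\<integral>x. f x * g x \<partial>uniform_sphere) + c * (\<integral>x. f x * h x \<partial>uniform_sphere)"
    by simp
  then show ?case unfolding lincomb.IH by (simp add: algebra_simps)
qed

text \<open>For each degree the functions come from \<open>kernel_decomposition\<close> of the zonal
  kernel, whose sum representation is the addition formula; different degrees are orthogonal by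
  \<open>zonal_span_orthogonal\<close>.\<close>

theorem spherical_harmonics:
  assumes p: "CARD('p::finite) \<ge> 2"
  obtains g :: "nat \<Rightarrow> nat \<Rightarrow> real ^ 'p \<Rightarrow> real" where
    "\<And>k i. k \<ge> 1 \<Longrightarrow> i < d_const CARD('p) k \<Longrightarrow> g k i \<in> zonal_span k"
    and "\<And>k i l j. k \<ge> 1 \<Longrightarrow> l \<ge> 1 \<Longrightarrow> i < d_const CARD('p) k \<Longrightarrow> j < d_const CARD('p) l \<Longrightarrow>
      (\<integral>x. g k i x * g l j x \<partial>uniform_sphere) = (if k = l \<and> i = j then 1 else 0)"
    and "\<And>k x z. k \<ge> 1 \<Longrightarrow> norm x = 1 \<Longrightarrow> norm z = 1 \<Longrightarrow>
      h_fun CARD('p) k (x \<bullet> z) = (\<Sum>i<d_const CARD('p) k. g k i x * g k i z)"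
proof -
  define Q where "Q k g \<longleftrightarrow> (\<forall>i<d_const CARD('p) k. g i \<in> zonal_span k) \<and>
      (\<forall>i<d_const CARD('p) k. \<forall>j<d_const CARD('p) k. (\<integral>x. g i x * g j x \<partial>uniform_sphere) = (if i = j then 1 else 0)) \<and>
      (\<forall>x\<in>sphere 0 1. \<forall>z\<in>sphere 0 1. zonal k x z = (\<Sum>i<d_const CARD('p) k. g i x * g i z))"
    for k :: nat and g :: "nat \<Rightarrow> real ^ 'p \<Rightarrow> real"
  have "\<exists>g. Q k g"
    if k: "k \<ge> 1" for k
  proof -
    have "compact (poly (harmonic_poly CARD('p) k) ` {-1..1})"
      by (intro compact_continuous_image continuous_intros) auto
    then obtain B where B: "\<forall>y\<in>poly (harmonic_poly CARD('p) k) ` {-1..1}. norm y \<le> B"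
      using compact_imp_bounded bounded_iff by metis
    interpret reproducing_kernel "uniform_sphere :: (real ^ 'p) measure" "zonal k" "d_const CARD('p) k" B
    proof unfold_locales
      fix x z :: "real ^ 'p" assume x: "x \<in> space uniform_sphere" and z: "z \<in> space uniform_sphere"
      then have "\<bar>x \<bullet> z\<bar> \<le> 1" by (intro abs_inner_unit) auto
      then show "\<bar>zonal k x z\<bar> \<le> B"
        using B[rule_format, of "poly (harmonic_poly CARD('p) k) (x \<bullet> z)"] by (simp add: zonal_poly abs_le_iff)
      have "(\<integral>y. zonal k y x * zonal k y z \<partial>uniform_sphere) = zonal k z x"
        using x z by (subst zonal_span_zonal[OF p k order_refl]) (auto intro!: kernel_span.kernel)
      then show "(\<integral>y. zonal k x y * zonal k y z \<partial>uniform_sphere) = zonal k x z"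
        by (simp add: zonal_def inner_commute)
    next
      fix x :: "real ^ 'p" assume x: "x \<in> space uniform_sphere"
      then have "x \<bullet> x = 1" by (simp add: norm_eq_1)
      then show "zonal k x x = real (d_const CARD('p) k)"
        using harmonic_poly_at_1[OF p k] by (simp add: zonal_poly)
    next
      fix z :: "real ^ 'p"
      show "(\<lambda>x. zonal k x z) \<in> borel_measurable uniform_sphere"
        by (intro borel_measurable_uniform_sphere borel_measurable_continuous_onI continuous_zonal)
    qed (simp add: zonal_def inner_commute)
    obtain g where "\<And>i. i < d_const CARD('p) k \<Longrightarrow> g i \<in> kspan"
      "\<And>i j. i < d_const CARD('p) k \<Longrightarrow> j < d_const CARD('p) k \<Longrightarrow> (\<integral>x. g i x * g j x \<partial>uniform_sphere) = (if i = j then 1 else 0)"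
      "\<And>x z. x \<in> space uniform_sphere \<Longrightarrow> z \<in> space uniform_sphere \<Longrightarrow> zonal k x z = (\<Sum>i<d_const CARD('p) k. g i x * g i z)"
      using kernel_decomposition by blast
    then show ?thesis by (intro exI[of _ g]) (auto simp: Q_def)
  qed
  then have "\<forall>k. \<exists>g. k \<ge> 1 \<longrightarrow> Q k g" by blast
  from choice[OF this] obtain g where "\<forall>k. k \<ge> 1 \<longrightarrow> Q k (g k)" by blast
  then have g: "Q k (g k)" if "k \<ge> 1" for k using that by blast
  note g = g[unfolded Q_def]
  show ?thesis
  proof (rule that[of g])
    fix k i l j assume k: "k \<ge> 1" "l \<ge> 1" "i < d_const CARD('p) k" "j < d_const CARD('p) l"
    consider "k = l" | "l < k" | "k < l" by linarith
    then show "(\<integral>x. g k i x * g l j x \<partial>uniform_sphere) = (if k = l \<and> i = j then 1 else 0)"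
    proof cases
      case 1
      have "(\<integral>x. g k i x * g k j x \<partial>uniform_sphere) = (if i = j then 1 else 0)"
        using g[OF k(1)] k(3,4) unfolding 1 by blast
      then show ?thesis unfolding 1 by (simp only: simp_thms)
    next
      case 2
      then have "(\<integral>x. g k i x * g l j x \<partial>uniform_sphere) = 0"
        using g[OF k(1)] g[OF k(2)] k by (intro zonal_span_orthogonal[OF p]) blast+
      then show ?thesis using 2 by simp
    next
      case 3
      then have "(\<integral>x. g l j x * g k i x \<partial>uniform_sphere) = 0"
        using g[OF k(1)] g[OF k(2)] k by (intro zonal_span_orthogonal[OF p]) blast+
      moreover have "(\<integral>x. g k i x * g l j x \<partial>uniform_sphere) = (\<integral>x. g l j x * g k i x \<partial>uniform_sphere)"
        by (intro Bochner_Integration.integral_cong refl mult.commute)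
      ultimately show ?thesis using 3 by simp
    qed
  next
    fix k i assume "1 \<le> k" "i < d_const CARD('p) k"
    then show "g k i \<in> zonal_span k" using g by blast
  next
    fix k :: nat and x z :: "real ^ 'p" assume "1 \<le> k" "norm x = 1" "norm z = 1"
    then have "zonal k x z = (\<Sum>i<d_const CARD('p) k. g k i x * g k i z)" using g[of k] by simp
    then show "h_fun CARD('p) k (x \<bullet> z) = (\<Sum>i<d_const CARD('p) k. g k i x * g k i z)"
      unfolding zonal_def .
  qed
qed

lemma norm_theta0 [simp]: "norm (theta0 :: real ^ 'p::{finite,linorder}) = 1"
  by (simp add: theta0_def)

section \<open>Rotationally symmetric laws as densities over the uniform distribution\<close>

text \<open>With f within 1/2 of 1 on the range of the argument, the normalising integral is finite
  and positive. This excludes the null measure and lets the extended-real quotient be computed in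
  the reals.\<close>

lemma rotsym_law_facts:
  fixes f :: "real \<Rightarrow> real" and \<rho> :: "real ^ 'p::{finite,linorder} \<Rightarrow> real"
  assumes \<rho>_def: "\<rho> = (\<lambda>u. f (\<kappa> * (u \<bullet> theta0)))" and f: "angular_function f" and bound: "\<And>x. \<bar>x\<bar> \<le> \<kappa> \<Longrightarrow> \<bar>f x - 1\<bar> \<le> 1 / 2" and \<kappa>: "\<kappa> \<ge> 0"
  shows "sets (rotsym_law \<kappa> f :: (real ^ 'p::{finite,linorder}) measure) = sets uniform_sphere"
    and "prob_space (rotsym_law \<kappa> f :: (real ^ 'p::{finite,linorder}) measure)"
    and "integrable uniform_sphere (\<rho>)"
    and "1 / 2 \<le> (\<integral>u. \<rho> u \<partial>uniform_sphere)"
    and "\<And>g. g \<in> borel_measurable uniform_sphere \<Longrightarrow>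
      (\<integral>u. g u \<partial>rotsym_law \<kappa> f) = (\<integral>u. g u * \<rho> u \<partial>uniform_sphere) / (\<integral>u. \<rho> u \<partial>uniform_sphere)"
proof -
  let ?S = "surface_measure :: (real ^ 'p::{finite,linorder}) measure"
  let ?U = "uniform_sphere :: (real ^ 'p::{finite,linorder}) measure"
  define a where "a = measure ?S (sphere 0 1)"
  have a1: "emeasure ?S (sphere 0 1) = ennreal a"
    using surface_measure_total(2)[where 'p = 'p] unfolding a_def by (intro emeasure_eq_ennreal_measure) auto
  then have "0 < ennreal a" using surface_measure_total(1)[where 'p = 'p] by simp
  then have "a > 0" by (simp add: ennreal_less_zero_iff)
  note a = a1 this
  show sets: "sets (rotsym_law \<kappa> f :: (real ^ 'p::{finite,linorder}) measure) = sets ?U"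
    by (simp add: rotsym_law_def sets_uniform_sphere sets_surface_measure)
  have US: "sets ?U = sets ?S" by (simp add: sets_uniform_sphere sets_surface_measure)
  have fm: "f \<in> borel_measurable borel" and f0: "\<And>x. f x \<ge> 0" using f by (auto simp: angular_function_def)
  have rm: "\<rho> \<in> borel_measurable ?U"
    unfolding \<rho>_def by (intro borel_measurable_uniform_sphere measurable_compose[OF _ fm]) simp
  then have rmS: "\<rho> \<in> borel_measurable ?S"
    by (simp add: measurable_cong_sets[OF US refl])
  have r0: "\<rho> u \<ge> 0" for u by (simp add: \<rho>_def f0)
  have rb: "\<bar>\<rho> u - 1\<bar> \<le> 1 / 2" if "u \<in> sphere 0 1" for u
  proof -
    have "\<bar>u \<bullet> (theta0 :: real ^ 'p::{finite,linorder})\<bar> \<le> 1" using that by (intro abs_inner_unit) auto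
    then have "\<bar>\<kappa> * (u \<bullet> (theta0 :: real ^ 'p::{finite,linorder}))\<bar> \<le> \<kappa>"
      using \<kappa> by (simp add: abs_mult mult_left_le)
    then show ?thesis unfolding \<rho>_def by (rule bound)
  qed
  show int: "integrable ?U \<rho>"
  proof (rule uniform_sphere.integrable_const_bound[of _ 2])
    show "AE u in ?U. norm (\<rho> u) \<le> 2"
    proof (rule AE_I2)
      fix u :: "real ^ 'p::{finite,linorder}" assume "u \<in> space ?U"
      then have "\<bar>\<rho> u - 1\<bar> \<le> 1 / 2" using rb[of u] by simp
      then show "norm (\<rho> u) \<le> 2" unfolding real_norm_def by linarith
    qed
  qed (rule rm)
  define Z where "Z = (\<integral>u. \<rho> u \<partial>?U)"
  have "(\<integral>u. 1 / 2 \<partial>?U) \<le> Z"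
    unfolding Z_def
  proof (rule integral_mono_AE)
    show "AE u in ?U. 1 / 2 \<le> \<rho> u"
    proof (rule AE_I2)
      fix u :: "real ^ 'p::{finite,linorder}" assume "u \<in> space ?U"
      then have "\<bar>\<rho> u - 1\<bar> \<le> 1 / 2" using rb[of u] by simp
      then show "1 / 2 \<le> \<rho> u" by linarith
    qed
  qed (use int in auto)
  then have Z: "1 / 2 \<le> Z" by (simp add: uniform_sphere.prob_space[simplified])
  then show "1 / 2 \<le> (\<integral>u. \<rho> u \<partial>?U)" by (simp add: Z_def)
  have U: "?U = density ?S (\<lambda>_. ennreal (1 / a))"
    unfolding uniform_sphere_def a(1) using a(2) by (simp add: divide_ennreal flip: ennreal_1)
  have ZZ: "ennreal Z = (\<integral>\<^sup>+ u. ennreal (\<rho> u) \<partial>?U)"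
    unfolding Z_def by (rule nn_integral_eq_integral[symmetric]) (use int r0 in auto)
  also have "\<dots> = ennreal (1 / a) * (\<integral>\<^sup>+ u. ennreal (\<rho> u) \<partial>?S)"
    unfolding U using rmS by (subst nn_integral_density) (auto simp: nn_integral_cmult)
  finally have "ennreal a * ennreal Z = ennreal a * ennreal (1 / a) * (\<integral>\<^sup>+ u. ennreal (\<rho> u) \<partial>?S)"
    by (simp add: mult.assoc)
  then have N: "(\<integral>\<^sup>+ u. ennreal (\<rho> u) \<partial>?S) = ennreal (a * Z)"
    using a(2) Z by (simp add: ennreal_mult[symmetric])
  \<comment> \<open>The total area \<open>a\<close> cancels between the normalisations of the two
    densities.\<close>
  have law: "rotsym_law \<kappa> f = density ?U (\<lambda>u. ennreal (\<rho> u / Z))"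
  proof -
    have "density ?U (\<lambda>u. ennreal (\<rho> u / Z)) = density ?S (\<lambda>u. ennreal (1 / a) * ennreal (\<rho> u / Z))"
      unfolding U using rmS by (subst density_density_eq) auto
    also have "\<dots> = density ?S (\<lambda>u. ennreal (\<rho> u) / ennreal (a * Z))"
      using a(2) Z r0 rmS by (intro density_cong) (auto simp: divide_ennreal ennreal_mult[symmetric])
    also have "\<dots> = rotsym_law \<kappa> f"
      using N by (simp only: rotsym_law_def \<rho>_def)
    finally show ?thesis by (rule sym)
  qed
  show "prob_space (rotsym_law \<kappa> f :: (real ^ 'p::{finite,linorder}) measure)"
  proof
    have "emeasure (rotsym_law \<kappa> f :: (real ^ 'p::{finite,linorder}) measure) (space (rotsym_law \<kappa> f)) = (\<integral>\<^sup>+ u. ennreal (\<rho> u / Z) \<partial>?U)"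
    proof -
      have m: "(\<lambda>u. ennreal (\<rho> u / Z)) \<in> borel_measurable ?U" using rm by simp
      have sp: "space (rotsym_law \<kappa> f :: (real ^ 'p::{finite,linorder}) measure) = space ?U"
        by (rule sets_eq_imp_space_eq[OF sets])
      show ?thesis
        unfolding sp unfolding law emeasure_density[OF m sets.top] by (rule nn_integral_cong) simp
    qed
    also have "\<dots> = (\<integral>\<^sup>+ u. ennreal (1 / Z) * ennreal (\<rho> u) \<partial>?U)"
      using Z r0 by (intro nn_integral_cong) (simp flip: ennreal_mult)
    also have "\<dots> = ennreal (1 / Z) * ennreal Z"
      using rm by (simp add: nn_integral_cmult ZZ)
    also have "\<dots> = 1" using Z by (simp flip: ennreal_mult)
    finally show "emeasure (rotsym_law \<kappa> f :: (real ^ 'p::{finite,linorder}) measure) (space (rotsym_law \<kappa> f)) = 1" .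
  qed
  show "(\<integral>u. g u \<partial>rotsym_law \<kappa> f) = (\<integral>u. g u * \<rho> u \<partial>?U) / (\<integral>u. \<rho> u \<partial>?U)"
    if g: "g \<in> borel_measurable ?U" for g :: "real ^ 'p::{finite,linorder} \<Rightarrow> real"
  proof -
    have "(\<integral>u. g u \<partial>rotsym_law \<kappa> f) = (\<integral>u. \<rho> u / Z * g u \<partial>?U)"
      unfolding law using g rm Z r0 by (subst integral_density) auto
    also have "\<dots> = (\<integral>u. g u * \<rho> u / Z \<partial>?U)" by (simp add: mult.commute)
    finally show ?thesis by (simp add: Z_def)
  qed
qed

text \<open>Based on \<bar>y\<bar> \<le> (y^2 + 1) / 2. Only the L^2 norm of g enters, so for
  normalised harmonics the bound does not grow with the degree, as a bound by the supremum of g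
  would.\<close>

lemma integral_diff_bound:
  fixes g r :: "'a \<Rightarrow> real"
  assumes "prob_space M" "integrable M (\<lambda>x. (g x)\<^sup>2)" "g \<in> borel_measurable M" "r \<in> borel_measurable M"
    and r: "\<And>x. x \<in> space M \<Longrightarrow> \<bar>r x\<bar> \<le> e" and g: "(\<integral>x. (g x)\<^sup>2 \<partial>M) \<le> 1"
  shows "\<bar>\<integral>x. g x * r x \<partial>M\<bar> \<le> e"
proof -
  interpret prob_space M by fact
  have e: "e \<ge> 0" using r not_empty by (metis abs_ge_zero all_not_in_conv order_trans)
  have le: "\<bar>y\<bar> \<le> (y\<^sup>2 + 1) / 2" for y :: real
    using zero_le_power2[of "\<bar>y\<bar> - 1"] by (simp add: power2_eq_square algebra_simps)
  have bnd: "\<bar>g x * r x\<bar> \<le> e * (((g x)\<^sup>2 + 1) / 2)" if "x \<in> space M" for x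
    using mult_mono[OF le[of "g x"] r[OF that]] by (simp add: abs_mult mult.commute)
  have i2: "integrable M (\<lambda>x. e * (((g x)\<^sup>2 + 1) / 2))" using assms(2) by simp
  have i1: "integrable M (\<lambda>x. g x * r x)"
    by (rule Bochner_Integration.integrable_bound[OF i2]) (use assms(3,4) order_trans[OF bnd abs_ge_self] in auto)
  have "\<bar>\<integral>x. g x * r x \<partial>M\<bar> \<le> (\<integral>x. \<bar>g x * r x\<bar> \<partial>M)" by (rule integral_abs_bound)
  also have "\<dots> \<le> (\<integral>x. e * (((g x)\<^sup>2 + 1) / 2) \<partial>M)"
    by (intro integral_mono i2 integrable_abs i1 bnd)
  also have "\<dots> = e * (((\<integral>x. (g x)\<^sup>2 \<partial>M) + 1) / 2)" using assms(2) by (simp add: prob_space)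
  also have "\<dots> \<le> e * 1" using g e by (intro mult_left_mono) auto
  finally show ?thesis by simp
qed

subsection \<open>Weighted sums of chi-square variables\<close>

abbreviation shifted_normal :: "real \<Rightarrow> nat \<Rightarrow> real measure" where
  "shifted_normal \<xi> i \<equiv> density lborel (\<lambda>x. ennreal (normal_density (if i = 0 then sqrt \<xi> else 0) 1 x))"

text \<open>Independence of the coordinates gives the Laplace transform as a product. The bound on
  the mean comes from x^2 \<le> 2 (x - m)^2 + 2 m^2; it loses a factor 2, which is harmless for the
  summability it serves.\<close>

lemma noncentral_chi_square_facts:
  shows "real_distribution (noncentral_chi_square d \<xi>)"
    and "AE x in noncentral_chi_square d \<xi>. 0 \<le> x"
    and "a \<ge> 0 \<Longrightarrow> (\<integral>x. exp (- (a * x)) \<partial>noncentral_chi_square d \<xi>) = (\<Prod>i<d. gauss_laplace a (if i = 0 then sqrt \<xi> else 0))"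
    and "\<xi> \<ge> 0 \<Longrightarrow> (\<integral>\<^sup>+ x. ennreal x \<partial>noncentral_chi_square d \<xi>) \<le> ennreal (2 * real d + 2 * \<xi>)"
proof -
  let ?N = "shifted_normal \<xi>"
  let ?P = "PiM {..<d} ?N"
  have pN: "prob_space (?N i)" for i by (rule prob_space_normal_density) simp
  interpret N: product_prob_space ?N "{..<d}"
    by (simp add: product_prob_space_def product_prob_space_axioms_def product_sigma_finite_def pN prob_space_imp_sigma_finite)
  have [measurable]: "(\<lambda>z. \<Sum>i<d. (z i)\<^sup>2) \<in> borel_measurable ?P"
    by (intro borel_measurable_sum borel_measurable_power) (simp add: measurable_component_singleton)
  have def: "noncentral_chi_square d \<xi> = distr ?P borel (\<lambda>z. \<Sum>i<d. (z i)\<^sup>2)"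
    by (simp add: noncentral_chi_square_def)
  show "real_distribution (noncentral_chi_square d \<xi>)"
    unfolding def by (intro prob_space.real_distribution_distr N.P.prob_space_axioms) simp
  show "AE x in noncentral_chi_square d \<xi>. 0 \<le> x"
    unfolding def by (subst AE_distr_iff) (auto simp: sum_nonneg)
  show "(\<integral>x. exp (- (a * x)) \<partial>noncentral_chi_square d \<xi>) = (\<Prod>i<d. gauss_laplace a (if i = 0 then sqrt \<xi> else 0))"
    if a: "a \<ge> 0"
  proof -
    have "(\<integral>x. exp (- (a * x)) \<partial>noncentral_chi_square d \<xi>) = (\<integral>z. exp (- (a * (\<Sum>i<d. (z i)\<^sup>2))) \<partial>?P)"
      unfolding def by (subst integral_distr) auto
    also have "\<dots> = (\<integral>z. (\<Prod>i<d. exp (- a * (z i)\<^sup>2)) \<partial>?P)"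
      by (simp add: exp_sum sum_distrib_left flip: sum_negf)
    also have "\<dots> = (\<Prod>i<d. \<integral>x. exp (- a * x\<^sup>2) \<partial>?N i)"
    proof (rule N.product_integral_prod)
      fix i
      show "integrable (?N i) (\<lambda>x. exp (- a * x\<^sup>2))"
        by (rule finite_measure.integrable_const_bound[OF prob_space.finite_measure[OF pN], of _ 1]) (use a in auto)
    qed simp
    also have "\<dots> = (\<Prod>i<d. gauss_laplace a (if i = 0 then sqrt \<xi> else 0))"
      by (intro prod.cong refl integral_exp_square_normal a)
    finally show ?thesis .
  qed
  show "(\<integral>\<^sup>+ x. ennreal x \<partial>noncentral_chi_square d \<xi>) \<le> ennreal (2 * real d + 2 * \<xi>)" if \<xi>: "\<xi> \<ge> 0"
  proof -
    let ?m = "\<lambda>i. if i = 0 then sqrt \<xi> else 0"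
    have sq: "ennreal (x\<^sup>2) \<le> ennreal 2 * ennreal ((x - m)\<^sup>2) + ennreal (2 * m\<^sup>2)" for x m :: real
    proof -
      have "x\<^sup>2 \<le> 2 * (x - m)\<^sup>2 + 2 * m\<^sup>2"
        using zero_le_power2[of "x - 2 * m"] by (simp add: power2_eq_square algebra_simps)
      then have "ennreal (x\<^sup>2) \<le> ennreal (2 * (x - m)\<^sup>2 + 2 * m\<^sup>2)" by (rule ennreal_leI)
      also have "\<dots> = ennreal 2 * ennreal ((x - m)\<^sup>2) + ennreal (2 * m\<^sup>2)"
        by (subst ennreal_plus) (simp_all add: ennreal_mult)
      finally show ?thesis .
    qed
    have 1: "(\<integral>\<^sup>+ x. ennreal (x\<^sup>2) \<partial>?N i) \<le> ennreal (2 + 2 * (?m i)\<^sup>2)" for i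
    proof -
      have "(\<integral>\<^sup>+ x. ennreal (x\<^sup>2) \<partial>?N i) \<le> (\<integral>\<^sup>+ x. ennreal 2 * ennreal ((x - ?m i)\<^sup>2) + ennreal (2 * (?m i)\<^sup>2) \<partial>?N i)"
        by (intro nn_integral_mono sq)
      also have "\<dots> = ennreal 2 * (\<integral>\<^sup>+ x. ennreal ((x - ?m i)\<^sup>2) \<partial>?N i) + ennreal (2 * (?m i)\<^sup>2)"
        using prob_space.emeasure_space_1[OF pN, of i] by (subst nn_integral_add) (auto simp: nn_integral_cmult)
      also have "(\<integral>\<^sup>+ x. ennreal ((x - ?m i)\<^sup>2) \<partial>?N i) = ennreal 1"
      proof -
        have "has_bochner_integral lborel (\<lambda>x. normal_density (?m i) 1 x * (x - ?m i) ^ (2 * 1)) (fact (2 * 1) / ((2 / 1\<^sup>2) ^ 1 * fact 1))"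
          by (rule normal_moment_even) simp
        then have h: "has_bochner_integral lborel (\<lambda>x. normal_density (?m i) 1 x * (x - ?m i)\<^sup>2) 1"
          by simp
        have "(\<integral>\<^sup>+ x. ennreal ((x - ?m i)\<^sup>2) \<partial>?N i) = (\<integral>\<^sup>+ x. ennreal (normal_density (?m i) 1 x * (x - ?m i)\<^sup>2) \<partial>lborel)"
          by (subst nn_integral_density) (auto simp: ennreal_mult normal_density_nonneg)
        also have "\<dots> = ennreal 1"
          using h by (subst nn_integral_eq_integral) (auto simp: has_bochner_integral_iff normal_density_nonneg)
        finally show ?thesis .
      qed
      also have "ennreal 2 * ennreal 1 + ennreal (2 * (?m i)\<^sup>2) = ennreal (2 + 2 * (?m i)\<^sup>2)"
        by (subst ennreal_plus) simp_all
      finally show ?thesis .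
    qed
    have "(\<integral>\<^sup>+ x. ennreal x \<partial>noncentral_chi_square d \<xi>) = (\<integral>\<^sup>+ z. (\<Sum>i<d. ennreal ((z i)\<^sup>2)) \<partial>?P)"
      unfolding def by (subst nn_integral_distr) (auto simp: sum_ennreal)
    also have "\<dots> = (\<Sum>i<d. \<integral>\<^sup>+ z. ennreal ((z i)\<^sup>2) \<partial>?P)"
      by (subst nn_integral_sum) (auto intro!: measurable_compose[OF measurable_component_singleton])
    also have "\<dots> = (\<Sum>i<d. \<integral>\<^sup>+ x. ennreal (x\<^sup>2) \<partial>?N i)"
    proof (rule sum.cong[OF refl])
      fix i assume i: "i \<in> {..<d}"
      have "(\<integral>\<^sup>+ z. ennreal ((z i)\<^sup>2) \<partial>?P) = (\<integral>\<^sup>+ x. ennreal (x\<^sup>2) \<partial>distr ?P (?N i) (\<lambda>z. z i))"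
        by (subst nn_integral_distr) (use i in auto)
      then show "(\<integral>\<^sup>+ z. ennreal ((z i)\<^sup>2) \<partial>?P) = (\<integral>\<^sup>+ x. ennreal (x\<^sup>2) \<partial>?N i)"
        using N.PiM_component[of i] i by simp
    qed
    also have "\<dots> \<le> (\<Sum>i<d. ennreal (2 + 2 * (?m i)\<^sup>2))"
      by (intro sum_mono 1)
    also have "\<dots> = ennreal (\<Sum>i<d. 2 + 2 * (?m i)\<^sup>2)"
      by (rule sum_ennreal) auto
    also have "(\<Sum>i<d. 2 + 2 * (?m i)\<^sup>2) \<le> 2 * real d + 2 * \<xi>"
    proof -
      have "(\<Sum>i<d. (?m i)\<^sup>2) = (\<Sum>i<d. if i = 0 then \<xi> else 0)"
        using \<xi> by (intro sum.cong) auto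
      also have "\<dots> \<le> \<xi>" using \<xi> by (cases d) auto
      finally show ?thesis by (simp add: sum.distrib flip: sum_distrib_left)
    qed
    finally show ?thesis by (simp add: ennreal_leI)
  qed
qed

text \<open>Convergence of the series of means makes the random series converge almost surely, so
  that \<open>suminf\<close> in the definition is a genuine sum. The Laplace transform is then the
  limit of those of the partial sums.\<close>

lemma weighted_chi_square_facts:
  assumes w: "\<And>k. w k \<ge> 0" and \<xi>: "\<And>k. \<xi> k \<ge> 0"
    and sm: "summable (\<lambda>k. w (Suc k) * (2 * real (d (Suc k)) + 2 * \<xi> (Suc k)))"
  shows "real_distribution (weighted_chi_square w d \<xi>)"
    and "AE x in weighted_chi_square w d \<xi>. 0 \<le> x"
    and "t \<ge> 0 \<Longrightarrow> (\<lambda>K. \<Prod>k<K. \<Prod>i<d (Suc k). gauss_laplace (t * w (Suc k)) (if i = 0 then sqrt (\<xi> (Suc k)) else 0))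
      \<longlonglongrightarrow> (\<integral>x. exp (- (t * x)) \<partial>weighted_chi_square w d \<xi>)"
proof -
  let ?X = "\<lambda>k. noncentral_chi_square (d k) (\<xi> k)"
  let ?P = "PiM {1::nat..} ?X"
  have pX: "prob_space (?X k)" for k
    using noncentral_chi_square_facts(1) real_distribution.axioms(1) by blast
  have sX[measurable_cong]: "sets (?X k) = sets borel" for k
    using noncentral_chi_square_facts(1) real_distribution.events_eq_borel by blast
  interpret X: product_prob_space ?X "{1..}"
    by (simp add: product_prob_space_def product_prob_space_axioms_def product_sigma_finite_def pX prob_space_imp_sigma_finite)
  have comp: "(\<lambda>x. x (Suc k)) \<in> borel_measurable ?P" for k
    using measurable_component_singleton[of "Suc k" "{1..}" ?X] by (simp add: measurable_cong_sets[OF refl sX])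
  have marg: "distr ?P (?X (Suc k)) (\<lambda>x. x (Suc k)) = ?X (Suc k)" for k
    by (rule X.PiM_component) simp
  have comp': "(\<lambda>x. x (Suc k)) \<in> measurable ?P (?X (Suc k))" for k
    by (rule measurable_component_singleton) simp
  have nn: "AE x in ?P. 0 \<le> x (Suc k)" for k
  proof -
    have "AE y in distr ?P (?X (Suc k)) (\<lambda>x. x (Suc k)). 0 \<le> y"
      unfolding marg by (rule noncentral_chi_square_facts(2))
    then show ?thesis by (subst (asm) AE_distr_iff[OF comp']) auto
  qed
  have nn': "AE x in ?P. \<forall>k. 0 \<le> x (Suc k)" using nn by (simp add: AE_all_countable)
  have "(\<integral>\<^sup>+ x. (\<Sum>k. ennreal (w (Suc k) * x (Suc k))) \<partial>?P) = (\<Sum>k. \<integral>\<^sup>+ x. ennreal (w (Suc k) * x (Suc k)) \<partial>?P)"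
    using comp by (intro nn_integral_suminf) auto
  also have "\<dots> \<le> (\<Sum>k. ennreal (w (Suc k) * (2 * real (d (Suc k)) + 2 * \<xi> (Suc k))))"
  proof (intro suminf_le summableI)
    fix k
    have "(\<integral>\<^sup>+ x. ennreal (w (Suc k) * x (Suc k)) \<partial>?P) = (\<integral>\<^sup>+ y. ennreal (w (Suc k) * y) \<partial>distr ?P (?X (Suc k)) (\<lambda>x. x (Suc k)))"
      by (rule nn_integral_distr[symmetric, OF comp']) (simp add: measurable_cong_sets[OF sX refl])
    also have "\<dots> = (\<integral>\<^sup>+ y. ennreal (w (Suc k)) * ennreal y \<partial>?X (Suc k))"
      unfolding marg using w by (simp add: ennreal_mult')
    also have "\<dots> = ennreal (w (Suc k)) * (\<integral>\<^sup>+ y. ennreal y \<partial>?X (Suc k))"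
      by (rule nn_integral_cmult) (simp add: measurable_cong_sets[OF sX refl])
    also have "\<dots> \<le> ennreal (w (Suc k)) * ennreal (2 * real (d (Suc k)) + 2 * \<xi> (Suc k))"
      by (intro mult_left_mono noncentral_chi_square_facts(4) \<xi>) simp
    finally show "(\<integral>\<^sup>+ x. ennreal (w (Suc k) * x (Suc k)) \<partial>?P) \<le> ennreal (w (Suc k) * (2 * real (d (Suc k)) + 2 * \<xi> (Suc k)))"
      using w \<xi> by (simp add: ennreal_mult')
  qed
  also have "\<dots> < \<infinity>"
    using sm w \<xi> by (subst suminf_ennreal2) auto
  finally have "AE x in ?P. (\<Sum>k. ennreal (w (Suc k) * x (Suc k))) \<noteq> \<infinity>"
    using comp by (intro nn_integral_PInf_AE) auto
  with nn' have sum: "AE x in ?P. summable (\<lambda>k. w (Suc k) * x (Suc k))"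
    by eventually_elim (auto intro!: summable_suminf_not_top simp: w)
  define Y where "Y x = (\<Sum>k. w (Suc k) * x (Suc k))" for x :: "nat \<Rightarrow> real"
  have Y: "Y \<in> borel_measurable ?P"
    unfolding Y_def using comp by (intro borel_measurable_suminf) auto
  have def: "weighted_chi_square w d \<xi> = distr ?P borel Y"
    by (simp add: weighted_chi_square_def Y_def[abs_def])
  show "real_distribution (weighted_chi_square w d \<xi>)"
    unfolding def by (intro prob_space.real_distribution_distr X.P.prob_space_axioms Y)
  have Ynn: "AE x in ?P. 0 \<le> Y x"
    using nn' sum by eventually_elim (auto simp: Y_def w intro!: suminf_nonneg)
  then show "AE x in weighted_chi_square w d \<xi>. 0 \<le> x"
    unfolding def by (subst AE_distr_iff[OF Y]) auto
  show "(\<lambda>K. \<Prod>k<K. \<Prod>i<d (Suc k). gauss_laplace (t * w (Suc k)) (if i = 0 then sqrt (\<xi> (Suc k)) else 0))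
      \<longlonglongrightarrow> (\<integral>x. exp (- (t * x)) \<partial>weighted_chi_square w d \<xi>)" if t: "t \<ge> 0"
  proof -
    have "(\<lambda>K. \<integral>x. exp (- (t * (\<Sum>k<K. w (Suc k) * x (Suc k)))) \<partial>?P) \<longlonglongrightarrow> (\<integral>x. exp (- (t * Y x)) \<partial>?P)"
    proof (rule integral_dominated_convergence[where w = "\<lambda>_. 1"])
      show "AE x in ?P. (\<lambda>K. exp (- (t * (\<Sum>k<K. w (Suc k) * x (Suc k))))) \<longlonglongrightarrow> exp (- (t * Y x))"
        using sum
      proof eventually_elim
        case (elim x)
        then show ?case unfolding Y_def by (intro tendsto_intros summable_LIMSEQ)
      qed
      show "AE x in ?P. norm (exp (- (t * (\<Sum>k<K. w (Suc k) * x (Suc k))))) \<le> 1" for K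
        using nn' by eventually_elim (use t w in \<open>auto intro!: mult_nonneg_nonneg sum_nonneg\<close>)
      show "integrable ?P (\<lambda>_. 1 :: real)" by (rule X.P.integrable_const)
    qed (use comp Y in auto)
    moreover have "(\<integral>x. exp (- (t * Y x)) \<partial>?P) = (\<integral>x. exp (- (t * x)) \<partial>weighted_chi_square w d \<xi>)"
      unfolding def using Y by (subst integral_distr) auto
    moreover have "(\<integral>x. exp (- (t * (\<Sum>k<K. w (Suc k) * x (Suc k)))) \<partial>?P)
      = (\<Prod>k<K. \<Prod>i<d (Suc k). gauss_laplace (t * w (Suc k)) (if i = 0 then sqrt (\<xi> (Suc k)) else 0))" for K
    proof -
      \<comment> \<open>A partial sum depends on finitely many coordinates; their joint law is a
        finite product, where integrals of products factorise.\<close>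
      let ?J = "Suc ` {..<K}"
      have J: "finite ?J" "?J \<subseteq> {1..}" by auto
      let ?F = "\<lambda>x. (\<Prod>j\<in>?J. exp (- (t * w j * x j)))"
      have F: "?F \<in> borel_measurable (PiM ?J ?X)"
        by (intro borel_measurable_prod) auto
      have "(\<integral>x. exp (- (t * (\<Sum>k<K. w (Suc k) * x (Suc k)))) \<partial>?P) = (\<integral>x. ?F (restrict x ?J) \<partial>?P)"
        by (intro Bochner_Integration.integral_cong refl)
          (simp add: prod.reindex exp_sum sum_distrib_left mult.assoc flip: sum_negf)
      also have "\<dots> = (\<integral>x. ?F x \<partial>distr ?P (PiM ?J ?X) (\<lambda>x. restrict x ?J))"
        by (rule integral_distr[symmetric, OF _ F]) (rule measurable_restrict_subset[OF J(2)])
      also have "\<dots> = (\<integral>x. ?F x \<partial>PiM ?J ?X)"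
        unfolding X.distr_PiM_restrict_finite[OF J] ..
      also have "\<dots> = (\<Prod>j\<in>?J. \<integral>y. exp (- (t * w j * y)) \<partial>?X j)"
      proof (rule X.product_integral_prod[OF J(1)])
        fix j
        show "integrable (?X j) (\<lambda>y. exp (- (t * w j * y)))"
        proof (rule finite_measure.integrable_const_bound[OF prob_space.finite_measure[OF pX], of _ 1])
          show "AE y in ?X j. norm (exp (- (t * w j * y))) \<le> 1"
            using noncentral_chi_square_facts(2) by eventually_elim (use t w in \<open>auto intro!: mult_nonneg_nonneg\<close>)
        qed simp
      qed
      also have "\<dots> = (\<Prod>k<K. \<Prod>i<d (Suc k). gauss_laplace (t * w (Suc k)) (if i = 0 then sqrt (\<xi> (Suc k)) else 0))"
        using t w by (simp add: prod.reindex noncentral_chi_square_facts(3))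
      finally show ?thesis .
    qed
    ultimately show ?thesis by simp
  qed
qed

subsection \<open>Local alternatives\<close>

lemma second_moment_sum_PiM:
  fixes g :: "'a \<Rightarrow> real"
  assumes M: "prob_space M" and g: "g \<in> borel_measurable M" and B: "\<And>x. x \<in> space M \<Longrightarrow> \<bar>g x\<bar> \<le> B"
  shows "integrable (PiM {1..n::nat} (\<lambda>_. M)) (\<lambda>u. (\<Sum>j=1..n. g (u j))\<^sup>2)"
    and "(\<integral>u. (\<Sum>j=1..n. g (u j))\<^sup>2 \<partial>PiM {1..n} (\<lambda>_. M))
      = real n * (\<integral>x. (g x)\<^sup>2 \<partial>M) + real n * (real n - 1) * (\<integral>x. g x \<partial>M)\<^sup>2"
proof -
  interpret M: prob_space M by fact
  let ?P = "PiM {1..n} (\<lambda>_. M)"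
  interpret P: product_prob_space "\<lambda>_. M" "{1..n}" ..
  have int1: "integrable M g"
    by (rule M.integrable_const_bound[of _ B]) (use g B in \<open>auto intro!: AE_I2\<close>)
  have B0: "B \<ge> 0" using B M.not_empty by (metis abs_ge_zero all_not_in_conv order_trans)
  have comp: "(\<lambda>u. u j) \<in> measurable ?P M" if "j \<in> {1..n}" for j
    using that by (rule measurable_component_singleton)
  have gm: "(\<lambda>u. g (u j)) \<in> borel_measurable ?P" if "j \<in> {1..n}" for j
    by (rule measurable_compose[OF comp[OF that] g])
  have int: "integrable ?P (\<lambda>u. g (u i) * g (u j))" if ij: "i \<in> {1..n}" "j \<in> {1..n}" for i j
  proof (rule P.P.integrable_const_bound[of _ "B * B"])
    show "AE u in ?P. norm (g (u i) * g (u j)) \<le> B * B"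
    proof (rule AE_I2)
      fix u assume "u \<in> space ?P"
      then have "u i \<in> space M" "u j \<in> space M" using ij by (auto simp: space_PiM)
      then show "norm (g (u i) * g (u j)) \<le> B * B"
        using B0 by (auto simp: abs_mult intro!: mult_mono B)
    qed
  qed (use gm ij in auto)
  have sq: "(\<Sum>j=1..n. g (u j))\<^sup>2 = (\<Sum>i=1..n. \<Sum>j=1..n. g (u i) * g (u j))" for u
    by (simp add: power2_eq_square sum_product)
  show "integrable ?P (\<lambda>u. (\<Sum>j=1..n. g (u j))\<^sup>2)"
    unfolding sq by (intro Bochner_Integration.integrable_sum int)
  have e: "(\<integral>u. g (u i) * g (u j) \<partial>?P) = (\<integral>x. g x \<partial>M)\<^sup>2 + (if i = j then (\<integral>x. (g x)\<^sup>2 \<partial>M) - (\<integral>x. g x \<partial>M)\<^sup>2 else 0)"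
    if ij: "i \<in> {1..n}" "j \<in> {1..n}" for i j
  proof (cases "i = j")
    case True
    have "(\<integral>u. g (u i) * g (u i) \<partial>?P) = (\<integral>x. g x * g x \<partial>distr ?P M (\<lambda>u. u i))"
      using g by (subst integral_distr[OF comp[OF ij(1)]]) auto
    then show ?thesis using True P.PiM_component[OF ij(1)] by (simp add: power2_eq_square)
  next
    case False
    \<comment> \<open>Filling up with the constant 1 makes the product of two factors a product over
      all indices.\<close>
    let ?h = "\<lambda>l x. if l \<in> {i, j} then g x else 1"
    have "(\<Prod>l\<in>{1..n}. ?h l (u l)) = (\<Prod>l\<in>{i, j}. g (u l))" for u
      using ij by (intro prod.mono_neutral_cong_right) auto
    then have "(\<integral>u. g (u i) * g (u j) \<partial>?P) = (\<integral>u. (\<Prod>l\<in>{1..n}. ?h l (u l)) \<partial>?P)"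
      using False by simp
    also have "\<dots> = (\<Prod>l\<in>{1..n}. \<integral>x. ?h l x \<partial>M)"
    proof (rule P.product_integral_prod)
      show "integrable M (?h l)" for l
        by (cases "l \<in> {i, j}") (use int1 in auto)
    qed simp
    also have "\<dots> = (\<Prod>l\<in>{i, j}. \<integral>x. g x \<partial>M)"
      using ij by (intro prod.mono_neutral_cong_right) (auto simp: M.prob_space)
    finally show ?thesis using False by (simp add: power2_eq_square)
  qed
  have "(\<integral>u. (\<Sum>j=1..n. g (u j))\<^sup>2 \<partial>?P) = (\<Sum>i=1..n. \<Sum>j=1..n. \<integral>u. g (u i) * g (u j) \<partial>?P)"
    unfolding sq
    by (subst Bochner_Integration.integral_sum, intro Bochner_Integration.integrable_sum int, assumption+)
      (intro sum.cong refl Bochner_Integration.integral_sum int)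
  also have "\<dots> = (\<Sum>i=1..n. \<Sum>j=1..n. (\<integral>x. g x \<partial>M)\<^sup>2 + (if i = j then (\<integral>x. (g x)\<^sup>2 \<partial>M) - (\<integral>x. g x \<partial>M)\<^sup>2 else 0))"
    by (intro sum.cong refl e)
  also have "\<dots> = real n * (real n * (\<integral>x. g x \<partial>M)\<^sup>2) + real n * ((\<integral>x. (g x)\<^sup>2 \<partial>M) - (\<integral>x. g x \<partial>M)\<^sup>2)"
    by (simp add: sum.distrib distrib_left)
  finally show "(\<integral>u. (\<Sum>j=1..n. g (u j))\<^sup>2 \<partial>?P)
      = real n * (\<integral>x. (g x)\<^sup>2 \<partial>M) + real n * (real n - 1) * (\<integral>x. g x \<partial>M)\<^sup>2"
    by (simp add: algebra_simps)
qed

text \<open>C * \<delta> \<le> 1/2 together with \<kappa> n \<le> \<delta> keeps every density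
  within 1/2 of the constant 1, so each \<open>M n\<close> is a probability measure, not only those
  for large n.\<close>

locale rotsym_array =
  fixes f :: "real \<Rightarrow> real" and K :: nat and \<kappa> :: "nat \<Rightarrow> real" and \<delta> C :: real
    and M :: "nat \<Rightarrow> (real ^ 'p::{finite,linorder}) measure"
  assumes p: "CARD('p) \<ge> 2" and K: "K \<ge> 1" and angular: "angular_function f"
    and near1: "\<And>x. \<bar>x\<bar> \<le> \<delta> \<Longrightarrow> \<bar>f x - 1\<bar> \<le> C * \<bar>x\<bar>"
    and taylor: "\<And>x. \<bar>x\<bar> \<le> \<delta> \<Longrightarrow> \<bar>f x - (\<Sum>b\<le>K. (deriv ^^ b) f 0 / fact b * x ^ b)\<bar> \<le> C * \<bar>x\<bar> ^ Suc K"
    and C: "C \<ge> 0" "C * \<delta> \<le> 1 / 2"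
    and kappa: "\<And>n. 0 < \<kappa> n" "\<And>n. \<kappa> n \<le> \<delta>" "\<kappa> \<longlonglongrightarrow> 0"
    and M_def: "\<And>n. M n = rotsym_law (\<kappa> n) f"
begin

definition dens :: "nat \<Rightarrow> real ^ 'p::{finite,linorder} \<Rightarrow> real" where
  "dens n u = f (\<kappa> n * (u \<bullet> theta0))"

definition mass :: "nat \<Rightarrow> real" where
  "mass n = (\<integral>u. dens n u \<partial>uniform_sphere)"

lemma bound_half: "\<bar>x\<bar> \<le> \<kappa> n \<Longrightarrow> \<bar>f x - 1\<bar> \<le> 1 / 2"
  using near1[of x] kappa(2)[of n] C mult_left_mono[of "\<bar>x\<bar>" \<delta> C] by linarith

lemma dens_eq: "dens n = (\<lambda>u. f (\<kappa> n * (u \<bullet> theta0)))"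
  by (simp add: dens_def fun_eq_iff)

lemma law:
  shows "sets (M n) = sets uniform_sphere" "prob_space (M n)" "integrable uniform_sphere (dens n)" "1 / 2 \<le> mass n"
    and "g \<in> borel_measurable uniform_sphere \<Longrightarrow> (\<integral>u. g u \<partial>M n) = (\<integral>u. g u * dens n u \<partial>uniform_sphere) / mass n"
proof -
  have b: "\<And>x. \<bar>x\<bar> \<le> \<kappa> n \<Longrightarrow> \<bar>f x - 1\<bar> \<le> 1 / 2" by (rule bound_half)
  note F = rotsym_law_facts[OF dens_eq[of n] angular _ less_imp_le[OF kappa(1)], folded M_def mass_def]
  show "sets (M n) = sets uniform_sphere" by (rule F(1)) (rule b)
  show "prob_space (M n)" by (rule F(2)) (rule b)
  show "integrable uniform_sphere (dens n)" by (rule F(3)) (rule b)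
  show "1 / 2 \<le> mass n" by (rule F(4)) (rule b)
  show "(\<integral>u. g u \<partial>M n) = (\<integral>u. g u * dens n u \<partial>uniform_sphere) / mass n" if "g \<in> borel_measurable uniform_sphere"
    using that by (intro F(5) b)
qed

lemma sets_M: "sets (M n) = sets uniform_sphere"
  by (rule law(1))

lemma space_M [simp]: "space (M n) = sphere 0 1"
  using sets_eq_imp_space_eq[OF sets_M] by simp

lemma measurable_M: "g \<in> borel_measurable uniform_sphere \<Longrightarrow> g \<in> borel_measurable (M n)"
  by (simp add: measurable_cong_sets[OF sets_M refl])

lemma dens_measurable: "dens n \<in> borel_measurable uniform_sphere"
  using law(3) by blast

lemma arg_bound: "norm u = 1 \<Longrightarrow> \<bar>\<kappa> n * (u \<bullet> (theta0 :: real ^ 'p::{finite,linorder}))\<bar> \<le> \<kappa> n"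
  using abs_inner_unit[of u "theta0 :: real ^ 'p::{finite,linorder}"] kappa(1)[of n] by (simp add: abs_mult mult_left_le)

lemma dens_near1: "norm u = 1 \<Longrightarrow> \<bar>dens n u - 1\<bar> \<le> C * \<kappa> n"
  using near1[of "\<kappa> n * (u \<bullet> theta0)"] arg_bound[of u n] kappa(2)[of n] C(1)
    mult_left_mono[of "\<bar>\<kappa> n * (u \<bullet> theta0)\<bar>" "\<kappa> n" C]
  unfolding dens_def by linarith

lemma continuous_bounded_sphere:
  assumes "continuous_on UNIV (g :: real ^ 'p::{finite,linorder} \<Rightarrow> real)"
  obtains B where "B > 0" "\<And>u. norm u = 1 \<Longrightarrow> \<bar>g u\<bar> \<le> B"
proof -
  have "compact (g ` sphere 0 1)"
    by (intro compact_continuous_image continuous_on_subset[OF assms]) auto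
  then obtain B where B: "B > 0" "\<forall>y\<in>g ` sphere 0 1. norm y \<le> B"
    using compact_imp_bounded bounded_pos by metis
  then show thesis by (intro that[of B]) auto
qed

lemma integrable_dens:
  assumes "continuous_on UNIV (g :: real ^ 'p::{finite,linorder} \<Rightarrow> real)"
  shows "integrable uniform_sphere (\<lambda>u. g u * dens n u)"
proof -
  obtain B where B: "B > 0" "\<And>u. norm u = 1 \<Longrightarrow> \<bar>g u\<bar> \<le> B"
    using continuous_bounded_sphere[OF assms] by blast
  have "integrable uniform_sphere (\<lambda>u. B * dens n u)" using law(3)[of n] by simp
  then show ?thesis
  proof (rule Bochner_Integration.integrable_bound)
    show "(\<lambda>u. g u * dens n u) \<in> borel_measurable uniform_sphere"
      using dens_measurable[of n] borel_measurable_uniform_sphere[OF borel_measurable_continuous_onI[OF assms]] by simp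
    show "AE u in uniform_sphere. norm (g u * dens n u) \<le> norm (B * dens n u)"
      using B by (intro AE_I2) (auto simp: abs_mult intro!: mult_right_mono)
  qed
qed

lemma integral_dens_limit:
  assumes g: "continuous_on UNIV (g :: real ^ 'p::{finite,linorder} \<Rightarrow> real)"
  shows "(\<lambda>n. \<integral>u. g u * dens n u \<partial>uniform_sphere) \<longlonglongrightarrow> (\<integral>u. g u \<partial>uniform_sphere)"
proof -
  obtain B where B: "B > 0" "\<And>u. norm u = 1 \<Longrightarrow> \<bar>g u\<bar> \<le> B"
    using continuous_bounded_sphere[OF g] by blast
  have "(\<lambda>n. (\<integral>u. g u * dens n u \<partial>uniform_sphere) - (\<integral>u. g u \<partial>uniform_sphere)) \<longlonglongrightarrow> 0"
  proof (rule Lim_null_comparison)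
    show "(\<lambda>n. B * (C * \<kappa> n)) \<longlonglongrightarrow> 0" using kappa(3) by (auto intro!: tendsto_eq_intros)
    show "\<forall>\<^sub>F n in sequentially. norm ((\<integral>u. g u * dens n u \<partial>uniform_sphere) - (\<integral>u. g u \<partial>uniform_sphere)) \<le> B * (C * \<kappa> n)"
    proof (intro always_eventually allI)
      fix n
      have ig: "integrable uniform_sphere g" by (rule integrable_uniform_sphere[OF g])
      have "(\<integral>u. g u * dens n u \<partial>uniform_sphere) - (\<integral>u. g u \<partial>uniform_sphere) = (\<integral>u. g u * dens n u - g u \<partial>uniform_sphere)"
        by (rule Bochner_Integration.integral_diff[symmetric, OF integrable_dens[OF g] ig])
      also have "norm \<dots> \<le> (\<integral>u. norm (g u * dens n u - g u) \<partial>uniform_sphere)"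
        by (rule integral_norm_bound)
      also have "\<dots> \<le> (\<integral>u. B * (C * \<kappa> n) \<partial>(uniform_sphere :: (real ^ 'p::{finite,linorder}) measure))"
      proof (rule integral_mono)
        fix u :: "real ^ 'p::{finite,linorder}" assume "u \<in> space uniform_sphere"
        then have u: "norm u = 1" by simp
        have "norm (g u * dens n u - g u) = \<bar>g u\<bar> * \<bar>dens n u - 1\<bar>"
          unfolding real_norm_def abs_mult[symmetric] by (simp add: algebra_simps)
        also have "\<dots> \<le> B * (C * \<kappa> n)"
          using B(1) by (intro mult_mono B(2)[OF u] dens_near1[OF u]) auto
        finally show "norm (g u * dens n u - g u) \<le> B * (C * \<kappa> n)" .
      qed (use integrable_dens[OF g, of n] ig in auto)
      also have "\<dots> = B * (C * \<kappa> n)" by (simp add: uniform_sphere.prob_space[simplified])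
      finally show "norm ((\<integral>u. g u * dens n u \<partial>uniform_sphere) - (\<integral>u. g u \<partial>uniform_sphere)) \<le> B * (C * \<kappa> n)" .
    qed
  qed
  then show ?thesis by (simp add: LIM_zero_iff)
qed

lemma mass_limit: "mass \<longlonglongrightarrow> 1"
  using integral_dens_limit[of "\<lambda>_. 1"] by (simp add: mass_def[abs_def] uniform_sphere.prob_space[simplified])

lemma mean_M:
  assumes "continuous_on UNIV (g :: real ^ 'p::{finite,linorder} \<Rightarrow> real)"
  shows "(\<integral>u. g u \<partial>M n) = (\<integral>u. g u * dens n u \<partial>uniform_sphere) / mass n"
  by (rule law(5)) (intro borel_measurable_uniform_sphere borel_measurable_continuous_onI assms)

lemma mean_limit:
  assumes "continuous_on UNIV (g :: real ^ 'p::{finite,linorder} \<Rightarrow> real)"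
  shows "(\<lambda>n. \<integral>u. g u \<partial>M n) \<longlonglongrightarrow> (\<integral>u. g u \<partial>uniform_sphere)"
  unfolding mean_M[OF assms]
  using tendsto_divide[OF integral_dens_limit[OF assms] mass_limit] by simp

text \<open>The Taylor coefficient, derivative over \<open>fact K\<close>, times the constant
  \<open>fact K / sphere_weight\<close> with which harmonics of degree \<open>K\<close> integrate
  against the \<open>K\<close>-th power.\<close>

definition drift :: "nat \<Rightarrow> real" where
  "drift k = (if k = K then (deriv ^^ K) f 0 / sphere_weight CARD('p) K else 0)"

text \<open>Only the term of order K of the Taylor expansion of f sees harmonics of degree at least K.\<close>

lemma mean_expansion:
  assumes g: "g \<in> zonal_span k" and k: "k \<ge> K" and norm: "(\<integral>u. (g u)\<^sup>2 \<partial>uniform_sphere) \<le> 1"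
  shows "\<bar>(\<integral>u. g u * dens n u \<partial>uniform_sphere) - drift k * \<kappa> n ^ K * g theta0\<bar> \<le> C * \<kappa> n ^ Suc K"
proof -
  let ?T = "\<lambda>u :: real ^ 'p::{finite,linorder}. (\<Sum>b\<le>K. (deriv ^^ b) f 0 / fact b * (\<kappa> n * (u \<bullet> theta0)) ^ b)"
  have gc: "continuous_on UNIV g" by (rule zonal_span_continuous[OF g])
  have gT: "(\<integral>u. g u * ?T u \<partial>uniform_sphere) = drift k * \<kappa> n ^ K * g theta0"
  proof -
    have "(\<integral>u. g u * ?T u \<partial>uniform_sphere) = (\<integral>u. (\<Sum>b\<le>K. (deriv ^^ b) f 0 / fact b * \<kappa> n ^ b * (g u * (u \<bullet> theta0) ^ b)) \<partial>uniform_sphere)"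
      by (simp add: sum_distrib_left power_mult_distrib mult_ac)
    also have "\<dots> = (\<Sum>b\<le>K. (deriv ^^ b) f 0 / fact b * \<kappa> n ^ b * (\<integral>u. g u * (u \<bullet> theta0) ^ b \<partial>uniform_sphere))"
      by (subst Bochner_Integration.integral_sum) (auto intro!: integrable_uniform_sphere continuous_intros gc)
    \<comment> \<open>Since b \<le> K \<le> k, a nonzero contribution needs b = k and therefore k =
      K.\<close>
    also have "\<dots> = (\<Sum>b\<le>K. if b = k then drift k * \<kappa> n ^ K * g theta0 else 0)"
    proof (rule sum.cong[OF refl])
      fix b assume b: "b \<in> {..K}"
      have "(\<integral>u. g u * (u \<bullet> theta0) ^ b \<partial>uniform_sphere) = (if b = k then fact k / sphere_weight CARD('p) k else 0) * g theta0"
        using b k K by (intro zonal_span_power[OF p _ _ _ g]) auto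
      then show "(deriv ^^ b) f 0 / fact b * \<kappa> n ^ b * (\<integral>u. g u * (u \<bullet> theta0) ^ b \<partial>uniform_sphere) = (if b = k then drift k * \<kappa> n ^ K * g theta0 else 0)"
        using b k by (auto simp: drift_def)
    qed
    also have "\<dots> = drift k * \<kappa> n ^ K * g theta0"
      using k by (auto simp: drift_def)
    finally show ?thesis .
  qed
  have iT: "integrable uniform_sphere (\<lambda>u. g u * ?T u)"
    by (intro integrable_uniform_sphere continuous_intros gc)
  have "(\<integral>u. g u * dens n u \<partial>uniform_sphere) - drift k * \<kappa> n ^ K * g theta0 = (\<integral>u. g u * dens n u - g u * ?T u \<partial>uniform_sphere)"
    unfolding gT[symmetric] by (rule Bochner_Integration.integral_diff[symmetric, OF integrable_dens[OF gc] iT])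
  also have "\<dots> = (\<integral>u. g u * (dens n u - ?T u) \<partial>uniform_sphere)" by (simp add: right_diff_distrib)
  also have "\<bar>\<dots>\<bar> \<le> C * \<kappa> n ^ Suc K"
  proof (rule integral_diff_bound[OF prob_space_uniform_sphere _ zonal_span_measurable[OF g] _ _ norm])
    show "integrable uniform_sphere (\<lambda>u. (g u)\<^sup>2)"
      by (intro integrable_uniform_sphere continuous_intros gc)
    show "(\<lambda>u. dens n u - ?T u) \<in> borel_measurable uniform_sphere"
      by (rule borel_measurable_diff[OF dens_measurable])
        (intro borel_measurable_uniform_sphere borel_measurable_continuous_onI continuous_intros)
    fix u :: "real ^ 'p::{finite,linorder}" assume "u \<in> space uniform_sphere"
    then have "\<bar>\<kappa> n * (u \<bullet> theta0)\<bar> \<le> \<kappa> n" by (intro arg_bound) simp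
    moreover from this have "\<bar>dens n u - ?T u\<bar> \<le> C * \<bar>\<kappa> n * (u \<bullet> theta0)\<bar> ^ Suc K"
      unfolding dens_def using kappa(2)[of n] by (intro taylor) simp
    ultimately show "\<bar>dens n u - ?T u\<bar> \<le> C * \<kappa> n ^ Suc K"
      using C(1) by (meson abs_ge_zero mult_left_mono order_trans power_mono)
  qed
  finally show ?thesis .
qed

lemma mass_ge: "1 / 2 \<le> mass n"
  by (rule law(4))

text \<open>Without drift only the Taylor remainder is left; the factor 2 pays for
  \<open>mass n\<close> \<ge> 1/2. The bound does not depend on k, which the control of the tail of
  the statistic relies on.\<close>

lemma mean_bias:
  assumes g: "g \<in> zonal_span k" and k: "k > K" and norm: "(\<integral>u. (g u)\<^sup>2 \<partial>uniform_sphere) \<le> 1"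
  shows "\<bar>\<integral>u. g u \<partial>M n\<bar> \<le> 2 * C * \<kappa> n ^ Suc K"
proof -
  have "\<bar>\<integral>u. g u * dens n u \<partial>uniform_sphere\<bar> \<le> C * \<kappa> n ^ Suc K"
    using mean_expansion[OF g _ norm, of n] k by (simp add: drift_def)
  moreover have "C * \<kappa> n ^ Suc K \<le> 2 * C * \<kappa> n ^ Suc K * mass n"
  proof -
    have "0 \<le> C * \<kappa> n ^ Suc K" using C(1) kappa(1)[of n] by simp
    then show ?thesis using mult_left_mono[OF mass_ge[of n], of "C * \<kappa> n ^ Suc K"] by (simp add: mult_ac)
  qed
  ultimately show ?thesis
    using mass_ge[of n] unfolding mean_M[OF zonal_span_continuous[OF g]] by (simp add: abs_divide divide_le_eq)
qed

text \<open>The remainder contributes at most C sqrt n \<kappa>^(K+1), which tends to 0 because sqrt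
  n \<kappa>^K converges and \<kappa> tends to 0.\<close>

lemma drift_limit:
  assumes g: "g \<in> zonal_span k" and k: "k \<ge> K" and norm: "(\<integral>u. (g u)\<^sup>2 \<partial>uniform_sphere) \<le> 1"
    and c: "(\<lambda>n. sqrt n * \<kappa> n ^ K) \<longlonglongrightarrow> c"
  shows "(\<lambda>n. sqrt n * (\<integral>u. g u \<partial>M n)) \<longlonglongrightarrow> drift k * c * g theta0"
proof -
  let ?I = "\<lambda>n. \<integral>u. g u * dens n u \<partial>uniform_sphere"
  have "(\<lambda>n. sqrt n * (?I n - drift k * \<kappa> n ^ K * g theta0)) \<longlonglongrightarrow> 0"
  proof (rule Lim_null_comparison)
    show "(\<lambda>n. C * (sqrt n * \<kappa> n ^ K) * \<kappa> n) \<longlonglongrightarrow> 0"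
      using tendsto_mult[OF tendsto_mult[OF tendsto_const[of C] c] kappa(3)] by simp
    show "\<forall>\<^sub>F n in sequentially. norm (sqrt n * (?I n - drift k * \<kappa> n ^ K * g theta0)) \<le> C * (sqrt n * \<kappa> n ^ K) * \<kappa> n"
    proof (intro always_eventually allI)
      fix n :: nat
      have "norm (sqrt n * (?I n - drift k * \<kappa> n ^ K * g theta0)) \<le> sqrt n * (C * \<kappa> n ^ Suc K)"
        using mean_expansion[OF g k norm, of n] by (simp add: abs_mult mult_left_mono)
      then show "norm (sqrt n * (?I n - drift k * \<kappa> n ^ K * g theta0)) \<le> C * (sqrt n * \<kappa> n ^ K) * \<kappa> n"
        by (simp add: mult_ac)
    qed
  qed
  moreover have "(\<lambda>n. drift k * (sqrt n * \<kappa> n ^ K) * g theta0) \<longlonglongrightarrow> drift k * c * g theta0"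
    by (intro tendsto_intros c)
  ultimately have "(\<lambda>n. sqrt n * (?I n - drift k * \<kappa> n ^ K * g theta0) + drift k * (sqrt n * \<kappa> n ^ K) * g theta0) \<longlonglongrightarrow> 0 + drift k * c * g theta0"
    by (rule tendsto_add)
  then have "(\<lambda>n. sqrt n * ?I n) \<longlonglongrightarrow> drift k * c * g theta0"
    by (simp add: algebra_simps)
  from tendsto_divide[OF this mass_limit] show ?thesis
    unfolding mean_M[OF zonal_span_continuous[OF g]] by simp
qed

end

subsection \<open>The Sobolev statistic\<close>

text \<open>The means enter through the sum of their squares only. This permits replacing the mean
  vector of the harmonics by one concentrated in coordinate 0, as in the definition of the
  non-central law.\<close>

lemma prod_gauss_laplace:
  "(\<Prod>i<d. gauss_laplace \<alpha> (m i)) = exp (- \<alpha> * (\<Sum>i<d. (m i)\<^sup>2) / (1 + 2 * \<alpha>)) / sqrt (1 + 2 * \<alpha>) ^ d"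
proof -
  have "(\<Sum>i<d. - \<alpha> * (m i)\<^sup>2 / (1 + 2 * \<alpha>)) = - \<alpha> * (\<Sum>i<d. (m i)\<^sup>2) / (1 + 2 * \<alpha>)"
    by (simp add: sum_distrib_left sum_divide_distrib)
  then show ?thesis by (simp add: gauss_laplace_def prod_dividef exp_sum[symmetric])
qed

text \<open>The truncation error \<open>e N\<close> is uniform in n, so the truncation level can be
  fixed before n grows.\<close>

lemma interchange_limits:
  fixes a :: "nat \<Rightarrow> nat \<Rightarrow> real"
  assumes ab: "\<And>N. (\<lambda>n. a n N) \<longlonglongrightarrow> b N" and b: "b \<longlonglongrightarrow> l" and e: "e \<longlonglongrightarrow> 0"
    and le: "\<And>n N. n \<ge> 1 \<Longrightarrow> N \<ge> N0 \<Longrightarrow> \<bar>s n - a n N\<bar> \<le> e N"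
  shows "s \<longlonglongrightarrow> l"
proof (rule LIMSEQ_I)
  fix r :: real assume r: "r > 0"
  obtain N1 where N1: "\<And>N. N \<ge> N1 \<Longrightarrow> norm (b N - l) < r / 3" using LIMSEQ_D[OF b, of "r / 3"] r by auto
  obtain N2 where N2: "\<And>N. N \<ge> N2 \<Longrightarrow> norm (e N - 0) < r / 3" using LIMSEQ_D[OF e, of "r / 3"] r by auto
  define N where "N = Max {N0, N1, N2}"
  have N: "N \<ge> N0" "N \<ge> N1" "N \<ge> N2" by (auto simp: N_def)
  obtain n0 where n0: "\<And>n. n \<ge> n0 \<Longrightarrow> norm (a n N - b N) < r / 3" using LIMSEQ_D[OF ab[of N], of "r / 3"] r by auto
  have "norm (s n - l) < r" if "n \<ge> max 1 n0" for n
  proof -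
    have "\<bar>s n - a n N\<bar> \<le> e N" using le[of n N] N(1) that by simp
    moreover have "\<bar>e N\<bar> < r / 3" using N2[OF N(3)] by simp
    moreover have "\<bar>a n N - b N\<bar> < r / 3" using n0[of n] that by simp
    moreover have "\<bar>b N - l\<bar> < r / 3" using N1[OF N(2)] by simp
    ultimately show ?thesis unfolding real_norm_def by linarith
  qed
  then show "\<exists>no. \<forall>n\<ge>no. norm (s n - l) < r" by blast
qed

locale sobolev_array = rotsym_array f K \<kappa> \<delta> C M
  for f K \<kappa> \<delta> C and M :: "nat \<Rightarrow> (real ^ 'p::{finite,linorder}) measure" +
  fixes v :: "nat \<Rightarrow> real" and g :: "nat \<Rightarrow> nat \<Rightarrow> real ^ 'p::{finite,linorder} \<Rightarrow> real" and d :: "nat \<Rightarrow> nat"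
  assumes d_def: "d = d_const CARD('p)"
    and vK: "v K \<noteq> 0" and v0: "\<And>k. 1 \<le> k \<Longrightarrow> k < K \<Longrightarrow> v k = 0"
    and v_summable: "summable (\<lambda>k. (v (Suc k))\<^sup>2 * real (d (Suc k)))"
    and g_span: "\<And>k i. k \<ge> 1 \<Longrightarrow> i < d k \<Longrightarrow> g k i \<in> zonal_span k"
    and g_orthonormal: "\<And>k i l j. k \<ge> 1 \<Longrightarrow> l \<ge> 1 \<Longrightarrow> i < d k \<Longrightarrow> j < d l \<Longrightarrow>
      (\<integral>x. g k i x * g l j x \<partial>uniform_sphere) = (if k = l \<and> i = j then 1 else 0)"
    and addition: "\<And>k x z. k \<ge> 1 \<Longrightarrow> norm x = 1 \<Longrightarrow> norm z = 1 \<Longrightarrow> h_fun CARD('p) k (x \<bullet> z) = (\<Sum>i<d k. g k i x * g k i z)"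
begin

section \<open>The statistic as a weighted series of squares\<close>

definition P :: "nat \<Rightarrow> (nat \<Rightarrow> real ^ 'p::{finite,linorder}) measure" where
  "P n = PiM {1..n} (\<lambda>_. M n)"

definition Q :: "nat \<Rightarrow> nat \<Rightarrow> (nat \<Rightarrow> real ^ 'p::{finite,linorder}) \<Rightarrow> real" where
  "Q k n u = (\<Sum>i<d k. ((\<Sum>j=1..n. g k i (u j)) / sqrt n)\<^sup>2)"

lemma prob_space_M: "prob_space (M n)"
  by (rule law(2))

lemma prob_space_P: "prob_space (P n)"
  unfolding P_def by (intro prob_space_PiM prob_space_M)

lemma space_P: "u \<in> space (P n) \<Longrightarrow> j \<in> {1..n} \<Longrightarrow> norm (u j) = 1"
  by (auto simp: P_def space_PiM dest: PiE_mem)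

lemma g_continuous: "k \<ge> 1 \<Longrightarrow> i < d k \<Longrightarrow> continuous_on UNIV (g k i)"
  by (rule zonal_span_continuous[OF g_span])

lemma g_measurable: "k \<ge> 1 \<Longrightarrow> i < d k \<Longrightarrow> g k i \<in> borel_measurable (M n)"
  by (rule measurable_M[OF zonal_span_measurable[OF g_span]])

lemma sum_squares: "k \<ge> 1 \<Longrightarrow> norm x = 1 \<Longrightarrow> (\<Sum>i<d k. (g k i x)\<^sup>2) = real (d k)"
proof -
  assume k: "k \<ge> 1" and x: "norm x = 1"
  have "(\<Sum>i<d k. (g k i x)\<^sup>2) = h_fun CARD('p) k (x \<bullet> x)"
    unfolding addition[OF k x x] by (simp add: power2_eq_square)
  also have "x \<bullet> x = 1" using x by (simp add: norm_eq_1)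
  finally show ?thesis using harmonic_poly_at_1[OF p k] by (simp add: poly_harmonic_poly d_def)
qed

text \<open>Cauchy-Schwarz in the addition formula, with both factors equal to d_k. The bound d_k is
  what matches the summability assumption on v.\<close>

lemma h_bound:
  fixes x z :: "real ^ 'p::{finite,linorder}"
  assumes "k \<ge> 1" "norm x = 1" "norm z = 1"
  shows "\<bar>h_fun CARD('p) k (x \<bullet> z)\<bar> \<le> real (d k)"
proof -
  have "(h_fun CARD('p) k (x \<bullet> z))\<^sup>2 \<le> (\<Sum>i<d k. (g k i x)\<^sup>2) * (\<Sum>i<d k. (g k i z)\<^sup>2)"
    unfolding addition[OF assms] by (rule Cauchy_Schwarz_ineq_sum)
  also have "\<dots> = (real (d k))\<^sup>2"
    using sum_squares assms by (simp add: power2_eq_square)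
  finally show ?thesis by (simp add: abs_le_square_iff[symmetric])
qed

lemma g_bound:
  assumes "k \<ge> 1" "i < d k" "norm x = 1"
  shows "\<bar>g k i x\<bar> \<le> sqrt (d k)"
proof -
  have "(g k i x)\<^sup>2 \<le> (\<Sum>i<d k. (g k i x)\<^sup>2)"
    using assms by (intro member_le_sum) auto
  then show ?thesis using sum_squares[OF assms(1,3)] by (simp add: real_le_rsqrt)
qed

lemma Q_nonneg: "Q k n u \<ge> 0"
  by (simp add: Q_def sum_nonneg)

lemma Q_eq:
  assumes "k \<ge> 1" "u \<in> space (P n)"
  shows "1 / real n * (\<Sum>i=1..n. \<Sum>j=1..n. h_fun CARD('p) k (u i \<bullet> u j)) = Q k n u"
proof -
  have "(\<Sum>i=1..n. \<Sum>j=1..n. h_fun CARD('p) k (u i \<bullet> u j)) = (\<Sum>i=1..n. \<Sum>j=1..n. \<Sum>r<d k. g k r (u i) * g k r (u j))"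
    using assms space_P by (intro sum.cong refl addition) auto
  also have "\<dots> = (\<Sum>i=1..n. \<Sum>r<d k. \<Sum>j=1..n. g k r (u i) * g k r (u j))"
    by (intro sum.cong refl sum.swap)
  also have "\<dots> = (\<Sum>r<d k. \<Sum>i=1..n. \<Sum>j=1..n. g k r (u i) * g k r (u j))"
    by (rule sum.swap)
  also have "\<dots> = (\<Sum>r<d k. (\<Sum>j=1..n. g k r (u j))\<^sup>2)"
    by (simp add: power2_eq_square sum_product)
  finally have "1 / real n * (\<Sum>i=1..n. \<Sum>j=1..n. h_fun CARD('p) k (u i \<bullet> u j)) = (\<Sum>r<d k. (\<Sum>j=1..n. g k r (u j))\<^sup>2) / real n"
    by simp
  also have "\<dots> = (\<Sum>r<d k. (\<Sum>j=1..n. g k r (u j))\<^sup>2 / real n)"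
    by (rule sum_divide_distrib)
  also have "\<dots> = Q k n u"
    unfolding Q_def power_divide by simp
  finally show ?thesis .
qed

text \<open>In the definition the series stands inside the double sum. Each inner series converges
  by \<open>h_bound\<close>, so the finite sums may be taken termwise.\<close>

lemma stat_sums:
  assumes "u \<in> space (P n)"
  shows "(\<lambda>k. (v (Suc k))\<^sup>2 * Q (Suc k) n u) sums sobolev_stat v n u"
proof -
  have "(\<lambda>k. (v (Suc k))\<^sup>2 * h_fun CARD('p) (Suc k) (u i \<bullet> u j)) sums (\<Sum>k. (v (Suc k))\<^sup>2 * h_fun CARD('p) (Suc k) (u i \<bullet> u j))"
    if "i \<in> {1..n}" "j \<in> {1..n}" for i j
  proof (intro summable_sums summable_comparison_test'[OF v_summable])
    fix k
    show "norm ((v (Suc k))\<^sup>2 * h_fun CARD('p) (Suc k) (u i \<bullet> u j)) \<le> (v (Suc k))\<^sup>2 * real (d (Suc k))"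
      using h_bound[of "Suc k" "u i" "u j"] space_P[OF assms] that by (auto simp: abs_mult intro!: mult_left_mono)
  qed
  then have "(\<lambda>k. 1 / real n * (\<Sum>i=1..n. \<Sum>j=1..n. (v (Suc k))\<^sup>2 * h_fun CARD('p) (Suc k) (u i \<bullet> u j))) sums sobolev_stat v n u"
    unfolding sobolev_stat_def by (intro sums_mult sums_sum) auto
  moreover have "1 / real n * (\<Sum>i=1..n. \<Sum>j=1..n. (v (Suc k))\<^sup>2 * h_fun CARD('p) (Suc k) (u i \<bullet> u j)) = (v (Suc k))\<^sup>2 * Q (Suc k) n u" for k
  proof -
    have A: "1 / real n * (\<Sum>i=1..n. \<Sum>j=1..n. (v (Suc k))\<^sup>2 * h_fun CARD('p) (Suc k) (u i \<bullet> u j))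
      = (v (Suc k))\<^sup>2 * (1 / real n * (\<Sum>i=1..n. \<Sum>j=1..n. h_fun CARD('p) (Suc k) (u i \<bullet> u j)))"
      unfolding sum_distrib_left[symmetric] by simp
    have q: "1 / real n * (\<Sum>i=1..n. \<Sum>j=1..n. h_fun CARD('p) (Suc k) (u i \<bullet> u j)) = Q (Suc k) n u"
      by (rule Q_eq[OF _ assms]) simp
    show ?thesis unfolding A q ..
  qed
  ultimately show ?thesis by simp
qed

lemma stat_nonneg: "u \<in> space (P n) \<Longrightarrow> sobolev_stat v n u \<ge> 0"
  using stat_sums[of u n] suminf_nonneg[OF sums_summable[OF stat_sums[of u n]]]
  by (simp add: Q_nonneg sums_unique[symmetric])

lemma Q_measurable: "k \<ge> 1 \<Longrightarrow> Q k n \<in> borel_measurable (P n)"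
proof -
  assume k: "k \<ge> 1"
  have "(\<lambda>u. g k i (u j)) \<in> borel_measurable (P n)" if ij: "i < d k" "j \<in> {1..n}" for i j
    unfolding P_def by (rule measurable_compose[OF measurable_component_singleton[OF ij(2)] g_measurable[OF k ij(1)]])
  then show ?thesis
    unfolding Q_def[abs_def]
    by (intro borel_measurable_sum borel_measurable_power borel_measurable_divide borel_measurable_const) auto
qed

definition S :: "nat \<Rightarrow> nat \<Rightarrow> (nat \<Rightarrow> real ^ 'p::{finite,linorder}) \<Rightarrow> real" where
  "S n N u = (\<Sum>k<N. (v (Suc k))\<^sup>2 * Q (Suc k) n u)"

lemma S_measurable: "S n N \<in> borel_measurable (P n)"
  unfolding S_def[abs_def] by (intro borel_measurable_sum borel_measurable_times borel_measurable_const Q_measurable) simp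

lemma S_nonneg: "S n N u \<ge> 0"
  by (simp add: S_def sum_nonneg Q_nonneg)

lemma S_tendsto: "u \<in> space (P n) \<Longrightarrow> (\<lambda>N. S n N u) \<longlonglongrightarrow> sobolev_stat v n u"
  using stat_sums[of u n] by (simp add: sums_def S_def)

lemma stat_measurable: "sobolev_stat v n \<in> borel_measurable (P n)"
  by (rule borel_measurable_LIMSEQ_real[OF S_tendsto S_measurable])

lemma integrable_exp_nonneg:
  fixes X :: "(nat \<Rightarrow> real ^ 'p::{finite,linorder}) \<Rightarrow> real"
  assumes "X \<in> borel_measurable (P n)" "\<And>u. u \<in> space (P n) \<Longrightarrow> X u \<ge> 0" "t \<ge> 0"
  shows "integrable (P n) (\<lambda>u. exp (- (t * X u)))"
proof -
  interpret prob_space "P n" by (rule prob_space_P)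
  show ?thesis
  proof (rule integrable_const_bound[of _ 1])
    show "AE u in P n. norm (exp (- (t * X u))) \<le> 1"
    proof (rule AE_I2)
      fix u assume "u \<in> space (P n)"
      then have "0 \<le> t * X u" using assms(2,3) by simp
      then show "norm (exp (- (t * X u))) \<le> 1" by simp
    qed
    show "(\<lambda>u. exp (- (t * X u))) \<in> borel_measurable (P n)"
      by (rule measurable_compose[OF assms(1)]) simp
  qed
qed

text \<open>The squares of the harmonics of one degree add up to the constant d_k on the sphere, so
  the second-moment part is exactly d_k under every law; only the squared means depend on the
  alternative.\<close>

lemma integral_Q:
  assumes k: "k \<ge> 1" and n: "n \<ge> 1"
  shows "integrable (P n) (Q k n)"
    and "(\<integral>u. Q k n u \<partial>P n) = real (d k) + (real n - 1) * (\<Sum>i<d k. (\<integral>x. g k i x \<partial>M n)\<^sup>2)"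
proof -
  have b: "\<bar>g k i x\<bar> \<le> sqrt (d k)" if "i < d k" "x \<in> space (M n)" for i x
    using that k by (intro g_bound) auto
  have sm: "integrable (P n) (\<lambda>u. (\<Sum>j=1..n. g k i (u j))\<^sup>2)"
    "(\<integral>u. (\<Sum>j=1..n. g k i (u j))\<^sup>2 \<partial>P n) = real n * (\<integral>x. (g k i x)\<^sup>2 \<partial>M n) + real n * (real n - 1) * (\<integral>x. g k i x \<partial>M n)\<^sup>2"
    if i: "i < d k" for i
    using second_moment_sum_PiM[OF prob_space_M g_measurable[OF k i] b[OF i]] unfolding P_def by blast+
  have Q: "Q k n = (\<lambda>u. \<Sum>i<d k. (\<Sum>j=1..n. g k i (u j))\<^sup>2 / real n)"
    by (simp add: Q_def[abs_def] power_divide)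
  show "integrable (P n) (Q k n)"
    unfolding Q using sm(1) by (intro Bochner_Integration.integrable_sum integrable_divide_zero) auto
  interpret M: prob_space "M n" by (rule prob_space_M)
  have i2: "integrable (M n) (\<lambda>x. (g k i x)\<^sup>2)" if i: "i < d k" for i
  proof (rule M.integrable_const_bound[of _ "real (d k)"])
    show "AE x in M n. norm ((g k i x)\<^sup>2) \<le> real (d k)"
    proof (rule AE_I2)
      fix x assume "x \<in> space (M n)"
      then show "norm ((g k i x)\<^sup>2) \<le> real (d k)"
        using power_mono[OF b[OF i] abs_ge_zero, of x 2] by simp
    qed
  qed (use g_measurable[OF k i] in auto)
  have "(\<integral>u. Q k n u \<partial>P n) = (\<Sum>i<d k. (\<integral>u. (\<Sum>j=1..n. g k i (u j))\<^sup>2 \<partial>P n) / real n)"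
    unfolding Q using sm(1) by (subst Bochner_Integration.integral_sum) auto
  also have "\<dots> = (\<Sum>i<d k. (\<integral>x. (g k i x)\<^sup>2 \<partial>M n) + (real n - 1) * (\<integral>x. g k i x \<partial>M n)\<^sup>2)"
    using n by (intro sum.cong refl, subst sm(2)) (auto simp: field_simps)
  also have "\<dots> = (\<Sum>i<d k. \<integral>x. (g k i x)\<^sup>2 \<partial>M n) + (real n - 1) * (\<Sum>i<d k. (\<integral>x. g k i x \<partial>M n)\<^sup>2)"
    by (simp add: sum.distrib sum_distrib_left)
  also have "(\<Sum>i<d k. \<integral>x. (g k i x)\<^sup>2 \<partial>M n) = (\<integral>x. (\<Sum>i<d k. (g k i x)\<^sup>2) \<partial>M n)"
    using i2 by (subst Bochner_Integration.integral_sum) auto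
  also have "\<dots> = (\<integral>x. real (d k) \<partial>M n)"
    using sum_squares k by (intro Bochner_Integration.integral_cong) auto
  also have "\<dots> = real (d k)" using M.prob_space by simp
  finally show "(\<integral>u. Q k n u \<partial>P n) = real (d k) + (real n - 1) * (\<Sum>i<d k. (\<integral>x. g k i x \<partial>M n)\<^sup>2)" .
qed

lemma g_norm: "k \<ge> 1 \<Longrightarrow> i < d k \<Longrightarrow> (\<integral>x. (g k i x)\<^sup>2 \<partial>uniform_sphere) \<le> 1"
  using g_orthonormal[of k k i i] by (simp add: power2_eq_square)

section \<open>Limit law under local alternatives\<close>

context
  fixes c :: real assumes c: "(\<lambda>n. sqrt n * \<kappa> n ^ K) \<longlonglongrightarrow> c"
begin

text \<open>The limiting means in degree \<open>K\<close> are
  \<open>drift K * c * g K i theta0\<close>; the sum of their squares over i has this value because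
  the squared harmonics add up to d_K.\<close>

definition \<xi> :: "nat \<Rightarrow> real" where
  "\<xi> k = (if k = K then real (d K) * (drift K * c)\<^sup>2 else 0)"

lemma xi_nonneg: "\<xi> k \<ge> 0"
  by (simp add: \<xi>_def)

lemma truncated_limit:
  assumes t: "t \<ge> 0"
  shows "(\<lambda>n. \<integral>u. exp (- (t * S n N u)) \<partial>P n)
    \<longlonglongrightarrow> (\<Prod>k<N. \<Prod>i<d (Suc k). gauss_laplace (t * (v (Suc k))\<^sup>2) (if i = 0 then sqrt (\<xi> (Suc k)) else 0))"
proof -
  \<comment> \<open>Degrees below \<open>K\<close> have weight 0 and must be left out: their means
    are not controlled at this rate, and sqrt n times such a mean may diverge.\<close>
  let ?I = "SIGMA k:{K..N}. {..<d k}"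
  let ?g = "\<lambda>(k, i). g k i"
  let ?m = "\<lambda>(k, i). drift k * c * g k i theta0"
  let ?a = "\<lambda>(k, i). (v k)\<^sup>2"
  have lim: "(\<lambda>n. \<integral>u. exp (- (t * (\<Sum>\<iota>\<in>?I. ?a \<iota> * ((\<Sum>j=1..n. ?g \<iota> (u j)) / sqrt n)\<^sup>2))) \<partial>PiM {1..n} (\<lambda>_. M n))
      \<longlonglongrightarrow> (\<Prod>\<iota>\<in>?I. gauss_laplace (t * ?a \<iota>) (?m \<iota>))"
  proof (rule laplace_quadratic_form_tendsto[where B = "\<lambda>(k, i). sqrt (d k)", OF prob_space_M])
    show "finite ?I" by auto
    show "?g \<iota> \<in> borel_measurable (M n)" if "\<iota> \<in> ?I" for n \<iota>
      using that K by (auto intro!: g_measurable)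
    show "\<bar>?g \<iota> x\<bar> \<le> (case \<iota> of (k, i) \<Rightarrow> sqrt (d k))" if "\<iota> \<in> ?I" "x \<in> space (M n)" for n \<iota> x
      using that K by (auto intro!: g_bound)
    show "(\<lambda>n. sqrt n * (\<integral>x. ?g \<iota> x \<partial>M n)) \<longlonglongrightarrow> ?m \<iota>" if "\<iota> \<in> ?I" for \<iota>
    proof -
      obtain k i where \<iota>: "\<iota> = (k, i)" "K \<le> k" "i < d k" using \<open>\<iota> \<in> ?I\<close> by auto
      then show ?thesis using drift_limit[OF g_span _ g_norm c, of k i] K by simp
    qed
    show "(\<lambda>n. \<integral>x. ?g \<iota> x * ?g \<iota>' x \<partial>M n) \<longlonglongrightarrow> (if \<iota> = \<iota>' then 1 else 0)" if I: "\<iota> \<in> ?I" "\<iota>' \<in> ?I" for \<iota> \<iota>'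
    proof -
      obtain k i l j where \<iota>: "\<iota> = (k, i)" "\<iota>' = (l, j)" "1 \<le> k" "1 \<le> l" "i < d k" "j < d l" using I K by (cases \<iota>; cases \<iota>') auto
      have "(\<lambda>n. \<integral>x. g k i x * g l j x \<partial>M n) \<longlonglongrightarrow> (\<integral>x. g k i x * g l j x \<partial>uniform_sphere)"
        using \<iota> by (intro mean_limit continuous_intros g_continuous)
      then show ?thesis using \<iota> g_orthonormal[of k l i j] by simp
    qed
  qed (use t in auto)
  have S: "(\<Sum>\<iota>\<in>?I. ?a \<iota> * ((\<Sum>j=1..n. ?g \<iota> (u j)) / sqrt n)\<^sup>2) = S n N u" for n u
  proof -
    have "(\<Sum>\<iota>\<in>?I. ?a \<iota> * ((\<Sum>j=1..n. ?g \<iota> (u j)) / sqrt n)\<^sup>2) = (\<Sum>k\<in>{K..N}. (v k)\<^sup>2 * Q k n u)"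
      unfolding Q_def sum_distrib_left by (subst sum.Sigma) (auto simp: case_prod_beta intro!: sum.cong)
    also have "\<dots> = (\<Sum>k\<in>{1..N}. (v k)\<^sup>2 * Q k n u)"
      using K v0 by (intro sum.mono_neutral_left) auto
    finally show ?thesis
      using sum.atLeast1_atMost_eq[of "\<lambda>k. (v k)\<^sup>2 * Q k n u" N] by (simp add: S_def)
  qed
  have "(\<Prod>\<iota>\<in>?I. gauss_laplace (t * ?a \<iota>) (?m \<iota>)) = (\<Prod>k\<in>{K..N}. \<Prod>i<d k. gauss_laplace (t * (v k)\<^sup>2) (drift k * c * g k i theta0))"
    by (subst prod.Sigma) (auto simp: case_prod_beta intro!: prod.cong)
  also have "\<dots> = (\<Prod>k\<in>{K..N}. \<Prod>i<d k. gauss_laplace (t * (v k)\<^sup>2) (if i = 0 then sqrt (\<xi> k) else 0))"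
  proof (rule prod.cong[OF refl])
    fix k assume k: "k \<in> {K..N}"
    \<comment> \<open>Coordinate 0, which is to carry the whole mean, has to exist.\<close>
    have d: "d k \<noteq> 0"
    proof -
      have "(CARD('p) + k - 2) choose (CARD('p) - 2) > 0" using p by simp
      then show ?thesis by (simp add: d_def d_const_def)
    qed
    have "(\<Sum>i<d k. (drift k * c * g k i theta0)\<^sup>2) = (drift k * c)\<^sup>2 * (\<Sum>i<d k. (g k i theta0)\<^sup>2)"
      by (simp add: power_mult_distrib sum_distrib_left)
    also have "\<dots> = \<xi> k"
      using k K sum_squares[of k theta0] by (auto simp: \<xi>_def drift_def)
    also have "\<dots> = (\<Sum>i<d k. if i = 0 then \<xi> k else 0)" using d by simp
    also have "\<dots> = (\<Sum>i<d k. (if i = 0 then sqrt (\<xi> k) else 0)\<^sup>2)"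
      using xi_nonneg by (intro sum.cong) auto
    finally show "(\<Prod>i<d k. gauss_laplace (t * (v k)\<^sup>2) (drift k * c * g k i theta0))
        = (\<Prod>i<d k. gauss_laplace (t * (v k)\<^sup>2) (if i = 0 then sqrt (\<xi> k) else 0))"
      unfolding prod_gauss_laplace by simp
  qed
  \<comment> \<open>The restored degrees have v k = 0 and contribute \<open>gauss_laplace\<close> at
    0, which is 1.\<close>
  also have "\<dots> = (\<Prod>k\<in>{1..N}. \<Prod>i<d k. gauss_laplace (t * (v k)\<^sup>2) (if i = 0 then sqrt (\<xi> k) else 0))"
    using K v0 by (intro prod.mono_neutral_left) (auto simp: gauss_laplace_def)
  also have "\<dots> = (\<Prod>k<N. \<Prod>i<d (Suc k). gauss_laplace (t * (v (Suc k))\<^sup>2) (if i = 0 then sqrt (\<xi> (Suc k)) else 0))"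
    using prod.atLeast1_atMost_eq[of "\<lambda>k. \<Prod>i<d k. gauss_laplace (t * (v k)\<^sup>2) (if i = 0 then sqrt (\<xi> k) else 0)" N] by simp
  finally show ?thesis using lim unfolding S by (simp add: P_def)
qed

text \<open>A convergent sequence sqrt n \<kappa>^K is bounded, say by B. Then n times a squared
  mean in degree k > K is at most (B * (2 * C * \<delta>))^2, with constants from
  \<open>mean_bias\<close> that are common to all k.\<close>

lemma integral_Q_bound:
  obtains A where "A \<ge> 0" "\<And>k n. k > K \<Longrightarrow> n \<ge> 1 \<Longrightarrow> (\<integral>u. Q k n u \<partial>P n) \<le> A * real (d k)"
proof -
  have "Bseq (\<lambda>n. sqrt n * \<kappa> n ^ K)"
    by (rule convergent_imp_Bseq[OF convergentI[OF c]])
  then obtain B where "\<forall>n. norm (sqrt n * \<kappa> n ^ K) \<le> B"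
    by (rule BseqE)
  then have B: "norm (sqrt n * \<kappa> n ^ K) \<le> B" for n :: nat by blast
  have B0: "B \<ge> 0" using B[of 0] by simp
  let ?A = "1 + (B * (2 * C * \<delta>))\<^sup>2"
  show thesis
  proof (rule that[of ?A])
    fix k n :: nat assume k: "k > K" and n: "n \<ge> 1"
    have e: "(real n - 1) * (\<integral>x. g k i x \<partial>M n)\<^sup>2 \<le> (B * (2 * C * \<delta>))\<^sup>2" if i: "i < d k" for i
    proof -
      have b: "\<bar>\<integral>x. g k i x \<partial>M n\<bar> \<le> 2 * C * \<kappa> n ^ Suc K"
        using k K i by (intro mean_bias[OF g_span _ g_norm]) auto
      have "sqrt n * \<bar>\<integral>x. g k i x \<partial>M n\<bar> \<le> sqrt n * (2 * C * \<kappa> n ^ Suc K)"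
        by (intro mult_left_mono b) simp
      also have "\<dots> = (sqrt n * \<kappa> n ^ K) * (2 * C * \<kappa> n)" by simp
      also have "\<dots> \<le> B * (2 * C * \<delta>)"
        using B[of n] kappa(1,2)[of n] C(1) B0 by (intro mult_mono) (auto simp: abs_le_iff)
      finally have "(sqrt n * \<bar>\<integral>x. g k i x \<partial>M n\<bar>)\<^sup>2 \<le> (B * (2 * C * \<delta>))\<^sup>2"
        by (intro power_mono) auto
      then have "real n * (\<integral>x. g k i x \<partial>M n)\<^sup>2 \<le> (B * (2 * C * \<delta>))\<^sup>2"
        by (simp add: power_mult_distrib)
      moreover have "(real n - 1) * (\<integral>x. g k i x \<partial>M n)\<^sup>2 \<le> real n * (\<integral>x. g k i x \<partial>M n)\<^sup>2"
        by (intro mult_right_mono) auto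
      ultimately show ?thesis by linarith
    qed
    have "(\<integral>u. Q k n u \<partial>P n) = real (d k) + (\<Sum>i<d k. (real n - 1) * (\<integral>x. g k i x \<partial>M n)\<^sup>2)"
      using integral_Q(2)[of k n] k K n by (simp add: sum_distrib_left)
    also have "\<dots> \<le> real (d k) + (\<Sum>i<d k. (B * (2 * C * \<delta>))\<^sup>2)"
      by (intro add_left_mono sum_mono e) simp
    also have "\<dots> = ?A * real (d k)" by (simp add: algebra_simps)
    finally show "(\<integral>u. Q k n u \<partial>P n) \<le> ?A * real (d k)" .
  qed simp
qed

lemma exp_diff_le:
  fixes x y :: real
  assumes "0 \<le> x" "x \<le> y"
  shows "exp (- x) - exp (- y) \<le> y - x"
proof -
  have "1 - exp (- (y - x)) \<le> y - x" using exp_ge_add_one_self[of "- (y - x)"] by linarith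
  then have "exp (- x) * (1 - exp (- (y - x))) \<le> 1 * (y - x)"
    using assms by (intro mult_mono) auto
  then show ?thesis by (simp add: right_diff_distrib flip: exp_add)
qed

text \<open>The map x to exp (- x) is 1-Lipschitz on the half-line, so the error is at most t times
  the mean of the omitted terms. N \<ge> K ensures that all omitted degrees exceed \<open>K\<close>,
  as \<open>integral_Q_bound\<close> demands.\<close>

lemma truncation_error:
  assumes t: "t \<ge> 0" and A: "A \<ge> 0" "\<And>k n. k > K \<Longrightarrow> n \<ge> 1 \<Longrightarrow> (\<integral>u. Q k n u \<partial>P n) \<le> A * real (d k)"
    and n: "n \<ge> 1" and N: "N \<ge> K"
  shows "\<bar>(\<integral>u. exp (- (t * sobolev_stat v n u)) \<partial>P n) - (\<integral>u. exp (- (t * S n N u)) \<partial>P n)\<bar>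
    \<le> t * A * (\<Sum>k. (v (Suc (k + N)))\<^sup>2 * real (d (Suc (k + N))))"
proof -
  interpret prob_space "P n" by (rule prob_space_P)
  let ?E = "\<lambda>N. \<integral>u. exp (- (t * S n N u)) \<partial>P n"
  let ?w = "\<lambda>k. (v (Suc k))\<^sup>2 * real (d (Suc k))"
  have iE: "integrable (P n) (\<lambda>u. exp (- (t * S n N u)))" for N
    by (intro integrable_exp_nonneg S_measurable S_nonneg t)
  have sum_w: "summable (\<lambda>k. ?w (k + N))" using v_summable by (subst summable_iff_shift)
  \<comment> \<open>With r additional terms every integrand is a finite sum of integrable squares;
    the whole series is reached afterwards by dominated convergence as r grows.\<close>
  have le: "\<bar>?E (N + r) - ?E N\<bar> \<le> t * A * (\<Sum>k. ?w (k + N))" for r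
  proof -
    have D: "S n (N + r) u - S n N u = (\<Sum>k<r. (v (Suc (k + N)))\<^sup>2 * Q (Suc (k + N)) n u)" for u
      unfolding S_def by (induction r) (simp_all add: add_ac)
    have Dn: "0 \<le> (\<Sum>k<r. (v (Suc (k + N)))\<^sup>2 * Q (Suc (k + N)) n u)" for u
      by (intro sum_nonneg mult_nonneg_nonneg Q_nonneg) simp
    have iD: "integrable (P n) (\<lambda>u. t * (\<Sum>k<r. (v (Suc (k + N)))\<^sup>2 * Q (Suc (k + N)) n u))"
      by (intro integrable_mult_right Bochner_Integration.integrable_sum integral_Q(1) n) simp
    have mono: "S n N u \<le> S n (N + r) u" for u using D[of u] Dn[of u] by linarith
    have "?E N - ?E (N + r) = (\<integral>u. exp (- (t * S n N u)) - exp (- (t * S n (N + r) u)) \<partial>P n)"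
      by (rule Bochner_Integration.integral_diff[symmetric, OF iE iE])
    also have "\<dots> \<le> (\<integral>u. t * (\<Sum>k<r. (v (Suc (k + N)))\<^sup>2 * Q (Suc (k + N)) n u) \<partial>P n)"
    proof (intro integral_mono iD Bochner_Integration.integrable_diff iE)
      fix u
      have "exp (- (t * S n N u)) - exp (- (t * S n (N + r) u)) \<le> t * S n (N + r) u - t * S n N u"
        using t mono S_nonneg by (intro exp_diff_le mult_left_mono mult_nonneg_nonneg)
      then show "exp (- (t * S n N u)) - exp (- (t * S n (N + r) u)) \<le> t * (\<Sum>k<r. (v (Suc (k + N)))\<^sup>2 * Q (Suc (k + N)) n u)"
        unfolding D[symmetric] by (simp add: right_diff_distrib)
    qed
    also have "\<dots> = t * (\<Sum>k<r. (v (Suc (k + N)))\<^sup>2 * (\<integral>u. Q (Suc (k + N)) n u \<partial>P n))"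
      using integral_Q(1)[OF _ n] by (simp add: Bochner_Integration.integral_sum)
    also have "\<dots> \<le> t * (\<Sum>k<r. (v (Suc (k + N)))\<^sup>2 * (A * real (d (Suc (k + N)))))"
      using N by (intro mult_left_mono t sum_mono A(2) n) auto
    also have "\<dots> = t * A * (\<Sum>k<r. ?w (k + N))"
      by (simp add: sum_distrib_left mult_ac)
    also have "\<dots> \<le> t * A * (\<Sum>k. ?w (k + N))"
      using t A(1) by (intro mult_left_mono sum_le_suminf sum_w) auto
    finally have "?E N - ?E (N + r) \<le> t * A * (\<Sum>k. ?w (k + N))" .
    moreover have "?E (N + r) \<le> ?E N"
      using t mono by (intro integral_mono iE) (auto intro!: mult_left_mono)
    ultimately show ?thesis by linarith
  qed
  have "(\<lambda>r. ?E r) \<longlonglongrightarrow> (\<integral>u. exp (- (t * sobolev_stat v n u)) \<partial>P n)"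
  proof (rule integral_dominated_convergence[where w = "\<lambda>_. 1"])
    show "AE u in P n. (\<lambda>r. exp (- (t * S n r u))) \<longlonglongrightarrow> exp (- (t * sobolev_stat v n u))"
      by (intro AE_I2 tendsto_intros S_tendsto)
    show "AE u in P n. norm (exp (- (t * S n r u))) \<le> 1" for r
      using t S_nonneg by (intro AE_I2) auto
  qed (use stat_measurable S_measurable in auto)
  then have "(\<lambda>r. ?E (r + N)) \<longlonglongrightarrow> (\<integral>u. exp (- (t * sobolev_stat v n u)) \<partial>P n)"
    by (rule LIMSEQ_ignore_initial_segment)
  then have "(\<lambda>r. \<bar>?E (N + r) - ?E N\<bar>) \<longlonglongrightarrow> \<bar>(\<integral>u. exp (- (t * sobolev_stat v n u)) \<partial>P n) - ?E N\<bar>"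
    by (intro tendsto_intros) (simp add: add.commute)
  then show ?thesis
    by (rule LIMSEQ_le_const2) (use le in blast)
qed

theorem stat_weak_limit:
  "weak_conv_m (\<lambda>n. distr (P n) borel (sobolev_stat v n)) (weighted_chi_square (\<lambda>k. (v k)\<^sup>2) d \<xi>)"
proof (rule weak_conv_m_laplace)
  show "real_distribution (distr (P n) borel (sobolev_stat v n))" for n
    by (intro prob_space.real_distribution_distr prob_space_P stat_measurable)
  show "AE x in distr (P n) borel (sobolev_stat v n). 0 \<le> x" for n
    by (subst AE_distr_iff[OF stat_measurable]) (auto simp: stat_nonneg)
  have sm: "summable (\<lambda>k. (v (Suc k))\<^sup>2 * (2 * real (d (Suc k)) + 2 * \<xi> (Suc k)))"
  proof -
    \<comment> \<open>Only degree \<open>K\<close> has a non-centrality; in a series over Suc k it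
      sits at index K - 1.\<close>
    have "summable (\<lambda>k. 2 * ((v (Suc k))\<^sup>2 * real (d (Suc k))) + (if k \<in> {K - 1} then 2 * (v (Suc k))\<^sup>2 * \<xi> (Suc k) else 0))"
      by (intro summable_add summable_mult v_summable summable_If_finite_set) simp
    moreover have "2 * ((v (Suc k))\<^sup>2 * real (d (Suc k))) + (if k \<in> {K - 1} then 2 * (v (Suc k))\<^sup>2 * \<xi> (Suc k) else 0)
        = (v (Suc k))\<^sup>2 * (2 * real (d (Suc k)) + 2 * \<xi> (Suc k))" for k
      using K by (auto simp: \<xi>_def algebra_simps)
    ultimately show ?thesis by simp
  qed
  note W = weighted_chi_square_facts[of "\<lambda>k. (v k)\<^sup>2" \<xi> d, OF zero_le_power2 xi_nonneg sm]
  show "real_distribution (weighted_chi_square (\<lambda>k. (v k)\<^sup>2) d \<xi>)" by (rule W(1))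
  show "AE x in weighted_chi_square (\<lambda>k. (v k)\<^sup>2) d \<xi>. 0 \<le> x" by (rule W(2))
  fix t :: nat
  obtain A where A: "A \<ge> 0" "\<And>k n. k > K \<Longrightarrow> n \<ge> 1 \<Longrightarrow> (\<integral>u. Q k n u \<partial>P n) \<le> A * real (d k)"
    using integral_Q_bound by blast
  have "(\<lambda>N. t * A * (\<Sum>k. (v (Suc (k + N)))\<^sup>2 * real (d (Suc (k + N))))) \<longlonglongrightarrow> t * A * 0"
    using suminf_exist_split2[OF v_summable] by (intro tendsto_intros) simp
  then have e: "(\<lambda>N. t * A * (\<Sum>k. (v (Suc (k + N)))\<^sup>2 * real (d (Suc (k + N))))) \<longlonglongrightarrow> 0" by simp
  have "(\<lambda>n. \<integral>u. exp (- (real t * sobolev_stat v n u)) \<partial>P n) \<longlonglongrightarrow> (\<integral>x. exp (- (real t * x)) \<partial>weighted_chi_square (\<lambda>k. (v k)\<^sup>2) d \<xi>)"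
    by (rule interchange_limits[OF truncated_limit W(3) e truncation_error]) (use A in auto)
  moreover have "(\<integral>x. exp (- (real t * x)) \<partial>distr (P n) borel (sobolev_stat v n)) = (\<integral>u. exp (- (real t * sobolev_stat v n u)) \<partial>P n)" for n
    by (rule integral_distr[OF stat_measurable]) simp
  ultimately show "(\<lambda>n. \<integral>x. exp (- (real t * x)) \<partial>distr (P n) borel (sobolev_stat v n))
      \<longlonglongrightarrow> (\<integral>x. exp (- (real t * x)) \<partial>weighted_chi_square (\<lambda>k. (v k)\<^sup>2) d \<xi>)"
    by simp
qed

end

end

subsection \<open>Consistency and the main theorem\<close>

context sobolev_array
begin

text \<open>Chebyshev's inequality along the zonal direction of theta0.\<close>

theorem stat_consistent:
  assumes lim: "filterlim (\<lambda>n. sqrt n * \<kappa> n ^ K) at_top sequentially" and drift: "drift K \<noteq> 0"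
  shows "(\<lambda>n. measure (P n) {u \<in> space (P n). sobolev_stat v n u > b}) \<longlonglongrightarrow> 1"
proof -
  have d0: "d K > 0"
  proof -
    have "(CARD('p) + K - 2) choose (CARD('p) - 2) > 0" using p by simp
    then show ?thesis by (simp add: d_def d_const_def)
  qed
  define s where "s = sqrt (d K)"
  have s: "s > 0" "s\<^sup>2 = d K" using d0 by (auto simp: s_def)
  \<comment> \<open>The zonal function of theta0 with norm 1; its value at theta0 is s. The summand
    with factor 0 gives it the shape of a \<open>lincomb\<close> step.\<close>
  define g0 where "g0 x = 1 / s * zonal K x theta0 + 0 * zonal K x theta0" for x :: "real ^ 'p::{finite,linorder}"
  have g0: "g0 \<in> zonal_span K"
    unfolding g0_def[abs_def] by (intro kernel_span.lincomb kernel_span.kernel) auto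
  have g0_eq: "g0 x = (\<Sum>i<d K. g K i theta0 / s * g K i x)" if "norm x = 1" for x
    using addition[OF K that, of theta0] by (simp add: g0_def zonal_def sum_distrib_left sum_divide_distrib mult_ac)
  have g0_theta: "g0 theta0 = s"
    using sum_squares[OF K, of theta0] s by (simp add: g0_eq power2_eq_square field_simps flip: sum_divide_distrib)
  have "(\<integral>x. g0 x * zonal K x theta0 \<partial>uniform_sphere) = g0 theta0"
    using zonal_span_zonal[OF p K order_refl _ g0, of theta0] by simp
  then have "s * (\<integral>x. (g0 x)\<^sup>2 \<partial>uniform_sphere) = s"
  proof -
    assume a: "(\<integral>x. g0 x * zonal K x theta0 \<partial>uniform_sphere) = g0 theta0"
    have "(\<integral>x. g0 x * zonal K x theta0 \<partial>uniform_sphere) = (\<integral>x. s * (g0 x)\<^sup>2 \<partial>uniform_sphere)"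
    proof (intro Bochner_Integration.integral_cong refl)
      fix x
      have "zonal K x theta0 = s * g0 x" using s(1) by (simp add: g0_def)
      then show "g0 x * zonal K x theta0 = s * (g0 x)\<^sup>2" by (simp add: power2_eq_square)
    qed
    then show ?thesis using a g0_theta by simp
  qed
  then have norm: "(\<integral>x. (g0 x)\<^sup>2 \<partial>uniform_sphere) \<le> 1" using s by simp
  have g0_bound: "\<bar>g0 x\<bar> \<le> s" if "norm x = 1" for x
  proof -
    have "\<bar>g0 x\<bar> = \<bar>h_fun CARD('p) K (x \<bullet> theta0)\<bar> / s" using s by (simp add: g0_def zonal_def)
    also have "\<dots> \<le> real (d K) / s" using h_bound[OF K that, of theta0] s by (intro divide_right_mono) auto
    also have "\<dots> = s" unfolding s(2)[symmetric] using s(1) by (simp add: power2_eq_square)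
    finally show ?thesis .
  qed
  define e where "e n = (\<integral>x. g0 x \<partial>M n)" for n
  define m where "m n = sqrt n * e n" for n :: nat
  have g0m: "g0 \<in> borel_measurable (M n)" for n by (rule measurable_M[OF zonal_span_measurable[OF g0]])
  \<comment> \<open>\<open>m n\<close> is the mean of the linear statistic \<open>L n\<close> below.
    It is at least of order sqrt n \<kappa>^K, which diverges by assumption.\<close>
  have m_lower: "(\<bar>drift K\<bar> * s - C * \<kappa> n) / mass n * (sqrt n * \<kappa> n ^ K) \<le> \<bar>m n\<bar>" for n :: nat
  proof -
    let ?I = "\<integral>u. g0 u * dens n u \<partial>uniform_sphere"
    have "\<bar>?I - drift K * \<kappa> n ^ K * s\<bar> \<le> C * \<kappa> n ^ Suc K"
      using mean_expansion[OF g0 order_refl norm, of n] by (simp add: g0_theta)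
    moreover have "\<bar>drift K * \<kappa> n ^ K * s\<bar> = \<bar>drift K\<bar> * \<kappa> n ^ K * s"
      using s kappa(1)[of n] by (simp add: abs_mult)
    ultimately have "\<bar>drift K\<bar> * \<kappa> n ^ K * s - C * \<kappa> n ^ Suc K \<le> \<bar>?I\<bar>" by linarith
    then have "\<kappa> n ^ K * (\<bar>drift K\<bar> * s - C * \<kappa> n) / mass n \<le> \<bar>?I\<bar> / mass n"
      using mass_ge[of n] by (intro divide_right_mono) (auto simp: algebra_simps)
    also have "\<dots> = \<bar>e n\<bar>"
      using mass_ge[of n] unfolding e_def mean_M[OF zonal_span_continuous[OF g0]] by (simp add: abs_divide)
    finally have "sqrt n * (\<kappa> n ^ K * (\<bar>drift K\<bar> * s - C * \<kappa> n) / mass n) \<le> sqrt n * \<bar>e n\<bar>"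
      by (intro mult_left_mono) auto
    then show ?thesis by (simp add: m_def abs_mult mult_ac)
  qed
  have "(\<lambda>n. (\<bar>drift K\<bar> * s - C * \<kappa> n) / mass n) \<longlonglongrightarrow> (\<bar>drift K\<bar> * s - C * 0) / 1"
    by (intro tendsto_intros kappa mass_limit) simp
  then have ratio: "(\<lambda>n. (\<bar>drift K\<bar> * s - C * \<kappa> n) / mass n) \<longlonglongrightarrow> \<bar>drift K\<bar> * s"
    by simp
  have "0 < \<bar>drift K\<bar> * s" using drift s by simp
  then have "filterlim (\<lambda>n. (\<bar>drift K\<bar> * s - C * \<kappa> n) / mass n * (sqrt n * \<kappa> n ^ K)) at_top sequentially"
    by (rule filterlim_tendsto_pos_mult_at_top[OF ratio _ lim])
  then have m_inf: "filterlim (\<lambda>n. \<bar>m n\<bar>) at_top sequentially"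
    by (rule filterlim_at_top_mono) (intro always_eventually allI m_lower)
  \<comment> \<open>A statistic of at most b forces \<bar>L n u\<bar> \<le> R, since the square of
    \<open>L n u\<close> is at most \<open>Q K n u\<close> by Cauchy-Schwarz. The absolute value
    keeps the radicand nonnegative when b is negative.\<close>
  define R where "R = sqrt (\<bar>b\<bar> / (v K)\<^sup>2)"
  define L where "L n u = (\<Sum>j=1..n. g0 (u j)) / sqrt n" for n :: nat and u
  have v2: "(v K)\<^sup>2 > 0" using vK by simp
  have stat_L: "\<bar>L n u\<bar> \<le> R" if u: "u \<in> space (P n)" and le: "sobolev_stat v n u \<le> b" for n u
  proof -
    have "L n u = (\<Sum>i<d K. g K i theta0 / s * ((\<Sum>j=1..n. g K i (u j)) / sqrt n))"
    proof -
      have "(\<Sum>j=1..n. g0 (u j)) = (\<Sum>j=1..n. \<Sum>i<d K. g K i theta0 / s * g K i (u j))"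
        using space_P[OF u] by (intro sum.cong refl g0_eq) auto
      also have "\<dots> = (\<Sum>i<d K. \<Sum>j=1..n. g K i theta0 / s * g K i (u j))" by (rule sum.swap)
      finally show ?thesis by (simp add: L_def sum_distrib_left sum_divide_distrib)
    qed
    then have "(L n u)\<^sup>2 \<le> (\<Sum>i<d K. (g K i theta0 / s)\<^sup>2) * (\<Sum>i<d K. ((\<Sum>j=1..n. g K i (u j)) / sqrt n)\<^sup>2)"
      by (simp only:) (rule Cauchy_Schwarz_ineq_sum)
    also have "(\<Sum>i<d K. (g K i theta0 / s)\<^sup>2) = 1"
      using sum_squares[OF K, of theta0] s d0 by (simp add: power_divide flip: sum_divide_distrib)
    finally have LQ: "(L n u)\<^sup>2 \<le> Q K n u" by (simp add: Q_def)
    obtain k0 where k0: "K = Suc k0" using K by (cases K) auto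
    have "(v K)\<^sup>2 * Q K n u = (\<Sum>k\<in>{k0}. (v (Suc k))\<^sup>2 * Q (Suc k) n u)" by (simp add: k0)
    also have "\<dots> \<le> (\<Sum>k. (v (Suc k))\<^sup>2 * Q (Suc k) n u)"
      by (intro sum_le_suminf sums_summable[OF stat_sums[OF u]]) (auto simp: Q_nonneg)
    also have "\<dots> \<le> b" using le sums_unique[OF stat_sums[OF u]] by simp
    finally have "(v K)\<^sup>2 * Q K n u \<le> \<bar>b\<bar>" by linarith
    then have "Q K n u \<le> \<bar>b\<bar> / (v K)\<^sup>2" using v2 by (simp add: field_simps)
    with LQ have "(L n u)\<^sup>2 \<le> \<bar>b\<bar> / (v K)\<^sup>2" by linarith
    then have "sqrt ((L n u)\<^sup>2) \<le> R" unfolding R_def by (rule real_sqrt_le_mono)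
    then show ?thesis by simp
  qed
  \<comment> \<open>A normalised sum of independent centred terms has the second moment of a single
    term; \<bar>g0 - e n\<bar> \<le> 2 s bounds it by 4 s^2 = 4 d_K.\<close>
  have variance: "integrable (P n) (\<lambda>u. (L n u - m n)\<^sup>2)" "(\<integral>u. (L n u - m n)\<^sup>2 \<partial>P n) \<le> 4 * real (d K)" if n: "n \<ge> 1" for n
  proof -
    interpret M: prob_space "M n" by (rule prob_space_M)
    have ig: "integrable (M n) g0"
      by (rule M.integrable_const_bound[of _ s]) (use g0_bound g0m in \<open>auto intro!: AE_I2\<close>)
    have "\<bar>e n\<bar> \<le> (\<integral>x. \<bar>g0 x\<bar> \<partial>M n)" unfolding e_def by (rule integral_abs_bound)
    also have "\<dots> \<le> (\<integral>x. s \<partial>M n)" using g0_bound ig by (intro integral_mono) auto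
    also have "\<dots> = s" using M.prob_space by simp
    finally have e: "\<bar>e n\<bar> \<le> s" .
    have b2: "\<bar>g0 x - e n\<bar> \<le> 2 * s" if "x \<in> space (M n)" for x
      using g0_bound[of x] that e by (simp add: abs_le_iff)
    have meas: "(\<lambda>x. g0 x - e n) \<in> borel_measurable (M n)" using g0m by simp
    note V = second_moment_sum_PiM[OF prob_space_M meas b2, of n, folded P_def]
    have eq: "(L n u - m n)\<^sup>2 = (\<Sum>j=1..n. g0 (u j) - e n)\<^sup>2 / real n" for u
    proof -
      have "(\<Sum>j=1..n. g0 (u j) - e n) = (\<Sum>j=1..n. g0 (u j)) - real n * e n" by (simp add: sum_subtractf)
      moreover have "L n u - m n = ((\<Sum>j=1..n. g0 (u j)) - real n * e n) / sqrt n"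
        using n by (simp add: L_def m_def diff_divide_distrib) (simp add: field_simps)
      ultimately show ?thesis by (simp add: power_divide)
    qed
    show "integrable (P n) (\<lambda>u. (L n u - m n)\<^sup>2)"
      unfolding eq by (intro integrable_divide_zero V(1))
    have "(\<integral>x. g0 x - e n \<partial>M n) = 0"
      using ig M.prob_space by (simp add: e_def)
    then have "(\<integral>u. (L n u - m n)\<^sup>2 \<partial>P n) = (\<integral>x. (g0 x - e n)\<^sup>2 \<partial>M n)"
      unfolding eq using V(2) n by simp
    also have "\<dots> \<le> (\<integral>x. 4 * real (d K) \<partial>M n)"
    proof (rule integral_mono_AE)
      have sq: "(g0 x - e n)\<^sup>2 \<le> 4 * real (d K)" if "x \<in> space (M n)" for x
        using power_mono[OF b2[OF that] abs_ge_zero, of 2] s by (simp add: power_mult_distrib)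
      then show "AE x in M n. (g0 x - e n)\<^sup>2 \<le> 4 * real (d K)" by (rule AE_I2)
      show "integrable (M n) (\<lambda>x. (g0 x - e n)\<^sup>2)"
        by (rule M.integrable_const_bound[of _ "4 * real (d K)"]) (use sq meas in \<open>auto intro!: AE_I2\<close>)
    qed simp
    also have "\<dots> = 4 * real (d K)" using M.prob_space by simp
    finally show "(\<integral>u. (L n u - m n)\<^sup>2 \<partial>P n) \<le> 4 * real (d K)" .
  qed
  \<comment> \<open>On the event that the statistic is at most b, \<open>L n\<close> deviates from
    its mean by at least \<bar>m n\<bar> - R, while its variance stays bounded.\<close>
  have bound: "1 - 4 * real (d K) / (\<bar>m n\<bar> - R)\<^sup>2 \<le> measure (P n) {u \<in> space (P n). sobolev_stat v n u > b}"
    if n: "n \<ge> 1" and mR: "\<bar>m n\<bar> > R" for n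
  proof -
    interpret prob_space "P n" by (rule prob_space_P)
    let ?r = "(\<bar>m n\<bar> - R)\<^sup>2"
    have r: "?r > 0" using mR by simp
    have meas[measurable]: "sobolev_stat v n \<in> borel_measurable (P n)" by (rule stat_measurable)
    have meas2[measurable]: "(\<lambda>u. (L n u - m n)\<^sup>2) \<in> borel_measurable (P n)" using variance(1)[OF n] by blast
    have "measure (P n) {u \<in> space (P n). sobolev_stat v n u \<le> b} \<le> measure (P n) {u \<in> space (P n). ?r \<le> (L n u - m n)\<^sup>2}"
    proof (rule finite_measure_mono)
      show "{u \<in> space (P n). sobolev_stat v n u \<le> b} \<subseteq> {u \<in> space (P n). ?r \<le> (L n u - m n)\<^sup>2}"
      proof safe
        fix u assume u: "u \<in> space (P n)" "sobolev_stat v n u \<le> b"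
        have "\<bar>m n\<bar> - R \<le> \<bar>L n u - m n\<bar>" using stat_L[OF u] by linarith
        then have "?r \<le> \<bar>L n u - m n\<bar>\<^sup>2" using mR by (intro power_mono) auto
        then show "?r \<le> (L n u - m n)\<^sup>2" by simp
      qed
    qed measurable
    also have "\<dots> \<le> (\<integral>u. (L n u - m n)\<^sup>2 \<partial>P n) / ?r"
      by (rule integral_Markov_inequality_measure[OF variance(1)[OF n], of "{}"]) (use r in auto)
    also have "\<dots> \<le> 4 * real (d K) / ?r" using variance(2)[OF n] r by (intro divide_right_mono) auto
    finally have "measure (P n) {u \<in> space (P n). sobolev_stat v n u \<le> b} \<le> 4 * real (d K) / ?r" .
    moreover have "measure (P n) {u \<in> space (P n). sobolev_stat v n u > b} = 1 - measure (P n) {u \<in> space (P n). sobolev_stat v n u \<le> b}"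
    proof -
      have "{u \<in> space (P n). sobolev_stat v n u \<le> b} \<in> sets (P n)" by measurable
      moreover have "{u \<in> space (P n). sobolev_stat v n u > b} = space (P n) - {u \<in> space (P n). sobolev_stat v n u \<le> b}" by auto
      ultimately show ?thesis by (simp only: prob_compl)
    qed
    ultimately show ?thesis by linarith
  qed
  show ?thesis
  proof (rule tendsto_sandwich)
    show "\<forall>\<^sub>F n in sequentially. 1 - 4 * real (d K) / (\<bar>m n\<bar> - R)\<^sup>2 \<le> measure (P n) {u \<in> space (P n). sobolev_stat v n u > b}"
      using eventually_ge_at_top[of 1] filterlim_at_top_dense[THEN iffD1, OF m_inf, rule_format, of R]
      by eventually_elim (rule bound)
    show "\<forall>\<^sub>F n in sequentially. measure (P n) {u \<in> space (P n). sobolev_stat v n u > b} \<le> 1"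
      by (intro always_eventually allI prob_space.prob_le_1 prob_space_P)
    have "filterlim (\<lambda>n. - R + \<bar>m n\<bar>) at_top sequentially"
      by (rule filterlim_tendsto_add_at_top[OF tendsto_const m_inf])
    then have "filterlim (\<lambda>n. (\<bar>m n\<bar> - R)\<^sup>2) at_top sequentially"
      by (intro filterlim_pow_at_top) auto
    then have "(\<lambda>n. 4 * real (d K) / (\<bar>m n\<bar> - R)\<^sup>2) \<longlonglongrightarrow> 0"
      by (intro tendsto_divide_0[OF tendsto_const] filterlim_at_top_imp_at_infinity)
    from tendsto_diff[OF tendsto_const[of 1] this]
    show "(\<lambda>n. 1 - 4 * real (d K) / (\<bar>m n\<bar> - R)\<^sup>2) \<longlonglongrightarrow> 1" by simp
  qed simp
qed

end

text \<open>Translates the rate of the hypotheses, n^(1/(2K)) \<kappa>, into sqrt n \<kappa>^K, the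
  size of the drift.\<close>

lemma rate_power:
  assumes "n \<ge> 1" "K \<ge> 1"
  shows "sqrt n * x ^ K = (real n powr (1 / (2 * real K)) * x) ^ K"
proof -
  have "(real n powr (1 / (2 * real K))) ^ K = real n powr (1 / (2 * real K) * real K)"
    using assms by (simp add: powr_powr flip: powr_realpow)
  also have "1 / (2 * real K) * real K = 1 / 2" using assms by simp
  finally show ?thesis using assms by (simp add: power_mult_distrib powr_half_sqrt)
qed

theorem theorem4:
  fixes p k\<^sub>v :: nat
    and v \<kappa> :: "nat \<Rightarrow> real"
    and f :: "real \<Rightarrow> real"
    and \<tau> :: real
    and P :: "nat \<Rightarrow> (nat \<Rightarrow> real ^ 'p::{finite,linorder}) measure"
  assumes "p = CARD('p)" and "p \<ge> 2"
    and "\<exists>k\<ge>1. v k \<noteq> 0"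
    and "summable (\<lambda>k. (v (Suc k))\<^sup>2 * real (d_const p (Suc k)))"
    and "k\<^sub>v = (LEAST k. k \<ge> 1 \<and> v k \<noteq> 0)"
    and "angular_function f" and "infinitely_differentiable_at_zero f"
    and "\<forall>n\<ge>1. \<kappa> n > 0" and "\<kappa> \<longlonglongrightarrow> 0"
    and "\<tau> > 0"
    and "P = (\<lambda>n. rotsym_sample n (\<kappa> n) f)"
  shows "(\<forall>k\<ge>1. xi_const p f k \<tau> =
            real (d_const p k) * ((deriv ^^ k) f 0)\<^sup>2 * \<tau> ^ (2 * k) /
            (\<Prod>l<k. (real p + 2 * real l)\<^sup>2))
    \<and> (\<kappa> \<in> o(\<lambda>n. real n powr (- 1 / (2 * real k\<^sub>v))) \<longrightarrow>
        weak_conv_m (\<lambda>n. distr (P n) borel (sobolev_stat v n))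
          (weighted_chi_square (\<lambda>k. (v k)\<^sup>2) (d_const p) (\<lambda>k. 0)))
    \<and> ((\<forall>n\<ge>1. \<kappa> n = real n powr (- 1 / (2 * real k\<^sub>v)) * \<tau>) \<longrightarrow>
        weak_conv_m (\<lambda>n. distr (P n) borel (sobolev_stat v n))
          (weighted_chi_square (\<lambda>k. (v k)\<^sup>2) (d_const p)
            (\<lambda>k. if k = k\<^sub>v then xi_const p f k\<^sub>v \<tau> else 0)))
    \<and> (filterlim (\<lambda>n. real n powr (1 / (2 * real k\<^sub>v)) * \<kappa> n) at_top sequentially \<longrightarrow>
       (deriv ^^ k\<^sub>v) f 0 \<noteq> 0 \<longrightarrow>
        (\<forall>c>0. (\<lambda>n. measure (P n) {u \<in> space (P n). sobolev_stat v n u > c}) \<longlonglongrightarrow> 1)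
        \<and> (\<forall>\<alpha>. 0 < \<alpha> \<and> \<alpha> < 1 \<longrightarrow>
             (\<lambda>n. measure (P n) {u \<in> space (P n). sobolev_stat v n u >
                upper_quantile (weighted_chi_square (\<lambda>k. (v k)\<^sup>2) (d_const p) (\<lambda>k. 0)) \<alpha>})
             \<longlonglongrightarrow> 1))"
proof -
  note p = assms(1,2) and ang = assms(6)
  define K where "K = k\<^sub>v"
  have K: "K \<ge> 1" "v K \<noteq> 0" and v0: "\<And>k. 1 \<le> k \<Longrightarrow> k < K \<Longrightarrow> v k = 0"
  proof -
    have "\<exists>k. k \<ge> 1 \<and> v k \<noteq> 0" using assms(3) by auto
    from LeastI_ex[OF this] show "K \<ge> 1" "v K \<noteq> 0" unfolding K_def assms(5) by auto
    fix k assume "1 \<le> k" "k < K"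
    then show "v k = 0" using not_less_Least[of k "\<lambda>k. k \<ge> 1 \<and> v k \<noteq> 0"] unfolding K_def assms(5) by auto
  qed
  have f0: "f 0 = 1" using ang by (simp add: angular_function_def)
  obtain \<delta>1 C1 where t1: "\<delta>1 > 0" "C1 \<ge> 0"
    "\<And>x. \<bar>x\<bar> \<le> \<delta>1 \<Longrightarrow> \<bar>f x - (\<Sum>b\<le>K. (deriv ^^ b) f 0 / fact b * x ^ b)\<bar> \<le> C1 * \<bar>x\<bar> ^ Suc K"
    using taylor_bound[OF assms(7), of K] by blast
  \<comment> \<open>The expansion of order 0 supplies the bound of \<bar>f x - 1\<bar> by a multiple
    of \<bar>x\<bar>.\<close>
  obtain \<delta>2 C2 where t2: "\<delta>2 > 0" "C2 \<ge> 0"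
    "\<And>x. \<bar>x\<bar> \<le> \<delta>2 \<Longrightarrow> \<bar>f x - (\<Sum>b\<le>0. (deriv ^^ b) f 0 / fact b * x ^ b)\<bar> \<le> C2 * \<bar>x\<bar> ^ Suc 0"
    using taylor_bound[OF assms(7), of 0] by blast
  define C where "C = max C1 C2"
  have C: "C \<ge> 0" "C1 \<le> C" "C2 \<le> C" using t1 t2 by (auto simp: C_def)
  \<comment> \<open>The last entry yields C * \<delta> \<le> 1/2; C + 1 in place of C avoids a
    division by 0.\<close>
  define \<delta> where "\<delta> = min (min \<delta>1 \<delta>2) (1 / (2 * (C + 1)))"
  have \<delta>: "\<delta> > 0" "\<delta> \<le> \<delta>1" "\<delta> \<le> \<delta>2" "\<delta> \<le> 1 / (2 * (C + 1))" using t1 t2 C by (auto simp: \<delta>_def)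
  have C\<delta>: "C * \<delta> \<le> 1 / 2"
  proof -
    have "C * \<delta> \<le> (C + 1) * (1 / (2 * (C + 1)))" using C \<delta> by (intro mult_mono) auto
    also have "\<dots> = 1 / 2" using C(1) by (simp add: field_simps)
    finally show ?thesis .
  qed
  have "eventually (\<lambda>n. \<kappa> n < \<delta>) sequentially" using assms(9) \<delta>(1) by (rule order_tendstoD)
  then have ev: "eventually (\<lambda>n. \<kappa> n < \<delta> \<and> n \<ge> 1) sequentially"
    using eventually_ge_at_top[of 1] by eventually_elim simp
  text \<open>A law that is not normalisable can occur only for the finitely many n at which \<kappa> is modified.\<close>
  define \<kappa>' where "\<kappa>' n = (if \<kappa> n < \<delta> \<and> n \<ge> 1 then \<kappa> n else \<delta>)" for n
  have \<kappa>'_eq: "eventually (\<lambda>n. \<kappa>' n = \<kappa> n \<and> n \<ge> 1) sequentially"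
    using ev by eventually_elim (simp add: \<kappa>'_def)
  have \<kappa>'_lim: "\<kappa>' \<longlonglongrightarrow> 0"
    using assms(9) by (rule Lim_transform_eventually) (use \<kappa>'_eq in eventually_elim, simp)
  define M where "M n = (rotsym_law (\<kappa>' n) f :: (real ^ 'p::{finite,linorder}) measure)" for n
  have p2: "CARD('p) \<ge> 2" using p by simp
  obtain g :: "nat \<Rightarrow> nat \<Rightarrow> real ^ 'p::{finite,linorder} \<Rightarrow> real" where g:
    "\<And>k i. k \<ge> 1 \<Longrightarrow> i < d_const CARD('p) k \<Longrightarrow> g k i \<in> zonal_span k"
    "\<And>k i l j. k \<ge> 1 \<Longrightarrow> l \<ge> 1 \<Longrightarrow> i < d_const CARD('p) k \<Longrightarrow> j < d_const CARD('p) l \<Longrightarrow>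
      (\<integral>x. g k i x * g l j x \<partial>uniform_sphere) = (if k = l \<and> i = j then 1 else 0)"
    "\<And>k x z. k \<ge> 1 \<Longrightarrow> norm x = 1 \<Longrightarrow> norm z = 1 \<Longrightarrow>
      h_fun CARD('p) k (x \<bullet> z) = (\<Sum>i<d_const CARD('p) k. g k i x * g k i z)"
    using spherical_harmonics[OF p2] by blast
  interpret A: sobolev_array f K \<kappa>' \<delta> C M v g "d_const CARD('p)"
  proof (unfold_locales, goal_cases)
    case (4 x)
    then have "\<bar>f x - 1\<bar> \<le> C2 * \<bar>x\<bar>" using t2(3)[of x] \<delta>(3) f0 by simp
    also have "\<dots> \<le> C * \<bar>x\<bar>" using C by (intro mult_right_mono) auto
    finally show ?case .
  next
    case (5 x)
    then have "\<bar>f x - (\<Sum>b\<le>K. (deriv ^^ b) f 0 / fact b * x ^ b)\<bar> \<le> C1 * \<bar>x\<bar> ^ Suc K"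
      using t1(3)[of x] \<delta>(2) by simp
    also have "\<dots> \<le> C * \<bar>x\<bar> ^ Suc K" using C by (intro mult_right_mono) auto
    finally show ?case .
  next
    case (8 n)
    show ?case using \<delta>(1) assms(8) by (simp add: \<kappa>'_def)
  next
    case (9 n)
    show ?case by (simp add: \<kappa>'_def)
  next
    case 15
    show ?case using assms(4) p(1) by simp
  qed (fact p2 K ang C C\<delta> \<kappa>'_lim M_def refl v0 g)+
  have P_eq: "eventually (\<lambda>n. P n = A.P n) sequentially"
    using \<kappa>'_eq by eventually_elim (simp add: assms(11) A.P_def M_def rotsym_sample_def)
  have rate: "eventually (\<lambda>n. (real n powr (1 / (2 * real K)) * \<kappa> n) ^ K = sqrt n * \<kappa>' n ^ K) sequentially"
    using \<kappa>'_eq by eventually_elim (use K rate_power in auto)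
  \<comment> \<open>Parts (i) and (ii) are one statement about the limit c of the rescaled
    concentration, with c = 0 and c = \<tau>.\<close>
  have conv: "weak_conv_m (\<lambda>n. distr (P n) borel (sobolev_stat v n)) (weighted_chi_square (\<lambda>k. (v k)\<^sup>2) (d_const p) \<xi>)"
    if c: "(\<lambda>n. real n powr (1 / (2 * real K)) * \<kappa> n) \<longlonglongrightarrow> c"
      and \<xi>: "\<xi> = (\<lambda>k. if k = K then real (d_const p K) * ((deriv ^^ K) f 0)\<^sup>2 * c ^ (2 * K) / (sphere_weight p K)\<^sup>2 else 0)" for c \<xi>
  proof -
    have l: "(\<lambda>n. sqrt n * \<kappa>' n ^ K) \<longlonglongrightarrow> c ^ K"
      by (rule Lim_transform_eventually[OF tendsto_power[OF c] rate])
    have "A.\<xi> (c ^ K) = \<xi>"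
      by (auto simp: A.\<xi>_def[OF l] \<xi> A.drift_def p(1) power_mult_distrib power_divide power_mult[symmetric] mult.commute)
    then have "weak_conv_m (\<lambda>n. distr (A.P n) borel (sobolev_stat v n)) (weighted_chi_square (\<lambda>k. (v k)\<^sup>2) (d_const p) \<xi>)"
      using A.stat_weak_limit[OF l] unfolding p(1) by (simp only:)
    moreover have "eventually (\<lambda>n. distr (P n) borel (sobolev_stat v n) = distr (A.P n) borel (sobolev_stat v n)) sequentially"
      using P_eq by eventually_elim (simp only:)
    ultimately show ?thesis by (rule weak_conv_m_eventually_cong[rotated])
  qed
  have part0: "\<forall>k\<ge>1. xi_const p f k \<tau> = real (d_const p k) * ((deriv ^^ k) f 0)\<^sup>2 * \<tau> ^ (2 * k) / (\<Prod>l<k. (real p + 2 * real l)\<^sup>2)"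
    using xi_const_eq[OF p(2)] by (simp add: sphere_weight_def prod_power_distrib)
  have part1: "weak_conv_m (\<lambda>n. distr (P n) borel (sobolev_stat v n)) (weighted_chi_square (\<lambda>k. (v k)\<^sup>2) (d_const p) (\<lambda>k. 0))"
    if o: "\<kappa> \<in> o(\<lambda>n. real n powr (- 1 / (2 * real k\<^sub>v)))"
  proof (rule conv)
    \<comment> \<open>The case c = 0; the non-centrality then vanishes because \<open>K\<close>
      \<ge> 1.\<close>
    have "(\<lambda>n. \<kappa> n / real n powr (- 1 / (2 * real K))) \<longlonglongrightarrow> 0"
      using smalloD_tendsto[OF o] unfolding K_def .
    then show "(\<lambda>n. real n powr (1 / (2 * real K)) * \<kappa> n) \<longlonglongrightarrow> 0"
      by (simp add: powr_minus_divide mult.commute)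
  qed (use K in \<open>auto simp: fun_eq_iff\<close>)
  have part2: "weak_conv_m (\<lambda>n. distr (P n) borel (sobolev_stat v n)) (weighted_chi_square (\<lambda>k. (v k)\<^sup>2) (d_const p)
      (\<lambda>k. if k = k\<^sub>v then xi_const p f k\<^sub>v \<tau> else 0))"
    if \<kappa>: "\<forall>n\<ge>1. \<kappa> n = real n powr (- 1 / (2 * real k\<^sub>v)) * \<tau>"
  proof (rule conv)
    have "eventually (\<lambda>n. \<tau> = real n powr (1 / (2 * real K)) * \<kappa> n) sequentially"
      using eventually_ge_at_top[of 1]
    proof eventually_elim
      case (elim n)
      have "real n powr (1 / (2 * real K)) * real n powr (- 1 / (2 * real K)) = 1"
        using elim by (simp flip: powr_add)
      then show ?case using \<kappa> elim by (simp add: K_def mult.assoc[symmetric])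
    qed
    then show "(\<lambda>n. real n powr (1 / (2 * real K)) * \<kappa> n) \<longlonglongrightarrow> \<tau>"
      by (rule Lim_transform_eventually[OF tendsto_const])
  qed (use xi_const_eq[OF p(2) K(1)] in \<open>auto simp: K_def\<close>)
  \<comment> \<open>Stated for every real c, so that it covers the upper quantile without
    information on its value.\<close>
  have part3: "(\<lambda>n. measure (P n) {u \<in> space (P n). sobolev_stat v n u > c}) \<longlonglongrightarrow> 1"
    if l: "filterlim (\<lambda>n. real n powr (1 / (2 * real k\<^sub>v)) * \<kappa> n) at_top sequentially" and D: "(deriv ^^ k\<^sub>v) f 0 \<noteq> 0" for c
  proof -
    have "filterlim (\<lambda>n. (real n powr (1 / (2 * real K)) * \<kappa> n) ^ K) at_top sequentially"
      using l K unfolding K_def[symmetric] by (intro filterlim_pow_at_top) auto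
    then have "filterlim (\<lambda>n. sqrt n * \<kappa>' n ^ K) at_top sequentially"
      by (rule filterlim_cong[OF refl refl rate, THEN iffD1])
    moreover have "A.drift K \<noteq> 0"
      unfolding A.drift_def using D[folded K_def] sphere_weight_pos[of "CARD('p)" K] by simp
    ultimately have "(\<lambda>n. measure (A.P n) {u \<in> space (A.P n). sobolev_stat v n u > c}) \<longlonglongrightarrow> 1"
      by (rule A.stat_consistent)
    then show ?thesis
      by (rule Lim_transform_eventually) (use P_eq in eventually_elim, simp)
  qed
  show ?thesis
    using part0 part1 part2 part3 by blast
qed

end
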